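(* (i) If $f$ is a (orientation-preserving) $C^{1+bv}$ circle diffeomorphism with irrational rotation number and absolutely continuous derivative, then its asymptotic distortion vanishes: $\mathrm{dist}_\infty(f)=0$. (ii) However, there exist $C^{1+bv}$ circle diffeomorphisms of irrational rotation number whose asymptotic distortion does not vanish.
   Context: All diffeomorphisms are orientation preserving; $\mathrm{S}^1=\mathbb{R}/\mathbb{Z}$. A $C^{1+bv}$ diffeomorphism is a $C^1$ diffeomorphism $f$ such that $\log(Df)$ has finite total variation; $\mathrm{var}$ denotes total variation on $\mathrm{S}^1$. The asymptotic distortion of a $C^{1+bv}$ diffeomorphism $f$ is $$\mathrm{dist}_\infty(f):=\lim_{n\to\infty}\frac{\mathrm{var}(\log(Df^n))}{n},$$ where $f^n$ is the $n$-th iterate; the limit exists by subadditivity of $n\mapsto\mathrm{var}(\log(Df^n))$. *)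

theory Defs
  imports "HOL-Analysis.Analysis"
begin

section \<open>The circle and lifts of circle maps\<close>

quotient_type circle = real / "\<lambda>x y :: real. x - y \<in> \<int>"
  morphisms rep_circle circle_proj
proof (rule equivpI)
  show "reflp (\<lambda>x y :: real. x - y \<in> \<int>)" by (simp add: reflp_def)
  show "symp (\<lambda>x y :: real. x - y \<in> \<int>)"
    unfolding symp_def by (metis Ints_minus minus_diff_eq)
  show "transp (\<lambda>x y :: real. x - y \<in> \<int>)"
  proof (rule transpI)
    fix x y z :: real
    assume "x - y \<in> \<int>" "y - z \<in> \<int>"
    then have "(x - y) + (y - z) \<in> \<int>" by (rule Ints_add)
    then show "x - z \<in> \<int>" by simp
  qed
qed

definition circle_lift :: "(real \<Rightarrow> real) \<Rightarrow> (circle \<Rightarrow> circle) \<Rightarrow> bool" where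
  "circle_lift F f \<longleftrightarrow> continuous_on UNIV F \<and> (\<forall>x. circle_proj (F x) = f (circle_proj x))"

text \<open>
  Continuous lifts of a given map differ by integer constants. The derivative, and the rotation
  number modulo the integers, therefore do not depend on the lift or representative chosen in their
  definitions; see the lemmas \<open>circle_deriv_eq\<close> and \<open>rotation_number_eq\<close>.
\<close>

definition circle_deriv :: "(circle \<Rightarrow> circle) \<Rightarrow> circle \<Rightarrow> real" where
  "circle_deriv f p = deriv (SOME F. circle_lift F f) (rep_circle p)"

text \<open>
  Every continuous circle map has a continuous lift, and regularity on the circle is regularity of
  the lift, since \<open>circle_proj\<close> is a local diffeomorphism.
\<close>

definition circle_C1 :: "(circle \<Rightarrow> circle) \<Rightarrow> bool" where
  "circle_C1 f \<longleftrightarrow> (\<exists>F. circle_lift F f \<and> F C1_differentiable_on UNIV)"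

definition circle_C1_diffeo :: "(circle \<Rightarrow> circle) \<Rightarrow> bool" where
  "circle_C1_diffeo f \<longleftrightarrow>
     bij f \<and> circle_C1 f \<and> circle_C1 (inv f) \<and> (\<forall>p. circle_deriv f p > 0)"
  \<comment> \<open>the last conjunct says that \<open>f\<close> preserves the orientation\<close>


section \<open>Total variation and absolute continuity\<close>

definition total_variation :: "(real \<Rightarrow> real) \<Rightarrow> real \<Rightarrow> real \<Rightarrow> ereal" where
  "total_variation g a b =
     Sup {ereal (\<Sum>i<n. \<bar>g (t (Suc i)) - g (t i)\<bar>) | n t.
            mono_on {..n} t \<and> t ` {..n} \<subseteq> {a..b}}"

definition absolutely_continuous_on_interval :: "(real \<Rightarrow> real) \<Rightarrow> real \<Rightarrow> real \<Rightarrow> bool" where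
  "absolutely_continuous_on_interval g a b \<longleftrightarrow>
     (\<forall>\<epsilon>>0. \<exists>\<delta>>0. \<forall>(n::nat) u v.
        (\<forall>i<n. a \<le> u i \<and> u i \<le> v i \<and> v i \<le> b) \<and>
        disjoint_family_on (\<lambda>i. {u i<..<v i}) {..<n} \<and>
        (\<Sum>i<n. v i - u i) < \<delta>
        \<longrightarrow> (\<Sum>i<n. \<bar>g (v i) - g (u i)\<bar>) < \<epsilon>)"

text \<open>
  On the circle both notions are those of the pullback to the fundamental domain \<open>[0,1]\<close>, where
  both endpoints are included so that no jump at the base point is missed.
\<close>

definition circle_variation :: "(circle \<Rightarrow> real) \<Rightarrow> ereal" where
  "circle_variation \<phi> = total_variation (\<lambda>x. \<phi> (circle_proj x)) 0 1"

definition circle_absolutely_continuous :: "(circle \<Rightarrow> real) \<Rightarrow> bool" where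
  "circle_absolutely_continuous \<phi> \<longleftrightarrow>
     absolutely_continuous_on_interval (\<lambda>x. \<phi> (circle_proj x)) 0 1"


section \<open>Rotation number and asymptotic distortion\<close>

definition translation_number :: "(real \<Rightarrow> real) \<Rightarrow> real" where
  "translation_number F = lim (\<lambda>n. (F ^^ n) 0 / real n)"

definition rotation_number :: "(circle \<Rightarrow> circle) \<Rightarrow> circle" where
  "rotation_number f = circle_proj (translation_number (SOME F. circle_lift F f))"

definition irrational_rotation_number :: "(circle \<Rightarrow> circle) \<Rightarrow> bool" where
  "irrational_rotation_number f \<longleftrightarrow> rotation_number f \<notin> circle_proj ` \<rat>"

definition circle_C1bv_diffeo :: "(circle \<Rightarrow> circle) \<Rightarrow> bool" where
  "circle_C1bv_diffeo f \<longleftrightarrow>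
     circle_C1_diffeo f \<and> circle_variation (\<lambda>p. ln (circle_deriv f p)) < \<infinity>"

text \<open>
  The iterates of a $C^{1+bv}$ diffeomorphism are again of this class, so that for such maps all
  the variations below are finite, and the limit exists by subadditivity.
\<close>

definition asymptotic_distortion :: "(circle \<Rightarrow> circle) \<Rightarrow> real" where
  "asymptotic_distortion f =
     lim (\<lambda>n. real_of_ereal (circle_variation (\<lambda>p. ln (circle_deriv (f ^^ n) p))) / real n)"


section \<open>Independence of the lift\<close>

lemma circle_proj_eq_iff: "circle_proj x = circle_proj y \<longleftrightarrow> x - y \<in> \<int>"
  by (rule circle.abs_eq_iff)

lemma circle_proj_rep [simp]: "circle_proj (rep_circle p) = p"
  by (rule Quotient3_abs_rep[OF Quotient3_circle])

lemma continuous_Ints_constant: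
  fixes h :: "real \<Rightarrow> real"
  assumes "continuous_on UNIV h" "\<And>x. h x \<in> \<int>"
  obtains k :: int where "\<And>x. h x = of_int k"
proof -
  have "h constant_on UNIV"
  proof (rule continuous_discrete_range_constant)
    fix x :: real
    show "\<exists>e>0. \<forall>y. y \<in> UNIV \<and> h y \<noteq> h x \<longrightarrow> e \<le> norm (h y - h x)"
    proof (intro exI[of _ 1] conjI allI impI)
      fix y assume "y \<in> UNIV \<and> h y \<noteq> h x"
      moreover have "h y - h x \<in> \<int>" using assms(2) by (intro Ints_diff)
      ultimately show "1 \<le> norm (h y - h x)"
        using Ints_nonzero_abs_ge1[of "h y - h x"] by simp
    qed simp
  qed (use assms in auto)
  then obtain c where c: "\<And>x. h x = c" by (auto simp: constant_on_def)
  moreover obtain k where "c = of_int k" using assms(2)[of 0] unfolding c by (rule Ints_cases)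
  ultimately show ?thesis using that by auto
qed

lemma circle_lift_unique:
  assumes "circle_lift F f" "circle_lift G f"
  obtains k :: int where "\<And>x. G x = F x + of_int k"
proof -
  have "continuous_on UNIV (\<lambda>x. G x - F x)"
    using assms by (intro continuous_on_diff) (auto simp: circle_lift_def)
  moreover have "G x - F x \<in> \<int>" for x
    using assms by (simp add: circle_lift_def flip: circle_proj_eq_iff)
  ultimately obtain k :: int where "\<And>x. G x - F x = of_int k"
    by (rule continuous_Ints_constant) blast
  then have "\<And>x. G x = F x + of_int k" by (simp add: algebra_simps)
  then show ?thesis by (rule that)
qed

lemma circle_lift_shift:
  assumes "circle_lift F f"
  shows "circle_lift (\<lambda>x. F (x + of_int m)) f"
proof -
  have "circle_proj (x + of_int m) = circle_proj x" for x
    by (simp add: circle_proj_eq_iff)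
  moreover have "continuous_on UNIV (\<lambda>x. F (x + of_int m))"
    by (rule continuous_on_compose2[of UNIV F])
       (use assms in \<open>simp_all add: circle_lift_def continuous_on_add\<close>)
  ultimately show ?thesis using assms by (simp add: circle_lift_def)
qed

lemma circle_lift_some: "circle_lift F f \<Longrightarrow> circle_lift (SOME F. circle_lift F f) f"
  by (rule someI[where P = "\<lambda>F. circle_lift F f"])

lemma circle_deriv_eq:
  assumes "circle_lift F f" "F differentiable at x"
  shows "circle_deriv f (circle_proj x) = deriv F x"
proof -
  define y where "y = rep_circle (circle_proj x)"
  have "x - y \<in> \<int>" unfolding y_def by (simp flip: circle_proj_eq_iff)
  then obtain m where "x - y = of_int m" by (rule Ints_cases)
  then have m: "x = y + of_int m" by simp
  define G where "G = (SOME F. circle_lift F f)"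
  have "circle_lift G f" unfolding G_def by (rule circle_lift_some[OF assms(1)])
  then obtain k :: int where "\<And>z. G z = F (z + of_int m) + of_int k"
    using circle_lift_unique[OF circle_lift_shift[OF assms(1)]] by blast
  then have G: "G = (\<lambda>z. F (z + of_int m) + of_int k)" by auto
  have "(F has_real_derivative deriv F x) (at x)"
    using assms(2) by (simp add: DERIV_deriv_iff_real_differentiable)
  then have "((\<lambda>z. F (z + of_int m)) has_real_derivative deriv F x) (at y)"
    unfolding m by (simp add: DERIV_shift)
  then have "(G has_real_derivative deriv F x) (at y)"
    unfolding G by (auto intro!: derivative_eq_intros)
  then show ?thesis
    by (simp add: circle_deriv_def DERIV_imp_deriv flip: G_def y_def)
qed

lemma rotation_number_eq:
  assumes F: "circle_lift F f" "\<And>x. F (x + 1) = F x + 1"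
    and lim: "(\<lambda>n. (F ^^ n) 0 / real n) \<longlonglongrightarrow> \<tau>"
  shows "rotation_number f = circle_proj \<tau>"
proof -
  define G where "G = (SOME F. circle_lift F f)"
  have "circle_lift G f" unfolding G_def by (rule circle_lift_some[OF F(1)])
  then obtain k :: int where G: "\<And>z. G z = F z + of_int k"
    using circle_lift_unique[OF F(1)] by blast
  have nat: "F (x + of_nat j) = F x + of_nat j" for x j
  proof (induction j)
    case (Suc j)
    then show ?case using F(2)[of "x + of_nat j"] by (simp add: algebra_simps)
  qed simp
  have int: "F (x + of_int j) = F x + of_int j" for x j
  proof (cases "j \<ge> 0")
    case True
    then show ?thesis using nat[of x "nat j"] by simp
  next
    case False
    then show ?thesis using nat[of "x + of_int j" "nat (- j)"] by simp
  qed
  have iter: "(G ^^ n) 0 = (F ^^ n) 0 + of_int (int n * k)" for n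
  proof (induction n)
    case (Suc n)
    have "(G ^^ Suc n) 0 = F ((F ^^ n) 0 + of_int (int n * k)) + of_int k"
      by (simp only: funpow.simps comp_apply Suc.IH G)
    also have "\<dots> = (F ^^ Suc n) 0 + of_int (int (Suc n) * k)"
      unfolding int by (simp add: algebra_simps)
    finally show ?case .
  qed simp
  have "(\<lambda>n. (F ^^ n) 0 / real n + of_int k) \<longlonglongrightarrow> \<tau> + of_int k"
    by (intro tendsto_intros lim)
  moreover have "eventually (\<lambda>n. (F ^^ n) 0 / real n + of_int k = (G ^^ n) 0 / real n) sequentially"
    using eventually_gt_at_top[of 0] by eventually_elim (simp add: iter field_simps)
  ultimately have "(\<lambda>n. (G ^^ n) 0 / real n) \<longlonglongrightarrow> \<tau> + of_int k"
    by (rule Lim_transform_eventually)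
  then have "translation_number G = \<tau> + of_int k"
    unfolding translation_number_def by (rule limI)
  then show ?thesis
    by (simp add: rotation_number_def circle_proj_eq_iff flip: G_def)
qed

end

theory Submission
  imports Defs
begin

text \<open>
  (i) The density \<open>\<psi>\<close> of the absolutely continuous function \<open>ln (D f)\<close> has mean zero, and the variation
  of \<open>ln (D f\<^sup>n)\<close> is the \<open>L\<^sup>1\<close> norm of the \<open>n\<close>-th Birkhoff sum of \<open>\<psi>\<close> under the isometry
  \<open>U g = (g \<circ> f) \<cdot> D f\<close>. Cutting \<open>\<psi>\<close> along a tower of arcs over a closest return and moving all pieces to
  the base changes \<open>\<psi>\<close> by a coboundary. By Denjoy's theorem the arcs are short, so \<open>\<psi>\<close>, which may be taken continuous, is
  almost constant on each of them, and by bounded distortion the positive and the negative pieces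
  become comparable to Lebesgue measure on the base. Hence a definite proportion of the mass cancels,
  and iterating this contraction shows that the Birkhoff averages tend to \<open>0\<close> in \<open>L\<^sup>1\<close>.

  (ii) Let \<open>ln (D f)\<close> be the Cantor function minus the identity, up to a constant. In \<open>ln (D f\<^sup>n)\<close> the
  singular increasing parts all add up, and so do the Lipschitz decreasing parts; a singular
  function cannot cancel a Lipschitz one, so the variation is exactly \<open>2 n\<close>. Composing with a
  suitable rotation makes the rotation number irrational without changing the derivative.
\<close>

section \<open>Functions of bounded variation on the circle\<close>

text \<open>Each moved piece costs a coboundary whose Birkhoff sums stay bounded in n, so only the
  mass left on the base counts. The contraction factor 1 - exp (- 2 * V) / 4 depends on the map
  alone: one half because the positive and the negative part each carry half of the mass, one half
  because the tower covers the circle at most twice, and exp (- 2 * V) for the distortion. This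
  uniformity is what allows iteration. The moved density itself is discontinuous and cannot be fed
  back into the argument; the Birkhoff averages of \<psi> can, being continuous, of mean zero and
  cohomologous to \<psi>. Passing to a continuous density means approximating ln (D f) in variation;
  composing with a lift does not increase variation, so the error in ln (D f^n) grows at most
  linearly in n, with small slope. This approximation is where absolute continuity enters, and it
  comes from lengths of inscribed polygons instead of Lebesgue differentiation. In (ii) the rotation
  number of the translates changes continuously by 1, hence passes through irrational
  values.\<close>

lemma add_of_int:
  fixes g :: "real \<Rightarrow> real"
  assumes "\<And>x. g (x + 1) = g x + c"
  shows "g (x + of_int k) = g x + of_int k * c"
proof -
  have nat: "g (x + of_nat j) = g x + of_nat j * c" for x j
  proof (induction j)
    case (Suc j)
    then show ?case using assms[of "x + of_nat j"] by (simp add: algebra_simps)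
  qed simp
  show ?thesis
  proof (cases "k \<ge> 0")
    case True
    then show ?thesis using nat[of x "nat k"] by simp
  next
    case False
    then show ?thesis using nat[of "x + of_int k" "nat (- k)"] by (simp add: algebra_simps)
  qed
qed

text \<open>\<open>T\<close> plays the role of the accumulated variation, extended to the line so
  that it gains \<open>C\<close> per period. Sums, compositions with lifts and families of disjoint
  arcs then reduce to properties of \<open>T\<close>, without partitions.\<close>

definition variation_le :: "(real \<Rightarrow> real) \<Rightarrow> real \<Rightarrow> bool" where
  "variation_le h C \<longleftrightarrow>
     (\<exists>T. (\<forall>u v. u \<le> v \<longrightarrow> \<bar>h v - h u\<bar> \<le> T v - T u) \<and> (\<forall>x. T (x + 1) = T x + C))"

lemma total_variation_upper:
  assumes "mono_on {..n} t" "t ` {..n} \<subseteq> {a..b}"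
  shows "ereal (\<Sum>i<n. \<bar>g (t (Suc i)) - g (t i)\<bar>) \<le> total_variation g a b"
  unfolding total_variation_def using assms by (intro Sup_upper) blast

lemma total_variation_le_iff:
  "total_variation g a b \<le> B \<longleftrightarrow>
     (\<forall>n t. mono_on {..n::nat} t \<longrightarrow> t ` {..n} \<subseteq> {a..b} \<longrightarrow>
        ereal (\<Sum>i<n. \<bar>g (t (Suc i)) - g (t i)\<bar>) \<le> B)"
  unfolding total_variation_def by (subst Sup_le_iff) blast

lemma variation_le_imp_total_variation_le:
  assumes "variation_le h C"
  shows "total_variation h a (a + 1) \<le> ereal C"
proof -
  obtain T where T: "\<And>u v. u \<le> v \<Longrightarrow> \<bar>h v - h u\<bar> \<le> T v - T u" "\<And>x. T (x + 1) = T x + C"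
    using assms unfolding variation_le_def by blast
  show ?thesis
    unfolding total_variation_le_iff
  proof (intro allI impI)
    fix n :: nat and t :: "nat \<Rightarrow> real"
    assume t: "mono_on {..n} t" "t ` {..n} \<subseteq> {a..a+1}"
    have "(\<Sum>i<n. \<bar>h (t (Suc i)) - h (t i)\<bar>) \<le> (\<Sum>i<n. T (t (Suc i)) - T (t i))"
      by (intro sum_mono T mono_onD[OF t(1)]) auto
    also have "\<dots> = T (t n) - T (t 0)"
      by (rule sum_lessThan_telescope)
    also have "\<dots> \<le> T (a + 1) - T a"
    proof -
      have "a \<le> t 0" "t n \<le> a + 1" using t(2) by auto
      then have "0 \<le> T (a + 1) - T (t n)" "0 \<le> T (t 0) - T a"
        using T(1)[of "t n" "a + 1"] T(1)[of a "t 0"] abs_ge_zero order_trans by blast+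
      then show ?thesis by simp
    qed
    finally show "ereal (\<Sum>i<n. \<bar>h (t (Suc i)) - h (t i)\<bar>) \<le> ereal C"
      by (simp add: T(2))
  qed
qed

text \<open>Every partition of \<open>{0..u}\<close> can be prolonged by the points \<open>u\<close>
  and \<open>v\<close>; the increment from its last point to \<open>u\<close> only enlarges the
  sum.\<close>

lemma total_variation_append:
  assumes "0 \<le> u" "u \<le> v"
  shows "total_variation h 0 u + ereal \<bar>h v - h u\<bar> \<le> total_variation h 0 v"
proof -
  have "total_variation h 0 u \<le> total_variation h 0 v - ereal \<bar>h v - h u\<bar>"
    unfolding total_variation_le_iff
  proof (intro allI impI)
    fix n :: nat and t :: "nat \<Rightarrow> real"
    assume t: "mono_on {..n} t" "t ` {..n} \<subseteq> {0..u}"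
    define s where "s = (\<lambda>i. if i \<le> n then t i else if i = Suc n then u else v)"
    have range_t: "0 \<le> t i" "t i \<le> u" if "i \<le> n" for i
      using t(2) that by auto
    have "mono_on {..n+2} s"
    proof (rule mono_onI)
      fix i j assume "i \<in> {..n+2}" "j \<in> {..n+2}" "i \<le> j"
      then show "s i \<le> s j"
        using assms range_t[of i] mono_onD[OF t(1), of i j] by (auto simp: s_def)
    qed
    moreover have "s ` {..n+2} \<subseteq> {0..v}"
    proof (rule image_subsetI)
      fix i assume "i \<in> {..n+2}"
      then show "s i \<in> {0..v}" using assms range_t[of i] by (auto simp: s_def)
    qed
    ultimately have "ereal (\<Sum>i<n+2. \<bar>h (s (Suc i)) - h (s i)\<bar>) \<le> total_variation h 0 v"
      by (rule total_variation_upper)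
    moreover have "(\<Sum>i<n. \<bar>h (s (Suc i)) - h (s i)\<bar>) = (\<Sum>i<n. \<bar>h (t (Suc i)) - h (t i)\<bar>)"
      by (intro sum.cong) (auto simp: s_def)
    then have "(\<Sum>i<n. \<bar>h (t (Suc i)) - h (t i)\<bar>) + \<bar>h v - h u\<bar> \<le> (\<Sum>i<n+2. \<bar>h (s (Suc i)) - h (s i)\<bar>)"
      by (simp add: s_def)
    ultimately have "ereal ((\<Sum>i<n. \<bar>h (t (Suc i)) - h (t i)\<bar>) + \<bar>h v - h u\<bar>) \<le> total_variation h 0 v"
      by (meson ereal_less_eq(3) order_trans)
    then show "ereal (\<Sum>i<n. \<bar>h (t (Suc i)) - h (t i)\<bar>) \<le> total_variation h 0 v - ereal \<bar>h v - h u\<bar>"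
      by (subst ereal_le_minus) (auto simp: plus_ereal.simps(1)[symmetric] simp del: plus_ereal.simps)
  qed
  then show ?thesis by (subst (asm) ereal_le_minus) auto
qed

lemma total_variation_nonneg: "a \<le> b \<Longrightarrow> 0 \<le> total_variation h a b"
  using total_variation_upper[of 0 "\<lambda>_. a" a b h] by (auto simp: mono_on_def zero_ereal_def)

lemma total_variation_le_imp_variation_le:
  assumes per: "\<And>x. h (x + 1) = h x" and le: "total_variation h 0 1 \<le> ereal C"
  shows "variation_le h C"
proof -
  define V where "V = (\<lambda>x. real_of_ereal (total_variation h 0 x))"
  have V: "total_variation h 0 x = ereal (V x)" if "0 \<le> x" "x \<le> 1" for x
  proof -
    have "total_variation h 0 x \<le> total_variation h 0 x + ereal \<bar>h 1 - h x\<bar>"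
      by (intro add_increasing2) auto
    also have "\<dots> \<le> total_variation h 0 1"
      using that by (intro total_variation_append) auto
    also note le
    finally show ?thesis
      unfolding V_def using total_variation_nonneg[OF that(1), of h]
      by (cases "total_variation h 0 x") auto
  qed
  have step: "\<bar>h v - h u\<bar> \<le> V v - V u" if "0 \<le> u" "u \<le> v" "v \<le> 1" for u v
    using total_variation_append[OF that(1,2), of h] V[of u] V[of v] that by auto
  have V1: "V 1 \<le> C" using V[of 1] le by simp
  have V0: "0 \<le> V 0" using total_variation_nonneg[of 0 0 h] V[of 0] by simp
  have per_int: "h (x + of_int k) = h x" for x k
    using add_of_int[of h 0 x k] per by simp
  \<comment> \<open>\<open>C\<close> is only an upper bound for \<open>V 1\<close>, so
    \<open>T\<close> may jump upwards at the integers. Domination survives this, and across an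
    integer the two partial increments join because \<open>h 1 = h 0\<close>.\<close>
  define T where "T = (\<lambda>x. of_int \<lfloor>x\<rfloor> * C + V (frac x))"
  have "\<bar>h v - h u\<bar> \<le> T v - T u" if "u \<le> v" for u v
  proof -
    have hfrac: "h x = h (frac x)" for x
      using per_int[of "frac x" "\<lfloor>x\<rfloor>"] by (simp add: frac_def)
    have fr: "0 \<le> frac x" "frac x \<le> 1" for x :: real
      using frac_lt_1[of x] by auto
    show ?thesis
    proof (cases "\<lfloor>u\<rfloor> = \<lfloor>v\<rfloor>")
      case True
      then have "frac u \<le> frac v" using that by (simp add: frac_def)
      then show ?thesis
        using step[of "frac u" "frac v"] fr True hfrac by (simp add: T_def)
    next
      case False
      then have "\<lfloor>u\<rfloor> + 1 \<le> \<lfloor>v\<rfloor>" using floor_mono[OF that] by linarith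
      moreover have "0 \<le> C" using V0 V1 step[of 0 1] by simp
      ultimately have "of_int (\<lfloor>u\<rfloor> + 1) * C \<le> of_int \<lfloor>v\<rfloor> * C"
        by (intro mult_right_mono) simp_all
      moreover have "\<bar>h 1 - h (frac u)\<bar> \<le> C - V (frac u)"
        using step[of "frac u" 1] fr V1 by force
      moreover have "\<bar>h (frac v) - h 0\<bar> \<le> V (frac v)"
        using step[of 0 "frac v"] fr V0 by force
      moreover have "h 1 = h 0" using per[of 0] by simp
      ultimately show ?thesis
        using hfrac[of u] hfrac[of v] by (simp add: T_def algebra_simps)
    qed
  qed
  moreover have "T (x + 1) = T x + C" for x
    by (simp add: T_def frac_1_eq) (simp add: algebra_simps)
  ultimately show ?thesis unfolding variation_le_def by blast
qed

lemma variation_le_mono: "variation_le h C \<Longrightarrow> C \<le> C' \<Longrightarrow> variation_le h C'"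
  unfolding variation_le_def
proof (elim exE conjE)
  fix T assume C: "C \<le> C'" and T: "\<forall>u v. u \<le> v \<longrightarrow> \<bar>h v - h u\<bar> \<le> T v - T u" "\<forall>x. T (x + 1) = T x + C"
  show "\<exists>T. (\<forall>u v. u \<le> v \<longrightarrow> \<bar>h v - h u\<bar> \<le> T v - T u) \<and> (\<forall>x. T (x + 1) = T x + C')"
  proof (intro exI conjI allI impI)
    fix u v :: real assume "u \<le> v"
    then have "\<bar>h v - h u\<bar> \<le> T v - T u" using T by blast
    moreover have "(C' - C) * u \<le> (C' - C) * v" using C \<open>u \<le> v\<close> by (intro mult_left_mono) auto
    ultimately show "\<bar>h v - h u\<bar> \<le> (T v + (C' - C) * v) - (T u + (C' - C) * u)" by linarith
  qed (use T in \<open>simp add: algebra_simps\<close>)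
qed

lemma variation_le_add:
  assumes "variation_le g A" "variation_le h B"
  shows "variation_le (\<lambda>x. g x + h x) (A + B)"
proof -
  obtain T S where
    "\<And>u v. u \<le> v \<Longrightarrow> \<bar>g v - g u\<bar> \<le> T v - T u" "\<And>x. T (x + 1) = T x + A"
    "\<And>u v. u \<le> v \<Longrightarrow> \<bar>h v - h u\<bar> \<le> S v - S u" "\<And>x. S (x + 1) = S x + B"
    using assms unfolding variation_le_def by metis
  then show ?thesis
    unfolding variation_le_def by (intro exI[of _ "\<lambda>x. T x + S x"]) (smt (verit))
qed

lemma variation_le_const: "variation_le (\<lambda>_. c) 0"
  unfolding variation_le_def by (intro exI[of _ "\<lambda>_. 0"]) simp

lemma variation_le_sum:
  fixes h :: "'b \<Rightarrow> real \<Rightarrow> real"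
  assumes "finite A" "\<And>i. i \<in> A \<Longrightarrow> variation_le (h i) (C i)"
  shows "variation_le (\<lambda>x. \<Sum>i\<in>A. h i x) (\<Sum>i\<in>A. C i)"
  using assms
proof (induction A rule: finite_induct)
  case empty then show ?case by (simp add: variation_le_const)
next
  case (insert a A) then show ?case by (simp add: variation_le_add)
qed

lemma variation_le_mono_function:
  assumes "mono h" "\<And>x. h (x + 1) = h x + C"
  shows "variation_le h C"
  unfolding variation_le_def using assms
  by (intro exI[of _ h]) (simp add: monoD)

lemma variation_le_uminus: "variation_le h C \<Longrightarrow> variation_le (\<lambda>x. - h x) C"
  unfolding variation_le_def by (simp add: abs_minus_commute)

lemma variation_le_compose:
  assumes "variation_le h C" "mono F" "\<And>x. F (x + 1) = F x + 1"
  shows "variation_le (\<lambda>x. h (F x)) C"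
proof -
  obtain T where "\<And>u v. u \<le> v \<Longrightarrow> \<bar>h v - h u\<bar> \<le> T v - T u" "\<And>x. T (x + 1) = T x + C"
    using assms(1) unfolding variation_le_def by metis
  then show ?thesis
    unfolding variation_le_def using assms(2,3)
    by (intro exI[of _ "\<lambda>x. T (F x)"]) (simp add: monoD)
qed

section \<open>Lifts\<close>

locale diffeo_lift =
  fixes F D :: "real \<Rightarrow> real"
  assumes has_deriv: "\<And>x. (F has_real_derivative D x) (at x)"
    and cont_D: "continuous_on UNIV D"
    and D_pos: "\<And>x. 0 < D x"
    and F_add_1: "\<And>x. F (x + 1) = F x + 1"
begin

lemma strict_mono_F: "strict_mono F"
  by (rule strict_monoI) (meson DERIV_pos_imp_increasing has_deriv D_pos)

lemma cont_F: "continuous_on S F"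
  by (meson DERIV_continuous_on has_deriv has_field_derivative_at_within)

lemma deriv_F: "deriv F x = D x"
  using has_deriv by (rule DERIV_imp_deriv)

lemma D_add_1: "D (x + 1) = D x"
proof -
  have "((\<lambda>x. F (x + 1)) has_real_derivative D (x + 1)) (at x)"
    by (rule DERIV_shift[THEN iffD1]) (rule has_deriv)
  moreover have "((\<lambda>x. F x + 1) has_real_derivative D x) (at x)"
    using has_deriv[of x] by (auto intro!: derivative_eq_intros)
  ultimately show ?thesis
    unfolding F_add_1 by (rule DERIV_unique)
qed

lemma iter_add_1: "(F ^^ n) (x + 1) = (F ^^ n) x + 1"
  by (induction n) (auto simp: F_add_1)

lemma strict_mono_iter: "strict_mono (F ^^ n)"
  by (induction n) (auto intro!: strict_monoI dest: strict_monoD[OF strict_mono_F] strict_monoD)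

lemma mono_iter: "mono (F ^^ n)"
  using strict_mono_iter by (rule strict_mono_mono)

lemma cont_iter: "continuous_on S (F ^^ n)"
proof (induction n)
  case (Suc n)
  then show ?case
    unfolding funpow.simps by (intro continuous_on_compose cont_F)
qed (simp add: id_def)

lemma iter_has_deriv: "((F ^^ n) has_real_derivative (\<Prod>k<n. D ((F ^^ k) x))) (at x)"
proof (induction n)
  case 0
  then show ?case using DERIV_ident[of "at x"] by (simp add: id_def)
next
  case (Suc n)
  have "((\<lambda>x. F ((F ^^ n) x)) has_real_derivative D ((F ^^ n) x) * (\<Prod>k<n. D ((F ^^ k) x))) (at x)"
    by (rule DERIV_chain2[OF has_deriv Suc])
  then show ?case by (simp add: o_def mult.commute)
qed

lemma F_surj: "\<exists>x. F x = y"
proof -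
  have nat: "F (of_int k) = F 0 + of_int k" for k
    using add_of_int[of F 1 0 k] F_add_1 by simp
  define k where "k = \<lfloor>y - F 0\<rfloor>"
  have "F (of_int k) \<le> y" "y \<le> F (of_int (k + 1))"
    using nat[of k] nat[of "k + 1"] unfolding k_def by simp_all linarith+
  then show ?thesis
    using IVT'[of F "of_int k" y "of_int (k + 1)"] cont_F by auto
qed

lemma bij_F: "bij F"
  unfolding bij_def surj_def using strict_mono_imp_inj_on[OF strict_mono_F] F_surj by metis

end

lemma circle_lift_funpow:
  assumes "circle_lift F f"
  shows "circle_lift (F ^^ n) (f ^^ n)"
proof (induction n)
  case 0
  then show ?case by (simp add: circle_lift_def id_def)
next
  case (Suc n)
  then show ?case
    using assms unfolding circle_lift_def funpow.simps
    by (auto simp: o_def intro: continuous_on_compose2[of UNIV F])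
qed

context diffeo_lift
begin

lemma ln_deriv_iter:
  assumes "circle_lift F f"
  shows "ln (circle_deriv (f ^^ n) (circle_proj x)) = (\<Sum>k<n. ln (D ((F ^^ k) x)))"
proof -
  have "circle_deriv (f ^^ n) (circle_proj x) = deriv (F ^^ n) x"
    using circle_lift_funpow[OF assms] iter_has_deriv[of n x]
    by (intro circle_deriv_eq) (auto simp: real_differentiable_def)
  also have "\<dots> = (\<Prod>k<n. D ((F ^^ k) x))"
    by (rule DERIV_imp_deriv[OF iter_has_deriv])
  finally show ?thesis
    using D_pos by (simp add: ln_prod less_imp_neq[symmetric])
qed

lemma circle_deriv_lift:
  assumes "circle_lift F f"
  shows "circle_deriv f (circle_proj x) = D x"
proof -
  have "F differentiable at x" using has_deriv real_differentiable_def by blast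
  with assms show ?thesis by (simp add: circle_deriv_eq deriv_F)
qed

lemma circle_variation_ln_deriv:
  assumes "circle_lift F f"
  shows "circle_variation (\<lambda>p. ln (circle_deriv (f ^^ n) p)) =
           total_variation (\<lambda>x. \<Sum>k<n. ln (D ((F ^^ k) x))) 0 1"
  by (simp add: circle_variation_def ln_deriv_iter[OF assms])

end

lemma circle_C1_diffeo_lift:
  assumes "circle_C1_diffeo f"
  obtains F D where "diffeo_lift F D" "circle_lift F f"
proof -
  have bij: "bij f" and pos: "\<And>p. circle_deriv f p > 0"
    using assms by (auto simp: circle_C1_diffeo_def)
  obtain F where F: "circle_lift F f" "F C1_differentiable_on UNIV"
    using assms by (auto simp: circle_C1_diffeo_def circle_C1_def)
  then obtain D where D: "\<And>x. (F has_real_derivative D x) (at x)" "continuous_on UNIV D"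
    unfolding C1_differentiable_on_def has_real_derivative_iff_has_vector_derivative by blast
  have D_pos: "0 < D x" for x
  proof -
    have "F differentiable at x" using D real_differentiable_def by blast
    then have "circle_deriv f (circle_proj x) = D x"
      using F(1) D(1) by (simp add: circle_deriv_eq DERIV_imp_deriv)
    then show ?thesis using pos by metis
  qed
  have smono: "strict_mono F"
    by (rule strict_monoI) (meson DERIV_pos_imp_increasing D D_pos)
  obtain k :: int where k: "\<And>x. F (x + 1) = F x + of_int k"
    using circle_lift_unique[OF F(1) circle_lift_shift[OF F(1), of 1]] by auto
  have "F 0 < F 1" using smono by (simp add: strict_monoD)
  with k[of 0] have "k > 0" by simp
  \<comment> \<open>For a larger degree, \<open>F\<close> would take the value
    \<open>F 0 + 1\<close> strictly between 0 and 1, and two distinct points of the circle would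
    have the same image.\<close>
  have "k = 1"
  proof (rule ccontr)
    assume "k \<noteq> 1"
    with \<open>k > 0\<close> have k2: "k \<ge> 2" by simp
    have "F 0 \<le> F 0 + 1" "F 0 + 1 \<le> F 1" using k[of 0] k2 by simp_all
    then obtain y where y: "0 \<le> y" "y \<le> 1" "F y = F 0 + 1"
      using IVT'[of F 0 "F 0 + 1" 1] F(1)
      by (auto simp: circle_lift_def intro: continuous_on_subset)
    then have "circle_proj (F y) = circle_proj (F 0)"
      by (simp add: circle_proj_eq_iff)
    then have "f (circle_proj y) = f (circle_proj 0)"
      using F(1) by (simp add: circle_lift_def)
    then have "y - 0 \<in> \<int>"
      using bij by (metis bij_def circle_proj_eq_iff inj_eq)
    then obtain j where "y = of_int j" by (auto elim: Ints_cases)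
    with y have "y = 0 \<or> y = 1" by (auto simp: of_int_le_1_iff)
    with y k[of 0] k2 show False by auto
  qed
  then have "diffeo_lift F D"
    using D D_pos k by unfold_locales auto
  then show ?thesis using F(1) that by blast
qed

section \<open>Smooth approximation of absolutely continuous functions\<close>

lemma sum_abs_mono_subsequence_le:
  fixes a :: "nat \<Rightarrow> real"
  assumes "\<And>i. i < n \<Longrightarrow> d i \<le> d (Suc i)"
  shows "(\<Sum>i<n. \<bar>a (d (Suc i)) - a (d i)\<bar>) \<le> (\<Sum>j\<in>{d 0..<d n}. \<bar>a (Suc j) - a j\<bar>)"
    and "d 0 \<le> d n"
proof -
  have "(\<Sum>i<n. \<bar>a (d (Suc i)) - a (d i)\<bar>) \<le> (\<Sum>j\<in>{d 0..<d n}. \<bar>a (Suc j) - a j\<bar>) \<and> d 0 \<le> d n"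
    using assms
  proof (induction n)
    case (Suc n)
    have le: "d n \<le> d (Suc n)" using Suc.prems by simp
    have "\<bar>a (d (Suc n)) - a (d n)\<bar> \<le> (\<Sum>j\<in>{d n..<d (Suc n)}. \<bar>a (Suc j) - a j\<bar>)"
      using sum_abs[of "\<lambda>j. a (Suc j) - a j" "{d n..<d (Suc n)}"] by (simp add: sum_Suc_diff'[OF le])
    moreover have "(\<Sum>j\<in>{d 0..<d (Suc n)}. \<bar>a (Suc j) - a j\<bar>) =
        (\<Sum>j\<in>{d 0..<d n}. \<bar>a (Suc j) - a j\<bar>) + (\<Sum>j\<in>{d n..<d (Suc n)}. \<bar>a (Suc j) - a j\<bar>)"
      using Suc le by (intro sum.atLeastLessThan_concat[symmetric]) auto
    ultimately show ?case using Suc le by fastforce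
  qed simp
  then show "(\<Sum>i<n. \<bar>a (d (Suc i)) - a (d i)\<bar>) \<le> (\<Sum>j\<in>{d 0..<d n}. \<bar>a (Suc j) - a j\<bar>)"
    and "d 0 \<le> d n" by auto
qed

text \<open>By continuity a partition sum is the limit of the sums over its points rounded down to
  level \<open>m\<close>. Rounded points may coincide but stay ordered, so the triangle inequality
  bounds such a sum by the full dyadic one.\<close>

lemma total_variation_le_dyadic:
  assumes cont: "continuous_on {0..1} g"
    and dy: "\<And>m. n0 \<le> m \<Longrightarrow> (\<Sum>j<2^m. \<bar>g (real (Suc j) / 2^m) - g (real j / 2^m)\<bar>) \<le> C"
  shows "total_variation g 0 1 \<le> ereal C"
  unfolding total_variation_le_iff
proof (intro allI impI)
  fix n :: nat and t :: "nat \<Rightarrow> real"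
  assume t: "mono_on {..n} t" "t ` {..n} \<subseteq> {0..1}"
  define d where "d = (\<lambda>m i. nat \<lfloor>t i * 2 ^ m\<rfloor>)"
  have t01: "0 \<le> t i" "t i \<le> 1" if "i \<le> n" for i using t(2) that by auto
  have d_bounds: "real (d m i) \<le> t i * 2^m" "t i * 2^m < real (d m i) + 1" if "i \<le> n" for m i
    using t01[OF that] unfolding d_def by simp_all
  have d_lim: "(\<lambda>m. real (d m i) / 2^m) \<longlonglongrightarrow> t i" if "i \<le> n" for i
  proof (rule tendsto_sandwich)
    show "\<forall>\<^sub>F m in sequentially. t i - (1/2)^m \<le> real (d m i) / 2^m"
    proof (intro always_eventually allI)
      fix m
      have "(t i * 2^m - 1) / 2^m \<le> real (d m i) / 2^m"
        using d_bounds(2)[OF that, of m] by (intro divide_right_mono) auto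
      then show "t i - (1/2)^m \<le> real (d m i) / 2^m"
        by (simp add: diff_divide_distrib power_one_over)
    qed
    show "\<forall>\<^sub>F m in sequentially. real (d m i) / 2^m \<le> t i"
      using d_bounds(1)[OF that] by (intro always_eventually allI) (simp add: field_simps)
    have "(\<lambda>m. t i - (1/2)^m) \<longlonglongrightarrow> t i - 0"
      by (intro tendsto_diff tendsto_const LIMSEQ_realpow_zero) auto
    then show "(\<lambda>m. t i - (1/2)^m) \<longlonglongrightarrow> t i" by simp
  qed simp
  have d_range: "real (d m i) / 2^m \<in> {0..1}" if "i \<le> n" for m i
  proof -
    have "real (d m i) \<le> 1 * 2^m"
      using d_bounds(1)[OF that, of m] t01[OF that] by (meson mult_right_mono order_trans zero_le_numeral zero_le_power)
    then show ?thesis by simp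
  qed
  have g_lim: "(\<lambda>m. g (real (d m i) / 2^m)) \<longlonglongrightarrow> g (t i)" if "i \<le> n" for i
    using cont d_lim[OF that] t01[OF that] d_range[OF that]
    by (intro continuous_on_tendsto_compose[OF cont]) auto
  have "(\<lambda>m. \<Sum>i<n. \<bar>g (real (d m (Suc i)) / 2^m) - g (real (d m i) / 2^m)\<bar>) \<longlonglongrightarrow>
          (\<Sum>i<n. \<bar>g (t (Suc i)) - g (t i)\<bar>)"
    by (intro tendsto_sum tendsto_rabs tendsto_diff g_lim) auto
  moreover have "\<exists>N. \<forall>m\<ge>N. (\<Sum>i<n. \<bar>g (real (d m (Suc i)) / 2^m) - g (real (d m i) / 2^m)\<bar>) \<le> C"
  proof (intro exI[of _ n0] allI impI)
    fix m assume m: "n0 \<le> m"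
    have "d m i \<le> d m (Suc i)" if "i < n" for i
      unfolding d_def using that mono_onD[OF t(1), of i "Suc i"]
      by (intro nat_mono floor_mono mult_right_mono) auto
    then have "(\<Sum>i<n. \<bar>g (real (d m (Suc i)) / 2^m) - g (real (d m i) / 2^m)\<bar>)
        \<le> (\<Sum>j\<in>{d m 0..<d m n}. \<bar>g (real (Suc j) / 2^m) - g (real j / 2^m)\<bar>)"
      by (rule sum_abs_mono_subsequence_le(1)[where a = "\<lambda>j. g (real j / 2^m)"])
    also have "\<dots> \<le> (\<Sum>j<2^m. \<bar>g (real (Suc j) / 2^m) - g (real j / 2^m)\<bar>)"
    proof (rule sum_mono2)
      have "real (d m n) \<le> 2^m" using d_range[of n m] by simp
      then have "d m n \<le> 2^m" by (metis of_nat_le_iff of_nat_numeral of_nat_power)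
      then show "{d m 0..<d m n} \<subseteq> {..<2^m}" by auto
    qed auto
    also have "\<dots> \<le> C" by (rule dy[OF m])
    finally show "(\<Sum>i<n. \<bar>g (real (d m (Suc i)) / 2^m) - g (real (d m i) / 2^m)\<bar>) \<le> C" .
  qed
  ultimately have "(\<Sum>i<n. \<bar>g (t (Suc i)) - g (t i)\<bar>) \<le> C"
    by (rule LIMSEQ_le_const2)
  then show "ereal (\<Sum>i<n. \<bar>g (t (Suc i)) - g (t i)\<bar>) \<le> ereal C" by simp
qed

lemma continuous_on_frac:
  fixes g :: "real \<Rightarrow> real"
  assumes "continuous_on {0..1} g" "g 0 = g 1"
  shows "continuous_on UNIV (\<lambda>x. g (frac x))"
proof -
  have piece: "continuous_on {of_int n..of_int n + 1} (\<lambda>x. g (frac x))" for n :: int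
  proof -
    have "continuous_on {of_int n..of_int n + 1} (\<lambda>x. g (x - of_int n))"
      by (rule continuous_on_compose2[OF assms(1)]) (auto intro!: continuous_intros)
    moreover have "g (frac x) = g (x - of_int n)" if "x \<in> {of_int n..of_int n + 1}" for x
    proof (cases "x = of_int n + 1")
      case True
      then show ?thesis using assms(2) by (simp add: frac_def)
    next
      case False
      with that have "\<lfloor>x\<rfloor> = n" by (intro floor_unique) auto
      then show ?thesis by (simp add: frac_def)
    qed
    ultimately show ?thesis by (subst continuous_on_cong[OF refl]) auto
  qed
  have "isCont (\<lambda>x. g (frac x)) x" for x
  proof -
    \<comment> \<open>\<open>x\<close> may itself be the integer \<open>n\<close>; gluing the cells
      on both sides of \<open>n\<close> makes it an interior point.\<close>
    define n where "n = \<lfloor>x\<rfloor>"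
    have "continuous_on ({of_int (n - 1)..of_int (n - 1) + 1} \<union> {of_int n..of_int n + 1}) (\<lambda>x. g (frac x))"
      using piece[of "n - 1"] piece[of n] by (intro continuous_on_closed_Un) auto
    moreover have "{of_int (n - 1)..of_int (n - 1) + 1} \<union> {of_int n..of_int n + 1} = {of_int n - 1..of_int n + (1::real)}"
      by auto
    ultimately have c: "continuous_on {of_int n - 1..of_int n + 1} (\<lambda>x. g (frac x))" by simp
    have "x \<in> interior {of_int n - 1..of_int n + 1}"
      unfolding n_def interior_atLeastAtMost_real by simp linarith
    then show ?thesis using continuous_on_interior[OF c] by blast
  qed
  then show ?thesis by (simp add: continuous_on_eq_continuous_at)
qed

lemma antiderivative_exists:
  fixes f :: "real \<Rightarrow> real"
  assumes "continuous_on UNIV f"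
  obtains g where "\<And>x. (g has_real_derivative f x) (at x)"
proof -
  have "\<exists>g. \<forall>x. -\<infinity> < ereal x \<longrightarrow> ereal x < \<infinity> \<longrightarrow> (g has_vector_derivative f x) (at x)"
    using assms by (intro einterval_antiderivative) (auto simp: continuous_on_eq_continuous_at)
  then show ?thesis using that by (auto simp: has_real_derivative_iff_has_vector_derivative)
qed

lemma antiderivative_add_1:
  fixes g :: "real \<Rightarrow> real"
  assumes g: "\<And>x. (g has_real_derivative b x) (at x)" and b: "\<And>x. b (x + 1) = b x"
  shows "g (x + 1) = g x + (g 1 - g 0)"
proof -
  have "((\<lambda>x. g (x + 1) - g x) has_real_derivative 0) (at x)" for x
  proof -
    have "((\<lambda>x. g (x + 1)) has_real_derivative b (x + 1)) (at x)"
      by (rule DERIV_shift[THEN iffD1]) (rule g)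
    from DERIV_diff[OF this g[of x]] show ?thesis by (simp add: b)
  qed
  then have "g (x + 1) - g x = g (0 + 1) - g 0" by (intro DERIV_isconst_all) auto
  then show ?thesis by simp
qed

section \<open>Arc length as a strictly convex function of the slope\<close>

definition arclen :: "real \<Rightarrow> real" where "arclen s = sqrt (1 + s\<^sup>2)"

lemma arclen_ge_1: "1 \<le> arclen s"
  unfolding arclen_def by simp

lemma arclen_le: "arclen s \<le> 1 + \<bar>s\<bar>"
  unfolding arclen_def by (rule real_le_lsqrt) (auto simp: power2_eq_square algebra_simps)

lemma arclen_sq: "arclen s * arclen s = 1 + s * s"
  unfolding arclen_def by (simp add: power2_eq_square)

text \<open>The Bregman divergence of \<open>arclen\<close>: the height of its graph at
  \<open>r\<close> above the tangent at \<open>s\<close>.\<close>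

definition arc_gap :: "real \<Rightarrow> real \<Rightarrow> real" where
  "arc_gap s r = arclen r - arclen s - s / arclen s * (r - s)"

text \<open>Multiplied by \<open>arclen s\<close>, the gap becomes the product of the lengths of the
  vectors (1, s) and (1, r) minus their inner product. By Lagrange's identity the squares of these
  two differ by \<open>(r - s)\<^sup>2\<close>; factor the difference of squares.\<close>

lemma arc_gap_ge: "(r - s)\<^sup>2 / (2 * (1 + s\<^sup>2) * arclen r) \<le> arc_gap s r"
proof -
  define A B where "A = arclen s" and "B = arclen r"
  have A: "1 \<le> A" "A * A = 1 + s * s" and B: "1 \<le> B" "B * B = 1 + r * r"
    unfolding A_def B_def using arclen_ge_1 arclen_sq by auto
  have AB_pos: "0 < A * B" using A(1) B(1) by simp
  have gap: "arc_gap s r * A = A * B - (1 + s * r)"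
  proof -
    have "arc_gap s r * A = B * A - A * A - s * (r - s)"
      unfolding arc_gap_def A_def[symmetric] B_def[symmetric] using A(1) by (simp add: field_simps)
    then show ?thesis by (simp add: A(2) algebra_simps)
  qed
  have sq: "(A * B) * (A * B) = (1 + s * r) * (1 + s * r) + (r - s)\<^sup>2"
  proof -
    have "(A * B) * (A * B) = (A * A) * (B * B)" by (simp add: ac_simps)
    then show ?thesis unfolding A(2) B(2) by (simp add: power2_eq_square algebra_simps)
  qed
  have abs_le: "\<bar>1 + s * r\<bar> \<le> A * B"
    by (rule abs_le_square_iff[THEN iffD2, of _ "A * B", simplified abs_of_pos[OF AB_pos]])
       (use sq in \<open>simp add: power2_eq_square\<close>)
  have "(r - s)\<^sup>2 = (A * B - (1 + s * r)) * (A * B + (1 + s * r))"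
    using sq by (simp add: algebra_simps)
  also have "\<dots> \<le> (A * B - (1 + s * r)) * (2 * (A * B))"
    using abs_le by (intro mult_left_mono) auto
  also have "\<dots> = arc_gap s r * (2 * (A * A) * B)"
    unfolding gap[symmetric] by (simp add: ac_simps)
  finally have "(r - s)\<^sup>2 \<le> arc_gap s r * (2 * (1 + s\<^sup>2) * B)"
    using A(2) by (simp add: power2_eq_square)
  moreover have "0 < 2 * (1 + s\<^sup>2) * B" using B(1) by (simp add: add_pos_nonneg)
  ultimately show ?thesis
    unfolding B_def by (simp add: divide_le_eq)
qed

lemma arc_gap_nonneg: "0 \<le> arc_gap s r"
  using arclen_ge_1[of r] by (intro order_trans[OF _ arc_gap_ge] divide_nonneg_nonneg) auto

text \<open>\<open>r\<close> is unrestricted, but the denominator in \<open>arc_gap_ge\<close> grows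
  only linearly in t = \<open>\<bar>r - s\<bar>\<close>, so the gap still controls t. For t above
  \<open>\<epsilon>\<close> the quotient t / (1 + K + t) is at least its value at
  \<open>\<epsilon>\<close>, which yields the constant.\<close>

lemma abs_diff_le_arc_gap:
  assumes "0 < \<epsilon>" "\<bar>s\<bar> \<le> K"
  shows "\<bar>r - s\<bar> \<le> \<epsilon> + 2 * (1 + K\<^sup>2) * (1 + K + \<epsilon>) / \<epsilon> * arc_gap s r"
proof (cases "\<bar>r - s\<bar> \<le> \<epsilon>")
  case True
  have "0 \<le> 2 * (1 + K\<^sup>2) * (1 + K + \<epsilon>) / \<epsilon> * arc_gap s r"
    using assms arc_gap_nonneg by (intro mult_nonneg_nonneg divide_nonneg_nonneg) auto
  with True show ?thesis by linarith
next
  case False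
  define t where "t = \<bar>r - s\<bar>"
  have t: "\<epsilon> < t" "0 < t" using False assms unfolding t_def by auto
  have K: "0 \<le> K" using assms(2) by linarith
  have sq: "s\<^sup>2 \<le> K\<^sup>2" using assms(2) K by (simp add: abs_le_square_iff[symmetric])
  have arc: "arclen r \<le> 1 + K + t" using arclen_le[of r] assms(2) unfolding t_def by linarith
  have "t\<^sup>2 / (2 * (1 + K\<^sup>2) * (1 + K + t)) \<le> t\<^sup>2 / (2 * (1 + s\<^sup>2) * arclen r)"
    using sq arc arclen_ge_1[of r] by (intro divide_left_mono mult_mono mult_pos_pos) (auto simp: add_pos_nonneg K)
  also have "\<dots> \<le> arc_gap s r"
    using arc_gap_ge[of r s] unfolding t_def by simp
  finally have 1: "t\<^sup>2 \<le> arc_gap s r * (2 * (1 + K\<^sup>2) * (1 + K + t))"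
    using K t by (subst (asm) pos_divide_le_eq) (auto intro!: mult_pos_pos simp: add_pos_nonneg)
  have "\<epsilon> * (1 + K + t) \<le> t * (1 + K + \<epsilon>)"
  proof -
    have "\<epsilon> * (1 + K) \<le> t * (1 + K)" using t K by (intro mult_right_mono) auto
    then show ?thesis by (simp add: algebra_simps)
  qed
  then have "arc_gap s r * (2 * (1 + K\<^sup>2)) * (\<epsilon> * (1 + K + t)) \<le> arc_gap s r * (2 * (1 + K\<^sup>2)) * (t * (1 + K + \<epsilon>))"
    using arc_gap_nonneg by (intro mult_left_mono mult_nonneg_nonneg) auto
  moreover have "\<epsilon> * t\<^sup>2 \<le> \<epsilon> * (arc_gap s r * (2 * (1 + K\<^sup>2) * (1 + K + t)))"
    using assms(1) by (intro mult_left_mono[OF 1]) simp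
  ultimately have "t * (\<epsilon> * t) \<le> t * (arc_gap s r * (2 * (1 + K\<^sup>2)) * (1 + K + \<epsilon>))"
    by (simp add: power2_eq_square[of t] mult_ac)
  then have "\<epsilon> * t \<le> arc_gap s r * (2 * (1 + K\<^sup>2)) * (1 + K + \<epsilon>)"
    using t by simp
  then have "t \<le> 2 * (1 + K\<^sup>2) * (1 + K + \<epsilon>) / \<epsilon> * arc_gap s r"
    using assms(1) by (simp add: field_simps)
  then show ?thesis using assms(1) unfolding t_def by linarith
qed


section \<open>Inscribed polygons and their refinements\<close>

lemma sum_lessThan_mult:
  fixes f :: "nat \<Rightarrow> 'a::comm_monoid_add"
  shows "(\<Sum>j<N * r. f j) = (\<Sum>k<N. \<Sum>l<r. f (k * r + l))"
proof -
  have "(\<Sum>j\<in>{k * r..<k * r + r}. f j) = (\<Sum>l<r. f (k * r + l))" for k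
    using sum.shift_bounds_nat_ivl[of f 0 "k * r" r] by (simp add: add.commute lessThan_atLeast0)
  then show ?thesis by (simp add: sum.nat_group[symmetric])
qed

definition incr :: "(real \<Rightarrow> real) \<Rightarrow> nat \<Rightarrow> nat \<Rightarrow> real" where
  "incr h N k = h (real (Suc k) / real N) - h (real k / real N)"

lemma incr_refine:
  assumes "0 < r"
  shows "incr h N k = (\<Sum>l<r. incr h (N * r) (k * r + l))"
proof -
  define a where "a = (\<lambda>l. h (real (k * r + l) / real (N * r)))"
  have "(\<Sum>l<r. incr h (N * r) (k * r + l)) = (\<Sum>l<r. a (Suc l) - a l)"
    unfolding incr_def a_def by simp
  also have "\<dots> = a r - a 0" by (rule sum_lessThan_telescope)
  also have "a 0 = h (real k / real N)" using assms unfolding a_def by simp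
  also have "a r = h (real (Suc k) / real N)"
  proof -
    have "real (k * r + r) / real (N * r) = (real (Suc k) * real r) / (real N * real r)"
      by (simp add: algebra_simps)
    then show ?thesis using assms unfolding a_def by simp
  qed
  finally show ?thesis by (simp add: incr_def)
qed

text \<open>The length of the polygon inscribed in the graph of \<open>h\<close> over
  \<open>N\<close> equal cells of the unit interval: each summand is the hypotenuse over one cell,
  expressed through the slope \<open>real N * incr h N k\<close>.\<close>

definition polygon_length :: "(real \<Rightarrow> real) \<Rightarrow> nat \<Rightarrow> real" where
  "polygon_length h N = (\<Sum>k<N. arclen (real N * incr h N k) / real N)"

text \<open>The increments of the subcells add up to that of the cell, so the tangent terms in
  \<open>arc_gap\<close> cancel over each cell. The gain in length is therefore exactly a sum of
  nonnegative gaps.\<close>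

lemma polygon_length_refine:
  assumes N: "0 < N" and r: "0 < r"
  shows "polygon_length h (N * r) - polygon_length h N =
    (\<Sum>k<N. \<Sum>l<r. arc_gap (real N * incr h N k) (real (N * r) * incr h (N * r) (k * r + l)) / real (N * r))"
proof -
  have "(\<Sum>l<r. arc_gap (real N * incr h N k) (real (N * r) * incr h (N * r) (k * r + l)) / real (N * r)) =
        (\<Sum>l<r. arclen (real (N * r) * incr h (N * r) (k * r + l)) / real (N * r))
          - arclen (real N * incr h N k) / real N" for k
  proof -
    define S where "S = real N * incr h N k"
    define R where "R = (\<lambda>l. real (N * r) * incr h (N * r) (k * r + l))"
    define M where "M = real (N * r)"
    have M: "M \<noteq> 0" using N r by (simp add: M_def)
    have RM: "R l / M = incr h (N * r) (k * r + l)" for l using M by (simp add: R_def M_def)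
    have "(\<Sum>l<r. arc_gap S (R l) / M) =
        (\<Sum>l<r. arclen (R l) / M - arclen S / M - S / arclen S * (R l / M - S / M))"
      by (intro sum.cong) (auto simp: arc_gap_def diff_divide_distrib right_diff_distrib)
    also have "\<dots> = (\<Sum>l<r. arclen (R l) / M) - real r * (arclen S / M)
        - S / arclen S * ((\<Sum>l<r. R l / M) - real r * (S / M))"
      by (simp only: sum_subtractf sum_distrib_left[symmetric] sum_constant card_lessThan)
    also have "(\<Sum>l<r. R l / M) = incr h N k"
      unfolding RM by (rule incr_refine[OF r, symmetric])
    also have "real r * (S / M) = incr h N k" using N r by (simp add: S_def M_def)
    also have "real r * (arclen S / M) = arclen S / real N" using r by (simp add: M_def)
    finally show ?thesis by (simp add: S_def R_def M_def)
  qed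
  then show ?thesis
    unfolding polygon_length_def sum_lessThan_mult by (simp add: sum_subtractf)
qed

text \<open>Once the dyadic polygon length is almost maximal, strict convexity of \<open>arclen\<close> keeps moderate
  slopes almost unchanged under refinement; the cells with large slopes have small total length, so
  absolute continuity bounds the variation on them.\<close>

lemma ac_dyadic_interpolation:
  fixes h :: "real \<Rightarrow> real"
  assumes ac: "absolutely_continuous_on_interval h 0 1"
    and V: "\<And>N. 0 < N \<Longrightarrow> (\<Sum>k<N. \<bar>incr h N k\<bar>) \<le> V"
    and \<epsilon>: "0 < \<epsilon>"
  obtains n where "\<And>m. n \<le> m \<Longrightarrow>
    (\<Sum>k<2^n. \<Sum>l<2^(m-n). \<bar>incr h (2^m) (k * 2^(m-n) + l) - incr h (2^n) k / 2^(m-n)\<bar>) \<le> \<epsilon>"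
proof -
  \<comment> \<open>One share of \<open>\<epsilon>\<close> goes to small slope deviations, one to
    the gain in polygon length, and two to the cells with large slopes, where the increment of a
    cell is bounded by those of its subcells.\<close>
  define \<eta> where "\<eta> = \<epsilon> / 4"
  have \<eta>: "0 < \<eta>" using \<epsilon> by (simp add: \<eta>_def)
  obtain \<delta> where \<delta>: "0 < \<delta>" and small: "\<And>(n::nat) u v.
        (\<forall>i<n. 0 \<le> u i \<and> u i \<le> v i \<and> v i \<le> 1) \<Longrightarrow>
        disjoint_family_on (\<lambda>i. {u i<..<v i}) {..<n} \<Longrightarrow>
        (\<Sum>i<n. v i - u i) < \<delta> \<Longrightarrow> (\<Sum>i<n. \<bar>h (v i) - h (u i)\<bar>) < \<eta>"
    using ac \<eta> unfolding absolutely_continuous_on_interval_def by (elim allE[of _ \<eta>]) blast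
  have V0: "0 \<le> V" using V[of 1] by (simp add: order_trans[OF abs_ge_zero])
  \<comment> \<open>A Chebyshev bound: cells with slope above \<open>K\<close> have total length at
    most \<open>V / K\<close>, which is then below \<open>\<delta>\<close>.\<close>
  define K where "K = V / \<delta> + 1"
  have K: "0 < K" "V / K < \<delta>"
  proof -
    show "0 < K" using V0 \<delta> by (simp add: K_def add_nonneg_pos)
    then show "V / K < \<delta>" using \<delta> by (simp add: K_def field_simps)
  qed
  define c where "c = 2 * (1 + K\<^sup>2) * (1 + K + \<eta>) / \<eta>"
  have c: "0 < c" using K \<eta> unfolding c_def by (intro divide_pos_pos mult_pos_pos) (auto simp: add_pos_nonneg)
  have bdd: "polygon_length h N \<le> 1 + V" if "0 < N" for N
  proof -
    have "polygon_length h N \<le> (\<Sum>k<N. (1 + \<bar>real N * incr h N k\<bar>) / real N)"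
      unfolding polygon_length_def by (intro sum_mono divide_right_mono arclen_le) simp
    also have "\<dots> = (\<Sum>k<N. 1 / real N + \<bar>incr h N k\<bar>)"
      using that by (intro sum.cong) (auto simp: abs_mult add_divide_distrib)
    also have "\<dots> = 1 + (\<Sum>k<N. \<bar>incr h N k\<bar>)"
      using that by (simp add: sum.distrib)
    finally show ?thesis using V[OF that] by simp
  qed
  have bdd': "bdd_above (range (\<lambda>n. polygon_length h (2 ^ n)))"
    using bdd by (intro bdd_aboveI[of _ "1 + V"]) auto
  obtain n where n: "(SUP n. polygon_length h (2 ^ n)) - \<eta> / c < polygon_length h (2 ^ n)"
    using less_cSUP_iff[OF _ bdd', of "(SUP n. polygon_length h (2 ^ n)) - \<eta> / c"] \<eta> c by auto
  show ?thesis
  proof (rule that[of n])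
    fix m assume m: "n \<le> m"
    define N r where "N = (2::nat)^n" and "r = (2::nat)^(m-n)"
    have Nr: "0 < N" "0 < r" "N * r = 2^m" using m by (auto simp: N_def r_def power_add[symmetric])
    have gap_le: "c * (polygon_length h (N * r) - polygon_length h N) \<le> \<eta>"
    proof -
      have "polygon_length h (N * r) \<le> (SUP n. polygon_length h (2 ^ n))"
        unfolding Nr(3) using bdd' by (intro cSUP_upper) auto
      with n have "polygon_length h (N * r) - polygon_length h N \<le> \<eta> / c" by (simp add: N_def)
      with c show ?thesis by (simp add: field_simps)
    qed
    define bad where "bad = (\<lambda>k. K < \<bar>real N * incr h N k\<bar>)"
    let ?d = "\<lambda>k l. incr h (N * r) (k * r + l)"
    let ?g = "\<lambda>k l. arc_gap (real N * incr h N k) (real (N * r) * ?d k l) / real (N * r)"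
    let ?v = "\<lambda>k. \<Sum>l<r. \<bar>?d k l - incr h N k / r\<bar>"
    have bad_small: "(\<Sum>k<N. \<Sum>l<r. if bad k then \<bar>?d k l\<bar> else 0) \<le> \<eta>"
    proof -
      define M where "M = real (N * r)"
      have M: "0 < M" using Nr by (simp add: M_def)
      define u where "u = (\<lambda>j. real j / M)"
      \<comment> \<open>Subcells of good cells are collapsed to points, so that all
        \<open>N * r\<close> subcells can index the family tested against absolute
        continuity.\<close>
      define v where "v = (\<lambda>j. if bad (j div r) then real (Suc j) / M else real j / M)"
      have "(\<Sum>j<N * r. \<bar>h (v j) - h (u j)\<bar>) < \<eta>"
      proof (rule small)
        show "\<forall>i<N * r. 0 \<le> u i \<and> u i \<le> v i \<and> v i \<le> 1"
        proof (intro allI impI conjI)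
          fix i assume i: "i < N * r"
          then have "real (Suc i) \<le> M" unfolding M_def of_nat_le_iff by simp
          with M show "0 \<le> u i" "u i \<le> v i" "v i \<le> 1"
            by (auto simp: u_def v_def divide_right_mono)
        qed
        have sub: "{u i<..<v i} \<subseteq> {real i / M<..<real (Suc i) / M}" for i
          using M by (auto simp: u_def v_def)
        have "{u i<..<v i} \<inter> {u j<..<v j} = {}" if "i < j" for i j
        proof -
          have "real (Suc i) / M \<le> real j / M" using that M by (intro divide_right_mono) auto
          then show ?thesis using sub[of i] sub[of j] by fastforce
        qed
        then show "disjoint_family_on (\<lambda>i. {u i<..<v i}) {..<N * r}"
          unfolding disjoint_family_on_def by (metis Int_commute linorder_neqE_nat)
        have "(\<Sum>j<N * r. v j - u j) = (\<Sum>j<N * r. if bad (j div r) then 1 / M else 0)"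
          using M by (intro sum.cong) (auto simp: u_def v_def field_simps)
        also have "\<dots> = (\<Sum>k<N. if bad k then 1 / real N else 0)"
          unfolding sum_lessThan_mult
        proof (intro sum.cong refl)
          fix k
          have "(\<Sum>l<r. if bad ((k * r + l) div r) then 1 / M else 0) = (\<Sum>l<r. if bad k then 1 / M else 0)"
            by (intro sum.cong) auto
          then show "(\<Sum>l<r. if bad ((k * r + l) div r) then 1 / M else 0) = (if bad k then 1 / real N else 0)"
            using Nr(1,2) by (simp add: M_def)
        qed
        also have "\<dots> \<le> (\<Sum>k<N. \<bar>incr h N k\<bar> / K)"
        proof (rule sum_mono)
          fix k
          show "(if bad k then 1 / real N else 0) \<le> \<bar>incr h N k\<bar> / K"
            using K Nr by (auto simp: bad_def abs_mult field_simps)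
        qed
        also have "\<dots> \<le> V / K"
          unfolding sum_divide_distrib[symmetric] using V[OF Nr(1)] K by (intro divide_right_mono) auto
        also note K(2)
        finally show "(\<Sum>j<N * r. v j - u j) < \<delta>" .
      qed
      also have "(\<Sum>j<N * r. \<bar>h (v j) - h (u j)\<bar>) = (\<Sum>j<N * r. if bad (j div r) then \<bar>incr h (N * r) j\<bar> else 0)"
        by (intro sum.cong) (auto simp: u_def v_def incr_def M_def)
      also have "\<dots> = (\<Sum>k<N. \<Sum>l<r. if bad k then \<bar>?d k l\<bar> else 0)"
        unfolding sum_lessThan_mult by (intro sum.cong refl) auto
      finally show ?thesis by simp
    qed
    have "?v k \<le>
        \<eta> / real N + c * (\<Sum>l<r. ?g k l)
        + 2 * (\<Sum>l<r. if bad k then \<bar>?d k l\<bar> else 0)" for k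
    proof (cases "bad k")
      case True
      have "?v k \<le> (\<Sum>l<r. \<bar>?d k l\<bar> + \<bar>incr h N k\<bar> / r)"
        by (intro sum_mono order_trans[OF abs_triangle_ineq4]) simp
      also have "\<dots> = (\<Sum>l<r. \<bar>?d k l\<bar>) + \<bar>incr h N k\<bar>"
        using Nr by (simp add: sum.distrib)
      also have "\<bar>incr h N k\<bar> \<le> (\<Sum>l<r. \<bar>?d k l\<bar>)"
        unfolding incr_refine[OF Nr(2), of h N k] by (rule sum_abs)
      finally have "?v k \<le> 2 * (\<Sum>l<r. if bad k then \<bar>?d k l\<bar> else 0)"
        using True by simp
      moreover have "0 \<le> \<eta> / real N + c * (\<Sum>l<r. ?g k l)"
        using \<eta> c by (intro add_nonneg_nonneg mult_nonneg_nonneg sum_nonneg divide_nonneg_nonneg arc_gap_nonneg) auto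
      ultimately show ?thesis by linarith
    next
      case False
      have "\<bar>?d k l - incr h N k / r\<bar> \<le>
          \<eta> / real (N * r) + c * (?g k l)" for l
      proof -
        have "\<bar>?d k l - incr h N k / r\<bar> = \<bar>real (N * r) * ?d k l - real N * incr h N k\<bar> / real (N * r)"
        proof -
          have "?d k l - incr h N k / r = (real (N * r) * ?d k l - real N * incr h N k) / real (N * r)"
            using Nr(1,2) by (simp add: field_simps)
          then show ?thesis by (simp add: abs_divide)
        qed
        also have "\<dots> \<le> (\<eta> + c * arc_gap (real N * incr h N k) (real (N * r) * ?d k l)) / real (N * r)"
          using False \<eta> unfolding bad_def c_def by (intro divide_right_mono abs_diff_le_arc_gap) auto
        finally show ?thesis by (simp add: add_divide_distrib)
      qed
      then have "?v k \<le> (\<Sum>l<r. \<eta> / real (N * r) + c * (?g k l))"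
        by (rule sum_mono)
      also have "\<dots> = \<eta> / real N + c * (\<Sum>l<r. ?g k l)"
        using Nr(1,2) by (simp add: sum.distrib sum_distrib_left)
      finally show ?thesis using False by simp
    qed
    then have "(\<Sum>k<N. \<Sum>l<r. \<bar>?d k l - incr h N k / r\<bar>) \<le>
       (\<Sum>k<N. \<eta> / real N + c * (\<Sum>l<r. ?g k l)
        + 2 * (\<Sum>l<r. if bad k then \<bar>?d k l\<bar> else 0))"
      by (rule sum_mono)
    also have "\<dots> = \<eta> + c * (polygon_length h (N * r) - polygon_length h N)
        + 2 * (\<Sum>k<N. \<Sum>l<r. if bad k then \<bar>?d k l\<bar> else 0)"
      unfolding polygon_length_refine[OF Nr(1,2)] using Nr(1)
      by (simp only: sum.distrib sum_distrib_left[symmetric]) simp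
    also have "\<dots> \<le> \<epsilon>"
      using gap_le bad_small unfolding \<eta>_def by linarith
    finally show "(\<Sum>k<2^n. \<Sum>l<2^(m-n). \<bar>incr h (2^m) (k * 2^(m-n) + l) - incr h (2^n) k / 2^(m-n)\<bar>) \<le> \<epsilon>"
      unfolding Nr(3) by (simp add: N_def r_def)
  qed
qed

section \<open>Approximation by continuously differentiable functions in variation\<close>

lemma incr_diff: "incr (\<lambda>x. h x - g x) N k = incr h N k - incr g N k"
  by (simp add: incr_def)

lemma variation_le_incr:
  assumes "variation_le h V" "0 < N"
  shows "(\<Sum>k<N. \<bar>incr h N k\<bar>) \<le> V"
proof -
  have "ereal (\<Sum>k<N. \<bar>h (real (Suc k) / real N) - h (real k / real N)\<bar>) \<le> total_variation h 0 (0 + 1)"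
    using assms(2)
    by (intro total_variation_upper) (auto simp: mono_on_def divide_right_mono)
  also have "\<dots> \<le> ereal V" by (rule variation_le_imp_total_variation_le[OF assms(1)])
  finally show ?thesis by (simp add: incr_def)
qed

text \<open>The smooth approximation replaces the linear piece on each dyadic cell by a rescaled copy of the
  profile \<open>W\<close>, whose derivative \<open>w\<close> vanishes at both ends.\<close>

lemma ac_approx:
  fixes h :: "real \<Rightarrow> real"
  assumes per: "\<And>x. h (x + 1) = h x" and cont: "continuous_on UNIV h"
    and ac: "absolutely_continuous_on_interval h 0 1"
    and V: "variation_le h V" and \<epsilon>: "0 < \<epsilon>"
  shows "\<exists>g \<psi>. continuous_on UNIV \<psi> \<and> (\<forall>x. \<psi> (x + 1) = \<psi> x) \<and>
    (\<forall>x. (g has_real_derivative \<psi> x) (at x)) \<and> (\<forall>x. g (x + 1) = g x) \<and>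
    variation_le (\<lambda>x. h x - g x) \<epsilon>"
proof -
  have "0 < \<epsilon> / 2" using \<epsilon> by simp
  then obtain n where n: "\<And>m. n \<le> m \<Longrightarrow>
    (\<Sum>k<2^n. \<Sum>l<2^(m-n). \<bar>incr h (2^m) (k * 2^(m-n) + l) - incr h (2^n) k / 2^(m-n)\<bar>) \<le> \<epsilon> / 2"
    using ac_dyadic_interpolation[OF ac variation_le_incr[OF V], of "\<epsilon> / 2"] by blast
  define N where "N = (2::nat)^n"
  have N: "0 < N" by (simp add: N_def)
  \<comment> \<open>The flatness of the profile: replacing linear pieces by copies of
    \<open>W\<close> costs variation at most \<open>V / p\<close>.\<close>
  define p where "p = nat \<lceil>2 * V / \<epsilon>\<rceil> + 1"
  have p: "0 < p" "V / real p \<le> \<epsilon> / 2"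
  proof -
    show "0 < p" by (simp add: p_def)
    have "2 * V / \<epsilon> \<le> real p" unfolding p_def by linarith
    then show "V / real p \<le> \<epsilon> / 2" using \<epsilon> \<open>0 < p\<close> by (simp add: field_simps)
  qed
  \<comment> \<open>A plateau that drops to 0 at both ends, so that pieces on neighbouring cells
    join continuously. The factor normalises its integral over the unit interval, since 1 - (2t -
    1)^(2p) has integral 2p / (2p + 1) there.\<close>
  define w where "w = (\<lambda>t::real. (2 * p + 1) / (2 * p) * (1 - (2 * t - 1) ^ (2 * p)))"
  define W where "W = (\<lambda>t::real. (2 * p + 1) / (2 * p) * t - ((2 * t - 1) ^ (2 * p + 1) + 1) / (4 * p))"
  have W_deriv: "(W has_real_derivative w t) (at t)" for t
  proof -
    have "((\<lambda>t::real. (2 * t - 1) ^ (2 * p + 1)) has_real_derivative real (2 * p + 1) * (2 * t - 1) ^ (2 * p) * 2) (at t)"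
    proof -
      have "((\<lambda>t::real. 2 * t - 1) has_real_derivative 2) (at t)"
        by (auto intro!: derivative_eq_intros)
      from DERIV_power[OF this, of "2 * p + 1"] show ?thesis by (simp add: mult_ac)
    qed
    then have "(W has_real_derivative (2 * p + 1) / (2 * p) * 1 - (real (2 * p + 1) * (2 * t - 1) ^ (2 * p) * 2 + 0) / (4 * p)) (at t)"
      unfolding W_def by (intro DERIV_diff DERIV_cmult DERIV_ident DERIV_cdivide DERIV_add DERIV_const)
    moreover have "(2 * p + 1) / (2 * p) * 1 - (real (2 * p + 1) * z * 2 + 0) / (4 * p) = (2 * p + 1) / (2 * p) * (1 - z)" for z
      using p(1) by (simp add: field_simps)
    ultimately show ?thesis unfolding w_def by (simp only:)
  qed
  have w01: "w 0 = 0" "w 1 = 0" by (simp_all add: w_def)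
  have W01: "W 0 = 0" "W 1 = 1" using p(1) by (simp_all add: W_def field_simps)
  have W_id: "(\<Sum>l<r. \<bar>W (real (Suc l) / r) - W (real l / r) - 1 / r\<bar>) \<le> 1 / p" if r: "0 < r" for r :: nat
  proof -
    define z where "z = (\<lambda>l::nat. (2 * (real l / r) - 1) ^ (2 * p + 1))"
    \<comment> \<open>\<open>W\<close> minus the identity is a difference of two increasing
      functions, each rising by 1 / (2p) over the unit interval.\<close>
    have "\<bar>W (real (Suc l) / r) - W (real l / r) - 1 / r\<bar> \<le> 1 / (2 * p) * (1 / r) + (z (Suc l) - z l) / (4 * p)" for l
    proof -
      have "z l \<le> z (Suc l)"
        unfolding z_def by (intro power_mono_odd) (auto simp: divide_right_mono)
      then have "0 \<le> (z (Suc l) - z l) / (4 * p)" by simp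
      moreover have "0 \<le> 1 / (2 * p) * (1 / r)" by simp
      moreover have "W (real (Suc l) / r) - W (real l / r) - 1 / r = 1 / (2 * p) * (1 / r) - (z (Suc l) - z l) / (4 * p)"
      proof -
        have "W x - W y = (2 * p + 1) / (2 * p) * (x - y) - ((2 * x - 1) ^ (2 * p + 1) - (2 * y - 1) ^ (2 * p + 1)) / (4 * p)" for x y
        proof -
          have "c * x - (X + 1) / d - (c * y - (Y + 1) / d) = c * (x - y) - (X - Y) / d" for c d X Y :: real
            by (simp add: right_diff_distrib diff_divide_distrib add_divide_distrib)
          then show ?thesis unfolding W_def by blast
        qed
        from this[of "real (Suc l) / r" "real l / r"] have "W (real (Suc l) / r) - W (real l / r) =
          (2 * p + 1) / (2 * p) * (real (Suc l) / r - real l / r) - (z (Suc l) - z l) / (4 * p)"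
          unfolding z_def by simp
        also have "real (Suc l) / r - real l / r = 1 / r"
          by (simp add: diff_divide_distrib[symmetric])
        also have "(2 * p + 1) / (2 * p) * (1 / r) = 1 / r + 1 / (2 * p) * (1 / r)"
          using p(1) r by (simp add: field_simps)
        finally show ?thesis by simp
      qed
      ultimately show ?thesis by linarith
    qed
    then have "(\<Sum>l<r. \<bar>W (real (Suc l) / r) - W (real l / r) - 1 / r\<bar>) \<le>
        (\<Sum>l<r. 1 / (2 * p) * (1 / r) + (z (Suc l) - z l) / (4 * p))"
      by (rule sum_mono)
    also have "\<dots> = 1 / (2 * p) + (z r - z 0) / (4 * p)"
      using r by (simp add: sum.distrib sum_divide_distrib[symmetric] sum_lessThan_telescope)
    also have "\<dots> = 1 / p"
      using p(1) r by (simp add: z_def field_simps)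
    finally show ?thesis .
  qed
  \<comment> \<open>Outside its own cell each summand of \<open>\<psi>0\<close> is evaluated at 0 or
    1, where \<open>w\<close> vanishes; no case distinction on cells is needed to define a
    continuous sum.\<close>
  define clamp where "clamp = (\<lambda>t::real. max 0 (min 1 t))"
  define \<psi>0 where "\<psi>0 = (\<lambda>x. \<Sum>k<N. real N * incr h N k * w (clamp (real N * x - real k)))"
  define \<psi> where "\<psi> = (\<lambda>x. \<psi>0 (frac x))"
  have w_cont: "continuous_on S w" for S
    unfolding w_def by (intro continuous_intros)
  have "continuous_on {0..1} \<psi>0"
    unfolding \<psi>0_def clamp_def
    by (intro continuous_on_sum continuous_on_mult continuous_on_const
         continuous_on_compose2[OF w_cont[of UNIV]] continuous_on_max continuous_on_min continuous_intros) auto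
  moreover have "\<psi>0 0 = 0" unfolding \<psi>0_def by (simp add: clamp_def w01)
  moreover have "\<psi>0 1 = 0"
    unfolding \<psi>0_def
  proof (intro sum.neutral ballI)
    fix k assume "k \<in> {..<N}"
    then have "real (Suc k) \<le> real N" unfolding of_nat_le_iff by simp
    then have "clamp (real N * 1 - real k) = 1" by (simp add: clamp_def)
    then show "real N * incr h N k * w (clamp (real N * 1 - real k)) = 0" by (simp add: w01)
  qed
  ultimately have \<psi>_cont: "continuous_on UNIV \<psi>"
    unfolding \<psi>_def by (intro continuous_on_frac) auto
  have \<psi>_per: "\<psi> (x + 1) = \<psi> x" for x by (simp add: \<psi>_def frac_1_eq)
  obtain g where g: "\<And>x. (g has_real_derivative \<psi> x) (at x)"
    using antiderivative_exists[OF \<psi>_cont] by blast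
  have \<psi>_cell: "\<psi> x = real N * incr h N k * w (real N * x - real k)"
    if k: "k < N" and x: "real k < real N * x" "real N * x < real k + 1" for k x
  proof -
    have "real (Suc k) \<le> real N" using k unfolding of_nat_le_iff by simp
    with x(2) have "real N * x < real N * 1" by linarith
    then have "x < 1" using N mult_less_cancel_left_pos[of "real N" x 1] by simp
    moreover have "0 < real N * x" using x(1) by (meson le_less_trans of_nat_0_le_iff)
    then have "0 < x" by (simp add: zero_less_mult_iff)
    ultimately have fx: "frac x = x" by (simp add: frac_eq)
    have zero: "w (clamp (real N * x - real j)) = 0" if "j \<noteq> k" for j
    proof (cases "j < k")
      case True
      then have "real (Suc j) \<le> real k" unfolding of_nat_le_iff by simp
      then have "clamp (real N * x - real j) = 1" using x by (simp add: clamp_def)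
      then show ?thesis by (simp add: w01)
    next
      case False
      then have "real (Suc k) \<le> real j" using that unfolding of_nat_le_iff by simp
      then have "clamp (real N * x - real j) = 0" using x by (simp add: clamp_def)
      then show ?thesis by (simp add: w01)
    qed
    have "\<psi> x = (\<Sum>j\<in>{k}. real N * incr h N j * w (clamp (real N * x - real j)))"
      unfolding \<psi>_def \<psi>0_def fx using k zero by (intro sum.mono_neutral_right) auto
    also have "\<dots> = real N * incr h N k * w (real N * x - real k)"
      using x by (simp add: clamp_def)
    finally show ?thesis .
  qed
  have g_incr: "incr g (N * r) (k * r + l) = incr h N k * (W (real (Suc l) / r) - W (real l / r))"
    if k: "k < N" and l: "l < r" for k l r
  proof -
    define G where "G = (\<lambda>x. g x - incr h N k * W (real N * x - real k))"
    define a b where "a = real k / real N" and "b = (real k + 1) / real N"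
    have "a < b" using N by (simp add: a_def b_def divide_strict_right_mono)
    have Gd: "(G has_real_derivative \<psi> x - incr h N k * (w (real N * x - real k) * real N)) (at x)" for x
    proof -
      have "((\<lambda>x. real N * x - real k) has_real_derivative real N) (at x)"
        by (auto intro!: derivative_eq_intros)
      from DERIV_diff[OF g DERIV_cmult[OF DERIV_chain2[OF W_deriv this], of "incr h N k"]]
      show ?thesis unfolding G_def .
    qed
    have const: "G x = G a" if "a \<le> x" "x \<le> b" for x
    proof (rule DERIV_isconst2[of a b])
      show "continuous_on {a..b} G"
        by (rule DERIV_continuous_on) (rule has_field_derivative_at_within[OF Gd])
      show "(G has_real_derivative 0) (at x)" if "a < x" "x < b" for x
      proof -
        have "real k < real N * x" "real N * x < real k + 1"
          using that N by (auto simp: a_def b_def field_simps)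
        from \<psi>_cell[OF k this] Gd[of x] show ?thesis by (simp add: mult_ac)
      qed
    qed (use that \<open>a < b\<close> in auto)
    have pt: "real N * (real (k * r + i) / real (N * r)) - real k = real i / r" if "i \<le> r" for i
      using N l by (simp add: field_simps)
    have in_ab: "a \<le> real (k * r + i) / real (N * r)" "real (k * r + i) / real (N * r) \<le> b" if "i \<le> r" for i
    proof -
      have r: "0 < real r" using l by simp
      have "real k + real i / r = real N * (real (k * r + i) / real (N * r))" using pt[OF that] by simp
      moreover have "0 \<le> real i / r" "real i / r \<le> 1" using that r by auto
      ultimately have "real k \<le> real N * (real (k * r + i) / real (N * r))" 
         "real N * (real (k * r + i) / real (N * r)) \<le> real k + 1" by linarith+
      then show "a \<le> real (k * r + i) / real (N * r)" "real (k * r + i) / real (N * r) \<le> b"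
        unfolding a_def b_def using N by (simp_all add: pos_divide_le_eq pos_le_divide_eq mult.commute)
    qed
    define Y where "Y = (\<lambda>i. real (k * r + i) / real (N * r))"
    have "G (Y (Suc l)) = G a" "G (Y l) = G a"
      unfolding Y_def using l by (intro const in_ab; simp)+
    moreover have "G (Y i) = g (Y i) - incr h N k * W (real i / r)" if "i \<le> r" for i
      using pt[OF that] unfolding G_def Y_def by (simp only:)
    moreover have "incr g (N * r) (k * r + l) = g (Y (Suc l)) - g (Y l)"
      unfolding incr_def Y_def by (simp only: add_Suc_right)
    ultimately show ?thesis
      using l by (simp add: right_diff_distrib)
  qed
  have g_per: "g (x + 1) = g x" for x
  proof -
    have "g (x + 1) = g x + (g 1 - g 0)" by (rule antiderivative_add_1[OF g \<psi>_per])
    moreover have "g 1 - g 0 = incr g 1 0"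
      by (simp add: incr_def)
    moreover have "incr g 1 0 = (\<Sum>k<N. incr g (1 * N) (0 * N + k))"
      by (rule incr_refine[OF N])
    \<comment> \<open>With one subcell per cell, \<open>g_incr\<close> says that \<open>g\<close>
      and \<open>h\<close> have equal increments over each cell, so \<open>g\<close> inherits the
      periodicity of \<open>h\<close>.\<close>
    moreover have "\<dots> = (\<Sum>k<N. incr h N k)"
      using g_incr[of _ 0 1] by (intro sum.cong) (auto simp: W01)
    moreover have "\<dots> = incr h 1 0"
      using incr_refine[OF N, of h 1 0] by simp
    moreover have "incr h 1 0 = 0" using per[of 0] by (simp add: incr_def)
    ultimately show ?thesis by simp
  qed
  have "total_variation (\<lambda>x. h x - g x) 0 1 \<le> ereal \<epsilon>"
  proof (rule total_variation_le_dyadic[of _ n])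
    have "continuous_on {0..1} g"
      by (rule DERIV_continuous_on) (rule has_field_derivative_at_within[OF g])
    then show "continuous_on {0..1} (\<lambda>x. h x - g x)"
      by (intro continuous_on_diff continuous_on_subset[OF cont]) auto
  next
    fix m assume m: "n \<le> m"
    define r where "r = (2::nat)^(m-n)"
    have r: "0 < r" by (simp add: r_def)
    have Nr: "N * r = 2^m" using m by (simp add: N_def r_def power_add[symmetric])
    have "(\<Sum>j<2^m. \<bar>(h (real (Suc j) / 2^m) - g (real (Suc j) / 2^m)) - (h (real j / 2^m) - g (real j / 2^m))\<bar>)
       = (\<Sum>j<N * r. \<bar>incr (\<lambda>x. h x - g x) (N * r) j\<bar>)"
      unfolding Nr by (simp add: incr_def)
    also have "\<dots> = (\<Sum>k<N. \<Sum>l<r. \<bar>incr (\<lambda>x. h x - g x) (N * r) (k * r + l)\<bar>)"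
      by (rule sum_lessThan_mult)
    also have "\<dots> \<le> (\<Sum>k<N. \<Sum>l<r. \<bar>incr h (N * r) (k * r + l) - incr h N k / r\<bar> +
        \<bar>incr h N k\<bar> * \<bar>W (real (Suc l) / r) - W (real l / r) - 1 / r\<bar>)"
    proof (intro sum_mono)
      fix k l assume "k \<in> {..<N}" "l \<in> {..<r}"
      then have "incr (\<lambda>x. h x - g x) (N * r) (k * r + l) =
          (incr h (N * r) (k * r + l) - incr h N k / r) - incr h N k * (W (real (Suc l) / r) - W (real l / r) - 1 / r)"
        using g_incr[of k l r] by (simp add: incr_diff algebra_simps)
      then show "\<bar>incr (\<lambda>x. h x - g x) (N * r) (k * r + l)\<bar> \<le> \<bar>incr h (N * r) (k * r + l) - incr h N k / r\<bar> +
        \<bar>incr h N k\<bar> * \<bar>W (real (Suc l) / r) - W (real l / r) - 1 / r\<bar>"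
        by (metis abs_triangle_ineq4 abs_mult)
    qed
    also have "\<dots> = (\<Sum>k<N. \<Sum>l<r. \<bar>incr h (N * r) (k * r + l) - incr h N k / r\<bar>) +
        (\<Sum>k<N. \<bar>incr h N k\<bar> * (\<Sum>l<r. \<bar>W (real (Suc l) / r) - W (real l / r) - 1 / r\<bar>))"
      by (simp only: sum.distrib sum_distrib_left[symmetric])
    also have "\<dots> \<le> \<epsilon> / 2 + (\<Sum>k<N. \<bar>incr h N k\<bar> * (1 / p))"
    proof (intro add_mono sum_mono mult_left_mono W_id r)
      show "(\<Sum>k<N. \<Sum>l<r. \<bar>incr h (N * r) (k * r + l) - incr h N k / r\<bar>) \<le> \<epsilon> / 2"
        unfolding Nr using n[OF m] by (simp add: N_def r_def)
    qed simp
    also have "\<dots> \<le> \<epsilon> / 2 + V * (1 / p)"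
      unfolding sum_distrib_right[symmetric]
      by (intro add_left_mono mult_right_mono variation_le_incr[OF V N]) simp
    also have "\<dots> \<le> \<epsilon>"
    proof -
      have "V * (1 / real p) = V / real p" by simp
      then show ?thesis using p(2) by linarith
    qed
    finally show "(\<Sum>j<2^m. \<bar>(h (real (Suc j) / 2^m) - g (real (Suc j) / 2^m)) - (h (real j / 2^m) - g (real j / 2^m))\<bar>) \<le> \<epsilon>" .
  qed
  then have "variation_le (\<lambda>x. h x - g x) \<epsilon>"
    by (intro total_variation_le_imp_variation_le) (simp_all add: per g_per)
  then show ?thesis using \<psi>_cont \<psi>_per g g_per by (intro exI[of _ g] exI[of _ \<psi>]) simp
qed

section \<open>Translation numbers\<close>

context diffeo_lift
begin

lemma iter_add_of_int: "(F ^^ n) (x + of_int k) = (F ^^ n) x + of_int k"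
  using add_of_int[of "F ^^ n" 1] iter_add_1 by simp

lemma iter_less_iff [simp]: "(F ^^ n) x < (F ^^ n) y \<longleftrightarrow> x < y"
  using strict_mono_iter by (rule strict_mono_less)

lemma iter_le_iff [simp]: "(F ^^ n) x \<le> (F ^^ n) y \<longleftrightarrow> x \<le> y"
  using strict_mono_iter by (rule strict_mono_less_eq)

text \<open>A monotone map commuting with integer translations maps the interval between two
  consecutive translates of \<open>y\<close> into the interval between their images, so
  displacements at two points differ by at most 1.\<close>

lemma iter_displacement: "\<bar>((F ^^ n) x - x) - ((F ^^ n) y - y)\<bar> \<le> 1"
proof -
  define k where "k = \<lfloor>x - y\<rfloor>"
  have k: "y + of_int k \<le> x" "x \<le> y + of_int (k + 1)" unfolding k_def by linarith+
  have "(F ^^ n) y + of_int k \<le> (F ^^ n) x" "(F ^^ n) x \<le> (F ^^ n) y + of_int (k + 1)"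
    using k unfolding iter_add_of_int[symmetric] iter_le_iff .
  with k show ?thesis by (simp add: abs_le_iff)
qed

lemma iter_mult_bound: "\<bar>(F ^^ (n * m)) 0 - real n * (F ^^ m) 0\<bar> \<le> real n"
proof (induction n)
  case (Suc n)
  have "(F ^^ (Suc n * m)) 0 = (F ^^ m) ((F ^^ (n * m)) 0)" by (simp add: funpow_add)
  with Suc iter_displacement[of m "(F ^^ (n * m)) 0" 0] show ?case
    by (simp add: algebra_simps abs_le_iff)
qed simp

text \<open>Compare both terms with \<open>(F ^^ (n * m)) 0\<close>, read once as \<open>n\<close>
  blocks of length \<open>m\<close> and once as \<open>m\<close> blocks of length
  \<open>n\<close>.\<close>

lemma iter_quotient_diff:
  assumes "0 < n" "0 < m"
  shows "\<bar>(F ^^ n) 0 / n - (F ^^ m) 0 / m\<bar> \<le> 1 / n + 1 / m"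
proof -
  have "\<bar>real m * (F ^^ n) 0 - real n * (F ^^ m) 0\<bar> \<le> real m + real n"
    using iter_mult_bound[of n m] iter_mult_bound[of m n] by (simp add: mult.commute)
  then have "\<bar>real m * (F ^^ n) 0 - real n * (F ^^ m) 0\<bar> / (real n * real m) \<le> (real m + real n) / (real n * real m)"
    by (intro divide_right_mono) auto
  also have "\<dots> = 1 / n + 1 / m" using assms by (simp add: field_simps)
  also have "\<bar>real m * (F ^^ n) 0 - real n * (F ^^ m) 0\<bar> / (real n * real m) = \<bar>(F ^^ n) 0 / n - (F ^^ m) 0 / m\<bar>"
  proof -
    have "(F ^^ n) 0 / n - (F ^^ m) 0 / m = (real m * (F ^^ n) 0 - real n * (F ^^ m) 0) / (real n * real m)"
      using assms by (simp add: field_simps)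
    then show ?thesis by (simp add: abs_mult)
  qed
  finally show ?thesis .
qed

lemma translation_number_lim: "(\<lambda>n. (F ^^ n) 0 / real n) \<longlonglongrightarrow> translation_number F"
proof -
  have "Cauchy (\<lambda>n. (F ^^ n) 0 / real n)"
  proof (rule metric_CauchyI)
    fix e :: real assume e: "0 < e"
    define M where "M = nat \<lceil>2 / e\<rceil> + 1"
    have M: "0 < M" "2 / e < real M" unfolding M_def by linarith+
    have inv: "1 / real n < e / 2" if "M \<le> n" for n
    proof -
      have "2 / e < real n" using M(2) that by linarith
      moreover have "0 < n" using that M(1) by simp
      ultimately show ?thesis using e by (simp add: field_simps)
    qed
    show "\<exists>M. \<forall>m\<ge>M. \<forall>n\<ge>M. dist ((F ^^ m) 0 / real m) ((F ^^ n) 0 / real n) < e"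
    proof (intro exI allI impI)
      fix m n assume mn: "M \<le> m" "M \<le> n"
      then show "dist ((F ^^ m) 0 / real m) ((F ^^ n) 0 / real n) < e"
        using iter_quotient_diff[of m n] inv[OF mn(1)] inv[OF mn(2)] M(1)
        unfolding dist_real_def by linarith
    qed
  qed
  then show ?thesis
    unfolding translation_number_def by (simp add: Cauchy_convergent convergent_LIMSEQ_iff[symmetric])
qed

lemma translation_number_bound: "\<bar>(F ^^ n) 0 - real n * translation_number F\<bar> \<le> 1"
proof (cases "n = 0")
  case False
  have "(\<lambda>m. \<bar>(F ^^ n) 0 / n - (F ^^ m) 0 / real m\<bar>) \<longlonglongrightarrow> \<bar>(F ^^ n) 0 / n - translation_number F\<bar>"
    by (intro tendsto_intros translation_number_lim)
  moreover have "(\<lambda>m. 1 / real n + 1 / real m) \<longlonglongrightarrow> 1 / real n + 0"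
    by (intro tendsto_intros lim_const_over_n)
  moreover have "\<exists>N. \<forall>m\<ge>N. \<bar>(F ^^ n) 0 / n - (F ^^ m) 0 / real m\<bar> \<le> 1 / real n + 1 / real m"
    using iter_quotient_diff[of n] False by (intro exI[of _ 1]) auto
  ultimately have "\<bar>(F ^^ n) 0 / n - translation_number F\<bar> \<le> 1 / real n + 0"
    by (rule LIMSEQ_le)
  then have "real n * \<bar>(F ^^ n) 0 / n - translation_number F\<bar> \<le> real n * (1 / real n)"
    by (intro mult_left_mono) auto
  moreover have "real n * \<bar>(F ^^ n) 0 / n - translation_number F\<bar> = \<bar>(F ^^ n) 0 - real n * translation_number F\<bar>"
  proof -
    have "(F ^^ n) 0 - real n * translation_number F = real n * ((F ^^ n) 0 / n - translation_number F)"
      using False by (simp add: field_simps)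
    then show ?thesis by (simp add: abs_mult)
  qed
  ultimately show ?thesis using False by simp
qed simp

lemma iter_bound: "\<bar>(F ^^ n) x - x - real n * translation_number F\<bar> \<le> 2"
  using translation_number_bound[of n] iter_displacement[of n x 0] by linarith

lemma rotation_number_lift:
  assumes "circle_lift F f"
  shows "irrational_rotation_number f \<longleftrightarrow> translation_number F \<notin> \<rat>"
proof -
  have "rotation_number f = circle_proj (translation_number F)"
    by (rule rotation_number_eq[OF assms F_add_1 translation_number_lim])
  moreover have "circle_proj t \<in> circle_proj ` \<rat> \<longleftrightarrow> t \<in> \<rat>" for t
  proof
    assume "circle_proj t \<in> circle_proj ` \<rat>"
    then obtain s where s: "s \<in> \<rat>" "t - s \<in> \<int>" by (auto simp: circle_proj_eq_iff)
    then have "(t - s) + s \<in> \<rat>" by (intro Rats_add) (auto elim!: Ints_cases)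
    then show "t \<in> \<rat>" by simp
  qed auto
  ultimately show ?thesis by (simp add: irrational_rotation_number_def)
qed

text \<open>The monotone semiconjugacy from \<open>F\<close> to the translation by its translation number.\<close>

definition semiconj_set :: "real \<Rightarrow> real set" where
  "semiconj_set x = {(real j - real k) * translation_number F + of_int r | j k r.
      (F ^^ j) 0 + of_int r \<le> (F ^^ k) x}"

definition semiconj :: "real \<Rightarrow> real" where "semiconj x = Sup (semiconj_set x)"

lemma semiconj_set_nonempty: "semiconj_set x \<noteq> {}"
proof -
  have "(F ^^ 0) 0 + of_int \<lfloor>x\<rfloor> \<le> (F ^^ 0) x" by simp
  then show ?thesis unfolding semiconj_set_def by blast
qed

lemma semiconj_set_bdd: "bdd_above (semiconj_set x)"
proof (rule bdd_aboveI)
  fix y assume "y \<in> semiconj_set x"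
  then obtain j k r where y: "y = (real j - real k) * translation_number F + of_int r"
    "(F ^^ j) 0 + of_int r \<le> (F ^^ k) x" unfolding semiconj_set_def by blast
  then show "y \<le> x + 3"
    using translation_number_bound[of j] iter_bound[of k x] by (simp add: algebra_simps abs_le_iff)
qed

text \<open>Each relation for \<open>semiconj\<close> comes from an inclusion between shifted sets.
  In these sets the pair \<open>j\<close>, \<open>k\<close> encodes the time j - k, which may be
  negative: the condition places the corresponding translated orbit point of 0 at or below
  \<open>x\<close> without mentioning inverse iterates.\<close>

lemma semiconj_le:
  assumes "\<And>z. z \<in> semiconj_set x \<Longrightarrow> z + c \<in> semiconj_set y"
  shows "semiconj x + c \<le> semiconj y"
proof -
  have "semiconj x \<le> semiconj y - c"
    unfolding semiconj_def using assms semiconj_set_nonempty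
    by (intro cSup_least) (auto simp: le_diff_eq intro!: cSup_upper semiconj_set_bdd)
  then show ?thesis by simp
qed

lemma semiconj_mono: "x \<le> y \<Longrightarrow> semiconj x \<le> semiconj y"
proof -
  assume "x \<le> y"
  then have "(F ^^ k) x \<le> (F ^^ k) y" for k by simp
  then have "semiconj_set x \<subseteq> semiconj_set y"
    unfolding semiconj_set_def by (blast intro: order_trans)
  then show ?thesis using semiconj_le[of x 0 y] by auto
qed

lemma semiconj_add_1: "semiconj (x + 1) = semiconj x + 1"
proof (rule antisym)
  have "semiconj (x + 1) + (-1) \<le> semiconj x"
  proof (rule semiconj_le)
    fix z assume "z \<in> semiconj_set (x + 1)"
    then obtain j k r where z: "z = (real j - real k) * translation_number F + of_int r"
      "(F ^^ j) 0 + of_int r \<le> (F ^^ k) (x + 1)" unfolding semiconj_set_def by blast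
    have "z + (-1) = (real j - real k) * translation_number F + of_int (r - 1)" using z(1) by simp
    moreover have "(F ^^ j) 0 + of_int (r - 1) \<le> (F ^^ k) x" using z(2) by (simp add: iter_add_1)
    ultimately show "z + (-1) \<in> semiconj_set x" unfolding semiconj_set_def by blast
  qed
  then show "semiconj (x + 1) \<le> semiconj x + 1" by simp
  show "semiconj x + 1 \<le> semiconj (x + 1)"
  proof (rule semiconj_le)
    fix z assume "z \<in> semiconj_set x"
    then obtain j k r where z: "z = (real j - real k) * translation_number F + of_int r"
      "(F ^^ j) 0 + of_int r \<le> (F ^^ k) x" unfolding semiconj_set_def by blast
    have "z + 1 = (real j - real k) * translation_number F + of_int (r + 1)" using z(1) by simp
    moreover have "(F ^^ j) 0 + of_int (r + 1) \<le> (F ^^ k) (x + 1)" using z(2) by (simp add: iter_add_1)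
    ultimately show "z + 1 \<in> semiconj_set (x + 1)" unfolding semiconj_set_def by blast
  qed
qed

lemma semiconj_F: "semiconj (F x) = semiconj x + translation_number F"
proof (rule antisym)
  let ?a = "translation_number F"
  have "semiconj (F x) + (- ?a) \<le> semiconj x"
  proof (rule semiconj_le)
    fix z assume "z \<in> semiconj_set (F x)"
    then obtain j k r where z: "z = (real j - real k) * ?a + of_int r"
      "(F ^^ j) 0 + of_int r \<le> (F ^^ k) (F x)" unfolding semiconj_set_def by blast
    have "z + (- ?a) = (real j - real (Suc k)) * ?a + of_int r" using z(1) by (simp add: algebra_simps)
    moreover have "(F ^^ j) 0 + of_int r \<le> (F ^^ Suc k) x" using z(2) by (simp add: funpow_swap1)
    ultimately show "z + (- ?a) \<in> semiconj_set x" unfolding semiconj_set_def by blast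
  qed
  then show "semiconj (F x) \<le> semiconj x + ?a" by simp
  show "semiconj x + ?a \<le> semiconj (F x)"
  proof (rule semiconj_le)
    fix z assume "z \<in> semiconj_set x"
    then obtain j k r where z: "z = (real j - real k) * ?a + of_int r"
      "(F ^^ j) 0 + of_int r \<le> (F ^^ k) x" unfolding semiconj_set_def by blast
    have "z + ?a = (real (Suc j) - real k) * ?a + of_int r" using z(1) by (simp add: algebra_simps)
    moreover have "F ((F ^^ j) 0 + of_int r) \<le> F ((F ^^ k) x)"
      using z(2) iter_le_iff[of 1] by simp
    then have "(F ^^ Suc j) 0 + of_int r \<le> (F ^^ k) (F x)"
      using iter_add_of_int[of 1 "(F ^^ j) 0" r] by (simp add: funpow_swap1)
    ultimately show "z + ?a \<in> semiconj_set (F x)" unfolding semiconj_set_def by blast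
  qed
qed

lemma semiconj_iter: "semiconj ((F ^^ n) x + of_int r) = semiconj x + real n * translation_number F + of_int r"
proof -
  have "semiconj ((F ^^ n) x) = semiconj x + real n * translation_number F"
    by (induction n) (auto simp: semiconj_F algebra_simps)
  then show ?thesis using add_of_int[of semiconj 1 "(F ^^ n) x" r] semiconj_add_1 by simp
qed

end

section \<open>Families of arcs that are disjoint on the circle\<close>

lemma sum_mono_disjoint_intervals:
  fixes T :: "real \<Rightarrow> real" and u v :: "'a \<Rightarrow> real"
  assumes "finite I" and T: "\<And>x y. x \<le> y \<Longrightarrow> T x \<le> T y" and "a \<le> b"
    and "\<And>i. i \<in> I \<Longrightarrow> a \<le> u i \<and> u i < v i \<and> v i \<le> b"
    and "\<And>i j. i \<in> I \<Longrightarrow> j \<in> I \<Longrightarrow> i \<noteq> j \<Longrightarrow> v i \<le> u j \<or> v j \<le> u i"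
  shows "(\<Sum>i\<in>I. T (v i) - T (u i)) \<le> T b - T a"
  using assms(1,3-5)
proof (induction "card I" arbitrary: I b)
  case 0
  then show ?case using T[of a b] by simp
next
  case (Suc n)
  have ne: "I \<noteq> {}" using Suc.hyps(2) by auto
  \<comment> \<open>Remove the interval with the rightmost left end; disjointness puts all others to
    the left of that end.\<close>
  have "Max (u ` I) \<in> u ` I" using Suc.prems(1) ne by (intro Max_in) auto
  then obtain k where k: "k \<in> I" "u k = Max (u ` I)" by auto
  then have k: "k \<in> I" "\<And>j. j \<in> I \<Longrightarrow> u j \<le> u k"
    using Suc.prems(1) by auto
  have "(\<Sum>i\<in>I - {k}. T (v i) - T (u i)) \<le> T (u k) - T a"
  proof (rule Suc.hyps(1))
    show "n = card (I - {k})" using Suc.hyps(2) k(1) Suc.prems(1) by simp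
    show "a \<le> u k" using Suc.prems(3) k(1) by blast
    fix i assume i: "i \<in> I - {k}"
    have "v i \<le> u k \<or> v k \<le> u i" using Suc.prems(4) i k(1) by blast
    then show "a \<le> u i \<and> u i < v i \<and> v i \<le> u k"
      using Suc.prems(3)[of i] Suc.prems(3)[of k] k i by fastforce
  qed (use Suc.prems in auto)
  moreover have "T (v k) \<le> T b" using Suc.prems(3) k(1) T by blast
  ultimately show ?case using Suc.prems(1) k(1) by (simp add: sum.remove)
qed

text \<open>Disjointness after projection to the circle. The case of equal indices with
  \<open>r \<noteq> 0\<close> separates an arc from its own translates and so bounds its length by
  1.\<close>

definition disjoint_arcs :: "'a set \<Rightarrow> ('a \<Rightarrow> real) \<Rightarrow> ('a \<Rightarrow> real) \<Rightarrow> bool" where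
  "disjoint_arcs I u v \<longleftrightarrow> finite I \<and> (\<forall>i\<in>I. u i < v i) \<and>
     (\<forall>i\<in>I. \<forall>j\<in>I. \<forall>r::int. i \<noteq> j \<or> r \<noteq> 0 \<longrightarrow> v i + of_int r \<le> u j \<or> v j \<le> u i + of_int r)"

lemma disjoint_arcs_subset:
  assumes "disjoint_arcs I u v" "\<And>i. i \<in> I' \<Longrightarrow> u i \<le> u' i \<and> u' i < v' i \<and> v' i \<le> v i" "I' \<subseteq> I"
  shows "disjoint_arcs I' u' v'"
  unfolding disjoint_arcs_def
proof (intro conjI ballI allI impI)
  show "finite I'" using assms unfolding disjoint_arcs_def by (meson finite_subset)
next
  fix i j and r :: int assume ij: "i \<in> I'" "j \<in> I'" "i \<noteq> j \<or> r \<noteq> 0"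
  then have "v i + of_int r \<le> u j \<or> v j \<le> u i + of_int r"
    using assms(1,3) unfolding disjoint_arcs_def by blast
  then show "v' i + of_int r \<le> u' j \<or> v' j \<le> u' i + of_int r"
    using assms(2)[OF ij(1)] assms(2)[OF ij(2)] by linarith
qed (use assms in auto)

lemma sum_mono_disjoint_arcs:
  assumes T: "\<And>x y. x \<le> y \<Longrightarrow> T x \<le> T y" "\<And>x. T (x + 1) = T x + C"
    and dis: "disjoint_arcs I u v"
  shows "(\<Sum>i\<in>I. T (v i) - T (u i)) \<le> (C::real)"
proof (cases "I = {}")
  case True
  then show ?thesis using T(1)[of 0 1] T(2)[of 0] by simp
next
  case False
  then obtain i0 where i0: "i0 \<in> I" by blast
  \<comment> \<open>The fundamental domain starts at the left end of one of the arcs; an arc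
    translated to start inside it cannot cross its right end, where the next copy of the chosen arc
    begins.\<close>
  define a where "a = u i0"
  define s where "s = (\<lambda>i. - \<lfloor>u i - a\<rfloor>)"
  have fin: "finite I" and uv: "\<And>i. i \<in> I \<Longrightarrow> u i < v i"
    and d: "\<And>i j r. i \<in> I \<Longrightarrow> j \<in> I \<Longrightarrow> i \<noteq> j \<or> r \<noteq> 0 \<Longrightarrow> v i + of_int r \<le> u j \<or> v j \<le> u i + of_int r"
    using dis unfolding disjoint_arcs_def by auto
  have s: "a \<le> u i + of_int (s i)" "u i + of_int (s i) < a + 1" for i
    unfolding s_def by linarith+
  have "(\<Sum>i\<in>I. T (v i + of_int (s i)) - T (u i + of_int (s i))) \<le> T (a + 1) - T a"
  proof (rule sum_mono_disjoint_intervals[OF fin T(1)])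
    fix i assume i: "i \<in> I"
    have "v i + of_int (s i) \<le> a + 1"
    proof (cases "i = i0")
      case True
      then have "s i = 0" by (simp add: s_def a_def)
      then show ?thesis using d[OF i0 i0, of 1] d[OF i0 i0, of "-1"] uv[OF i0] True by (auto simp: a_def)
    next
      case False
      then have "v i + of_int (s i - 1) \<le> u i0 \<or> v i0 \<le> u i + of_int (s i - 1)"
        using d[OF i i0] by blast
      then show ?thesis using s(2)[of i] uv[OF i0] by (auto simp: a_def)
    qed
    then show "a \<le> u i + of_int (s i) \<and> u i + of_int (s i) < v i + of_int (s i) \<and> v i + of_int (s i) \<le> a + 1"
      using s(1)[of i] uv[OF i] by simp
  next
    fix i j assume ij: "i \<in> I" "j \<in> I" "i \<noteq> j"
    then have "v i + of_int (s i - s j) \<le> u j \<or> v j \<le> u i + of_int (s i - s j)"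
      using d by blast
    then show "v i + of_int (s i) \<le> u j + of_int (s j) \<or> v j + of_int (s j) \<le> u i + of_int (s i)"
      by auto
  qed auto
  moreover have "T (v i + of_int (s i)) - T (u i + of_int (s i)) = T (v i) - T (u i)" for i
    using add_of_int[of T C] T(2) by simp
  ultimately show ?thesis by (simp add: T(2))
qed

lemma sum_length_disjoint_arcs:
  assumes "disjoint_arcs I u v"
  shows "(\<Sum>i\<in>I. v i - u i) \<le> 1"
  using sum_mono_disjoint_arcs[of "\<lambda>x. x" 1, OF _ _ assms] by simp

lemma sum_variation_disjoint_arcs:
  assumes "variation_le h C" "disjoint_arcs I u v"
  shows "(\<Sum>i\<in>I. \<bar>h (v i) - h (u i)\<bar>) \<le> C"
proof -
  obtain T where T: "\<And>u v. u \<le> v \<Longrightarrow> \<bar>h v - h u\<bar> \<le> T v - T u" "\<And>x. T (x + 1) = T x + C"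
    using assms(1) unfolding variation_le_def by blast
  have "(\<Sum>i\<in>I. \<bar>h (v i) - h (u i)\<bar>) \<le> (\<Sum>i\<in>I. T (v i) - T (u i))"
    using assms(2) by (intro sum_mono T(1)) (auto simp: disjoint_arcs_def)
  also have "\<dots> \<le> C"
  proof (rule sum_mono_disjoint_arcs[where T = T])
    fix x y :: real assume "x \<le> y"
    then show "T x \<le> T y" using T(1)[of x y] by linarith
  qed (use T(2) assms(2) in auto)
  finally show ?thesis .
qed

section \<open>Closest returns of an irrational rotation\<close>

lemma irrational_multiple:
  fixes \<alpha> :: real
  assumes "\<alpha> \<notin> \<rat>" "of_int k * \<alpha> = of_int r"
  shows "k = 0 \<and> r = 0"
proof (cases "k = 0")
  case False
  then have "\<alpha> = of_int r / of_int k" using assms(2) by (simp add: field_simps)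
  then have "\<alpha> \<in> \<rat>" by simp
  with assms(1) show ?thesis by blast
qed (use assms in simp)

lemma irrational_multiple_nat:
  fixes \<alpha> :: real
  assumes "\<alpha> \<notin> \<rat>" "real j * \<alpha> + of_int r = real k * \<alpha> + of_int s"
  shows "j = k \<and> r = s"
proof -
  have "of_int (int j - int k) * \<alpha> = of_int (s - r)" using assms(2) by (simp add: algebra_simps)
  from irrational_multiple[OF assms(1) this] show ?thesis by simp
qed

lemma first_return:
  fixes \<alpha> :: real
  assumes "0 < \<eta>"
  obtains q p where "0 < q" "\<bar>real q * \<alpha> - of_int p\<bar> < \<eta>"
    "\<And>k r. 0 < k \<Longrightarrow> k < q \<Longrightarrow> \<eta> \<le> \<bar>real k * \<alpha> - of_int r\<bar>"
proof -
  define P where "P = (\<lambda>q::nat. 0 < q \<and> (\<exists>p::int. \<bar>real q * \<alpha> - of_int p\<bar> < \<eta>))"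
  obtain N :: nat where N: "0 < N" "1 / real N < \<eta>"
    using reals_Archimedean[OF assms] by (auto simp: inverse_eq_divide simp del: of_nat_Suc)
  obtain h k where hk: "0 < k" "k \<le> int N" "\<bar>of_int k * \<alpha> - of_int h\<bar> < 1 / N"
    using Dirichlet_approx[OF N(1), of \<alpha>] by blast
  have "P (nat k)" using hk N unfolding P_def by (auto intro!: exI[of _ h])
  then have "P (LEAST q. P q)" by (rule LeastI)
  then obtain p where "0 < (LEAST q. P q)" "\<bar>real (LEAST q. P q) * \<alpha> - of_int p\<bar> < \<eta>"
    unfolding P_def by blast
  moreover have "\<eta> \<le> \<bar>real k * \<alpha> - of_int r\<bar>" if "0 < k" "k < (LEAST q. P q)" for k r
    using not_less_Least[OF that(2)] that(1) unfolding P_def by (simp add: not_less)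
  ultimately show ?thesis by (rule that)
qed

text \<open>\<open>q\<close> and \<open>Q\<close> are consecutive closest return times, returning on
  opposite sides, with the return at \<open>q\<close> on the right. The bound 1 / 2 makes the
  integer paired with \<open>q\<close> unique.\<close>

lemma close_return:
  fixes \<alpha> :: real
  assumes irr: "\<alpha> \<notin> \<rat>" and \<eta>: "0 < \<eta>"
  shows "\<exists>q Q p P. 0 < q \<and> q < Q \<and> 0 < real q * \<alpha> - of_int p \<and> real q * \<alpha> - of_int p < \<eta> \<and>
    (\<forall>k r. 0 < k \<longrightarrow> k < Q \<longrightarrow> real q * \<alpha> - of_int p \<le> \<bar>real k * \<alpha> - of_int r\<bar>) \<and>
    real Q * \<alpha> - of_int P < 0 \<and> - (real q * \<alpha> - of_int p) < real Q * \<alpha> - of_int P \<and>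
    real q * \<alpha> - of_int p < 1 / 2"
proof -
  have nz: "real q * \<alpha> - of_int p \<noteq> 0" if "0 < q" for q p
    using irrational_multiple[OF irr, of "int q" p] that by auto
  have next_ret: "\<exists>Q P. q < Q \<and> \<bar>real Q * \<alpha> - of_int P\<bar> < \<bar>real q * \<alpha> - of_int p\<bar> \<and>
      (\<forall>k r. 0 < k \<longrightarrow> k < Q \<longrightarrow> \<bar>real q * \<alpha> - of_int p\<bar> \<le> \<bar>real k * \<alpha> - of_int r\<bar>) \<and>
      (0 < real q * \<alpha> - of_int p \<longleftrightarrow> real Q * \<alpha> - of_int P < 0)"
    if q: "0 < q" "\<bar>real q * \<alpha> - of_int p\<bar> < 1 / 2"
      "\<And>k r. 0 < k \<Longrightarrow> k < q \<Longrightarrow> \<bar>real q * \<alpha> - of_int p\<bar> \<le> \<bar>real k * \<alpha> - of_int r\<bar>" for q p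
  proof -
    define d where "d = \<bar>real q * \<alpha> - of_int p\<bar>"
    have "0 < d" using nz[OF q(1)] by (simp add: d_def)
    then obtain Q P where Q: "0 < Q" "\<bar>real Q * \<alpha> - of_int P\<bar> < d"
      "\<And>k r. 0 < k \<Longrightarrow> k < Q \<Longrightarrow> d \<le> \<bar>real k * \<alpha> - of_int r\<bar>"
      using first_return[of d \<alpha>] by blast
    have "Q \<noteq> q"
    proof
      assume "Q = q"
      then have "\<bar>real q * \<alpha> - of_int P\<bar> < d" using Q(2) by simp
      then have "\<bar>of_int P - of_int p\<bar> < (1::real)" using q(2) unfolding d_def by linarith
      then have "P = p" by linarith
      then show False using Q(2) \<open>Q = q\<close> unfolding d_def by simp
    qed
    moreover have "\<not> Q < q" using q(3)[OF Q(1), of P] Q(2) unfolding d_def by linarith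
    ultimately have qQ: "q < Q" by simp
    have "0 < real q * \<alpha> - of_int p \<longleftrightarrow> real Q * \<alpha> - of_int P < 0"
    proof (rule ccontr)
      assume same: "\<not> ?thesis"
      \<comment> \<open>Two consecutive returns on the same side would differ by less than
        \<open>d\<close>, which gives an earlier return that is too close.\<close>
      have "d \<le> \<bar>real (Q - q) * \<alpha> - of_int (P - p)\<bar>" using qQ q(1) by (intro Q(3)) auto
      then have "d \<le> \<bar>(real Q * \<alpha> - of_int P) - (real q * \<alpha> - of_int p)\<bar>"
        using qQ by (simp add: of_nat_diff algebra_simps)
      then show False using same Q(2) nz[OF q(1), of p] nz[OF Q(1), of P] unfolding d_def by linarith
    qed
    then show ?thesis using qQ Q unfolding d_def by blast
  qed
  obtain q p where q: "0 < q" "\<bar>real q * \<alpha> - of_int p\<bar> < min \<eta> (1 / 2)"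
    "\<And>k r. 0 < k \<Longrightarrow> k < q \<Longrightarrow> min \<eta> (1 / 2) \<le> \<bar>real k * \<alpha> - of_int r\<bar>"
    using first_return[of "min \<eta> (1 / 2)" \<alpha>] \<eta> by auto
  have q3: "\<bar>real q * \<alpha> - of_int p\<bar> \<le> \<bar>real k * \<alpha> - of_int r\<bar>" if "0 < k" "k < q" for k r
    using q(2) q(3)[OF that, of r] by linarith
  obtain Q P where Q: "q < Q" "\<bar>real Q * \<alpha> - of_int P\<bar> < \<bar>real q * \<alpha> - of_int p\<bar>"
      "\<And>k r. 0 < k \<Longrightarrow> k < Q \<Longrightarrow> \<bar>real q * \<alpha> - of_int p\<bar> \<le> \<bar>real k * \<alpha> - of_int r\<bar>"
      "0 < real q * \<alpha> - of_int p \<longleftrightarrow> real Q * \<alpha> - of_int P < 0"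
    using next_ret[OF q(1) _ q3] q(2) by auto
  show ?thesis
  proof (cases "0 < real q * \<alpha> - of_int p")
    case True
    then show ?thesis using Q q by (intro exI[of _ q] exI[of _ Q] exI[of _ p] exI[of _ P]) auto
  next
    case False
    \<comment> \<open>If the first closest return lies on the left, the next one lies on the right
      and is closer still, so it takes over the role of \<open>q\<close>.\<close>
    have Q0: "0 < Q" using Q(1) by simp
    have Qpos: "0 < real Q * \<alpha> - of_int P" using False Q(4) nz[OF Q0, of P] by linarith
    have Q3: "\<bar>real Q * \<alpha> - of_int P\<bar> \<le> \<bar>real k * \<alpha> - of_int r\<bar>" if "0 < k" "k < Q" for k r
      using Q(2) Q(3)[OF that, of r] by linarith
    obtain Q' P' where Q': "Q < Q'" "\<bar>real Q' * \<alpha> - of_int P'\<bar> < \<bar>real Q * \<alpha> - of_int P\<bar>"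
      "\<And>k r. 0 < k \<Longrightarrow> k < Q' \<Longrightarrow> \<bar>real Q * \<alpha> - of_int P\<bar> \<le> \<bar>real k * \<alpha> - of_int r\<bar>"
      "0 < real Q * \<alpha> - of_int P \<longleftrightarrow> real Q' * \<alpha> - of_int P' < 0"
      using next_ret[OF Q0 _ Q3] Q(2) q(2) by auto
    then show ?thesis using Qpos Q(2) q(2) Q0 by (intro exI[of _ Q] exI[of _ Q'] exI[of _ P] exI[of _ P']) auto
  qed
qed

lemma close_return_large:
  fixes \<alpha> :: real
  assumes irr: "\<alpha> \<notin> \<rat>"
  obtains \<eta> where "0 < \<eta>" "\<And>q p. 0 < q \<Longrightarrow> \<bar>real q * \<alpha> - of_int p\<bar> < \<eta> \<Longrightarrow> n < q"
proof -
  define \<eta> where "\<eta> = Min (insert 1 ((\<lambda>q. \<bar>real q * \<alpha> - of_int (round (real q * \<alpha>))\<bar>) ` {1..n}))"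
  have "0 < \<eta>"
    unfolding \<eta>_def
  proof (subst Min_gr_iff; (intro ballI)?)
    fix y assume "y \<in> insert 1 ((\<lambda>q. \<bar>real q * \<alpha> - of_int (round (real q * \<alpha>))\<bar>) ` {1..n})"
    then consider "y = 1" | q where "q \<in> {1..n}" "y = \<bar>real q * \<alpha> - of_int (round (real q * \<alpha>))\<bar>"
      by blast
    then show "0 < y"
    proof cases
      case (2 q)
      then show ?thesis
        using irrational_multiple[OF irr, of "int q" "round (real q * \<alpha>)"] by auto
    qed simp
  qed auto
  moreover have "n < q" if "0 < q" "\<bar>real q * \<alpha> - of_int p\<bar> < \<eta>" for q p
  proof (rule ccontr)
    assume "\<not> n < q"
    then have "\<eta> \<le> \<bar>real q * \<alpha> - of_int (round (real q * \<alpha>))\<bar>"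
      unfolding \<eta>_def using that(1) by (intro Min_le) auto
    also have "\<dots> \<le> \<bar>real q * \<alpha> - of_int p\<bar>" by (rule round_diff_minimal)
    finally show False using that(2) by simp
  qed
  ultimately show ?thesis using that by blast
qed


section \<open>Denjoy's theorem and towers over closest returns\<close>

context diffeo_lift
begin

definition log_deriv_iter :: "nat \<Rightarrow> real \<Rightarrow> real" where
  "log_deriv_iter n x = (\<Sum>k<n. ln (D ((F ^^ k) x)))"

lemma iter_has_exp_deriv: "((F ^^ n) has_real_derivative exp (log_deriv_iter n x)) (at x)"
proof -
  have "exp (log_deriv_iter n x) = (\<Prod>k<n. D ((F ^^ k) x))"
    unfolding log_deriv_iter_def using D_pos by (simp add: exp_sum)
  then show ?thesis using iter_has_deriv[of n x] by simp
qed

lemma D_add_of_int: "D (x + of_int k) = D x"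
  using add_of_int[of D 0 x k] D_add_1 by simp

end

locale denjoy_lift = diffeo_lift +
  fixes V :: real
  assumes irrational: "translation_number F \<notin> \<rat>"
    and variation: "variation_le (\<lambda>x. ln (D x)) V"
begin

abbreviation "\<alpha> \<equiv> translation_number F"

text \<open>An orbit is ordered as for the rigid rotation: \<open>semiconj\<close> transports the
  weak order, and irrationality excludes ties.\<close>

lemma orbit_less_iff:
  "(F ^^ j) x + of_int r < (F ^^ k) x + of_int s \<longleftrightarrow> real j * \<alpha> + of_int r < real k * \<alpha> + of_int s"
proof -
  have le: "real j * \<alpha> + of_int r \<le> real k * \<alpha> + of_int s"
    if "(F ^^ j) x + of_int r \<le> (F ^^ k) x + of_int s" for j k r s
    using semiconj_mono[OF that] by (simp add: semiconj_iter)
  show ?thesis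
  proof
    assume less: "(F ^^ j) x + of_int r < (F ^^ k) x + of_int s"
    then have "real j * \<alpha> + of_int r \<le> real k * \<alpha> + of_int s" by (intro le) simp
    moreover have "real j * \<alpha> + of_int r \<noteq> real k * \<alpha> + of_int s"
      using irrational_multiple_nat[OF irrational, of j r k s] less by auto
    ultimately show "real j * \<alpha> + of_int r < real k * \<alpha> + of_int s" by simp
  next
    assume "real j * \<alpha> + of_int r < real k * \<alpha> + of_int s"
    then show "(F ^^ j) x + of_int r < (F ^^ k) x + of_int s"
      using le[of k s j r] by (meson not_le)
  qed
qed

text \<open>An overlap of two translated arcs would bring two points of the rotation orbit, less
  than \<open>Q\<close> steps apart, closer together than the return at time
  \<open>q\<close>.\<close>

lemma disjoint_tower:
  assumes d: "0 < real q * \<alpha> - of_int p" "real q * \<alpha> - of_int p < 1 / 2"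
    and far: "\<And>k r. 0 < k \<Longrightarrow> k < Q \<Longrightarrow> real q * \<alpha> - of_int p \<le> \<bar>real k * \<alpha> - of_int r\<bar>"
  shows "disjoint_arcs {..<Q} (\<lambda>i. (F ^^ i) x) (\<lambda>i. (F ^^ (i + q)) x - of_int p)"
  unfolding disjoint_arcs_def
proof (intro conjI ballI allI impI)
  fix i
  have "(F ^^ i) x + of_int 0 < (F ^^ (i + q)) x + of_int (- p)"
    unfolding orbit_less_iff using d by (simp add: algebra_simps)
  then show "(F ^^ i) x < (F ^^ (i + q)) x - of_int p" by simp
next
  fix i j and r :: int
  assume ij: "i \<in> {..<Q}" "j \<in> {..<Q}" "i \<noteq> j \<or> r \<noteq> 0"
  show "(F ^^ (i + q)) x - of_int p + of_int r \<le> (F ^^ j) x \<or> (F ^^ (j + q)) x - of_int p \<le> (F ^^ i) x + of_int r"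
  proof (rule ccontr)
    assume "\<not> ?thesis"
    then have "(F ^^ j) x + of_int 0 < (F ^^ (i + q)) x + of_int (r - p)"
      "(F ^^ i) x + of_int r < (F ^^ (j + q)) x + of_int (- p)" by auto
    then have near: "\<bar>(real i - real j) * \<alpha> + of_int r\<bar> < real q * \<alpha> - of_int p"
      unfolding orbit_less_iff by (simp add: algebra_simps abs_less_iff)
    consider "i = j" | "i < j" | "j < i" by linarith
    then show False
    proof cases
      case 1
      then have "\<bar>of_int r\<bar> < (1::real)" using near d(2) by simp
      then have "r = 0" by linarith
      then show False using 1 ij(3) by simp
    next
      case 2
      then have "real q * \<alpha> - of_int p \<le> \<bar>real (j - i) * \<alpha> - of_int r\<bar>" using ij by (intro far) auto
      then show False using near 2 by (simp add: of_nat_diff algebra_simps abs_minus_commute)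
    next
      case 3
      then have "real q * \<alpha> - of_int p \<le> \<bar>real (i - j) * \<alpha> - of_int (- r)\<bar>" using ij by (intro far) auto
      then show False using near 3 by (simp add: of_nat_diff algebra_simps)
    qed
  qed
qed simp

text \<open>Denjoy's distortion estimate: along orbit arcs that are disjoint on the circle, the
  increments of \<open>ln (D x)\<close> add up to at most the total variation.\<close>

lemma log_deriv_iter_diff_le:
  assumes dis: "disjoint_arcs {..<n} (\<lambda>i. (F ^^ i) a) v" "\<And>i. i < n \<Longrightarrow> (F ^^ i) b \<le> v i"
    and "a \<le> s" "s \<le> b" "a \<le> t" "t \<le> b" "m \<le> n"
  shows "\<bar>log_deriv_iter m s - log_deriv_iter m t\<bar> \<le> V"
proof -
  have le: "\<bar>log_deriv_iter m s - log_deriv_iter m t\<bar> \<le> V"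
    if st: "a \<le> s" "s < t" "t \<le> b" for s t
  proof -
    have "disjoint_arcs {..<m} (\<lambda>i. (F ^^ i) s) (\<lambda>i. (F ^^ i) t)"
    proof (rule disjoint_arcs_subset[OF dis(1)])
      fix i assume "i \<in> {..<m}"
      then have "(F ^^ i) b \<le> v i" using dis(2) assms(7) by simp
      moreover have "(F ^^ i) t \<le> (F ^^ i) b" using st by simp
      ultimately have "(F ^^ i) t \<le> v i" by (meson order_trans)
      then show "(F ^^ i) a \<le> (F ^^ i) s \<and> (F ^^ i) s < (F ^^ i) t \<and> (F ^^ i) t \<le> v i"
        using st by simp
    qed (use assms(7) in auto)
    from sum_variation_disjoint_arcs[OF variation this]
    have "(\<Sum>i<m. \<bar>ln (D ((F ^^ i) t)) - ln (D ((F ^^ i) s))\<bar>) \<le> V" .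
    moreover have "\<bar>log_deriv_iter m t - log_deriv_iter m s\<bar> \<le> (\<Sum>i<m. \<bar>ln (D ((F ^^ i) t)) - ln (D ((F ^^ i) s))\<bar>)"
      unfolding log_deriv_iter_def sum_subtractf[symmetric] by (rule sum_abs)
    ultimately show ?thesis by (simp add: abs_minus_commute)
  qed
  have "0 \<le> V"
    using sum_variation_disjoint_arcs[OF variation, of "{}" id id] by (simp add: disjoint_arcs_def)
  then show ?thesis
    using le[of s t] le[of t s] assms(3-6) by (cases s t rule: linorder_cases) (auto simp: abs_minus_commute)
qed

text \<open>If images of an arc collapsed by \<open>semiconj\<close> overlapped, their image points
  under \<open>semiconj\<close> would coincide, giving an integer relation for
  \<open>\<alpha>\<close>.\<close>

lemma wandering_tower:
  assumes "a < b" "semiconj a = semiconj b"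
  shows "disjoint_arcs {..<n} (\<lambda>i. (F ^^ i) a) (\<lambda>i. (F ^^ i) b)"
  unfolding disjoint_arcs_def
proof (intro conjI ballI allI impI)
  fix i j and r :: int
  assume ij: "i \<in> {..<n}" "j \<in> {..<n}" "i \<noteq> j \<or> r \<noteq> 0"
  show "(F ^^ i) b + of_int r \<le> (F ^^ j) a \<or> (F ^^ j) b \<le> (F ^^ i) a + of_int r"
  proof (rule ccontr)
    assume "\<not> ?thesis"
    then have "(F ^^ j) a + of_int 0 \<le> (F ^^ i) b + of_int r" "(F ^^ i) a + of_int r \<le> (F ^^ j) b + of_int 0" by auto
    from this[THEN semiconj_mono] have "real i * \<alpha> + of_int r = real j * \<alpha> + of_int 0"
      unfolding semiconj_iter using assms(2) by simp
    then show False using irrational_multiple_nat[OF irrational, of i r j 0] ij(3) by blast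
  qed
qed (use assms in auto)

lemma eventually_small_if_sums_bounded:
  fixes l :: "nat \<Rightarrow> real"
  assumes "\<And>n. 0 \<le> l n" "\<And>n. (\<Sum>i<n. l i) \<le> C" "0 < \<epsilon>"
  shows "\<exists>N. \<forall>n\<ge>N. l n < \<epsilon>"
proof -
  have "summable l" using assms(1,2) by (intro summableI_nonneg_bounded[of l C]) auto
  then have "l \<longlonglongrightarrow> 0" by (rule summable_LIMSEQ_zero)
  then have "\<forall>\<^sub>F n in sequentially. l n < \<epsilon>" using assms(3) by (rule order_tendstoD)
  then show ?thesis by (simp add: eventually_sequentially)
qed

text \<open>Denjoy's argument. A collapsed arc I is wandering, so both its forward and its backward
  images become arbitrarily short. At a closest return time q, however, the product of the lengths
  of the q-th forward and backward images is at least exp (- 2V) times the squared length of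
  I.\<close>

lemma semiconj_strict_mono: "a < b \<Longrightarrow> semiconj a < semiconj b"
proof (rule ccontr)
  assume ab: "a < b" and "\<not> semiconj a < semiconj b"
  then have H: "semiconj a = semiconj b" using semiconj_mono[of a b] by simp
  define G where "G = inv F"
  have FG: "F (G x) = x" for x unfolding G_def using bij_F by (simp add: bij_is_surj surj_f_inv_f)
  have FGn: "(F ^^ n) ((G ^^ n) x) = x" for n x
    by (induction n arbitrary: x) (auto simp: funpow_swap1 FG)
  have G_less: "(G ^^ n) x < (G ^^ n) y" if "x < y" for n x y
    using that iter_less_iff[of n "(G ^^ n) x" "(G ^^ n) y"] by (simp add: FGn)
  have HG: "semiconj ((G ^^ n) a) = semiconj ((G ^^ n) b)" for n
    using semiconj_iter[of n "(G ^^ n) a" 0] semiconj_iter[of n "(G ^^ n) b" 0] H by (simp add: FGn)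
  have shift: "(G ^^ i) x = (F ^^ (n - i)) ((G ^^ n) x)" if "i \<le> n" for i n x
  proof -
    have "(G ^^ n) x = (G ^^ (n - i)) ((G ^^ i) x)"
      using that by (metis comp_apply funpow_add le_add_diff_inverse2)
    then show ?thesis by (simp add: FGn)
  qed
  \<comment> \<open>Chosen so that \<open>\<epsilon> * \<epsilon> * exp (2 * V)\<close> is the
    squared length of the arc.\<close>
  define \<epsilon> where "\<epsilon> = exp (- V) * (b - a)"
  have \<epsilon>: "0 < \<epsilon>" using ab by (simp add: \<epsilon>_def)
  have "\<exists>N. \<forall>n\<ge>N. (F ^^ n) b - (F ^^ n) a < \<epsilon>"
    using sum_length_disjoint_arcs[OF wandering_tower[OF ab H]] ab \<epsilon>
    by (intro eventually_small_if_sums_bounded[where C = 1]) (auto simp: less_imp_le)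
  moreover have "\<exists>N. \<forall>n\<ge>N. (G ^^ n) b - (G ^^ n) a < \<epsilon>"
  proof (rule eventually_small_if_sums_bounded[where C = 1])
    fix n
    show "0 \<le> (G ^^ n) b - (G ^^ n) a" using G_less[OF ab, of n] by simp
    \<comment> \<open>The backward images before time \<open>n\<close> are forward images of the
      \<open>n\<close>-th one, which is also collapsed, so one forward tower bounds their total
      length.\<close>
    have "(\<Sum>i<n. (G ^^ i) b - (G ^^ i) a) =
        (\<Sum>i<n. (F ^^ Suc (n - Suc i)) ((G ^^ n) b) - (F ^^ Suc (n - Suc i)) ((G ^^ n) a))"
    proof (intro sum.cong refl)
      fix i assume "i \<in> {..<n}"
      then have "i \<le> n" "Suc (n - Suc i) = n - i" by auto
      then show "(G ^^ i) b - (G ^^ i) a = (F ^^ Suc (n - Suc i)) ((G ^^ n) b) - (F ^^ Suc (n - Suc i)) ((G ^^ n) a)"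
        using shift[of i n a] shift[of i n b] by (simp only:)
    qed
    also have "\<dots> = (\<Sum>i<n. (F ^^ Suc i) ((G ^^ n) b) - (F ^^ Suc i) ((G ^^ n) a))"
      by (rule sum.nat_diff_reindex[where g = "\<lambda>i. (F ^^ Suc i) ((G ^^ n) b) - (F ^^ Suc i) ((G ^^ n) a)"])
    also have "\<dots> \<le> (\<Sum>i<Suc n. (F ^^ i) ((G ^^ n) b) - (F ^^ i) ((G ^^ n) a))"
      unfolding sum.lessThan_Suc_shift using G_less[OF ab, of n] by (simp del: funpow.simps)
    also have "\<dots> \<le> 1"
      by (rule sum_length_disjoint_arcs[OF wandering_tower[OF G_less[OF ab] HG]])
    finally show "(\<Sum>i<n. (G ^^ i) b - (G ^^ i) a) \<le> 1" .
  qed (rule \<epsilon>)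
  ultimately obtain N where N: "\<And>n. N \<le> n \<Longrightarrow> (F ^^ n) b - (F ^^ n) a < \<epsilon>"
    "\<And>n. N \<le> n \<Longrightarrow> (G ^^ n) b - (G ^^ n) a < \<epsilon>"
    by (metis le_trans nat_le_linear)
  obtain \<eta> where \<eta>: "0 < \<eta>" "\<And>q p. 0 < q \<Longrightarrow> \<bar>real q * \<alpha> - of_int p\<bar> < \<eta> \<Longrightarrow> N < q"
    using close_return_large[OF irrational, of N] by blast
  obtain q Q p P where q: "0 < q" "q < Q" "0 < real q * \<alpha> - of_int p" "real q * \<alpha> - of_int p < \<eta>"
    "\<And>k r. 0 < k \<Longrightarrow> k < Q \<Longrightarrow> real q * \<alpha> - of_int p \<le> \<bar>real k * \<alpha> - of_int r\<bar>"
    "real Q * \<alpha> - of_int P < 0" "- (real q * \<alpha> - of_int p) < real Q * \<alpha> - of_int P"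
    "real q * \<alpha> - of_int p < 1 / 2"
    using close_return[OF irrational \<eta>(1)] by blast
  have Nq: "N \<le> q" using \<eta>(2)[OF q(1), of p] q(3,4) by simp
  obtain u where u: "a < u" "u < b" "(F ^^ q) b - (F ^^ q) a = (b - a) * exp (log_deriv_iter q u)"
    using MVT2[OF ab, of "F ^^ q" "\<lambda>x. exp (log_deriv_iter q x)"] iter_has_exp_deriv by blast
  obtain w where w: "(G ^^ q) a < w" "w < (G ^^ q) b"
    "b - a = ((G ^^ q) b - (G ^^ q) a) * exp (log_deriv_iter q w)"
    using MVT2[OF G_less[OF ab], of q "F ^^ q" "\<lambda>x. exp (log_deriv_iter q x)"] iter_has_exp_deriv
    by (auto simp: FGn)
  \<comment> \<open>The link between \<open>u\<close> in the arc and \<open>w\<close> in its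
    backward image: \<open>t\<close> lies in the arc together with \<open>u\<close>, while its
    translate by \<open>- p\<close> lies in the closest return arc based at \<open>w\<close>. Each
    comparison costs one \<open>V\<close>.\<close>
  define t where "t = (F ^^ q) w"
  have t: "a < t" "t < b"
    using w(1,2) iter_less_iff[of q "(G ^^ q) a" w] iter_less_iff[of q w "(G ^^ q) b"] by (auto simp: t_def FGn)
  have "\<bar>log_deriv_iter q u - log_deriv_iter q t\<bar> \<le> V"
    by (rule log_deriv_iter_diff_le[OF wandering_tower[OF ab H, of q]]) (use u t in auto)
  moreover have "\<bar>log_deriv_iter q (t - of_int p) - log_deriv_iter q w\<bar> \<le> V"
  proof (rule log_deriv_iter_diff_le[OF disjoint_tower[OF q(3,8,5), where x = w]])
    show "(F ^^ i) (t - of_int p) \<le> (F ^^ (i + q)) w - of_int p" for i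
      using iter_add_of_int[of i t "- p"] by (simp add: t_def funpow_add)
    have "w + of_int 0 < t + of_int (- p)"
      using orbit_less_iff[of 0 w 0 q "- p"] q(3) by (simp add: t_def)
    then show "w \<le> t - of_int p" by simp
    then show "w \<le> t - of_int p" .
    show "q \<le> Q" using q(2) by simp
  qed auto
  moreover have "log_deriv_iter q (t - of_int p) = log_deriv_iter q t"
    unfolding log_deriv_iter_def
    using iter_add_of_int[of _ t "- p"] D_add_of_int[of _ "- p"] by (intro sum.cong) auto
  ultimately have "log_deriv_iter q w \<le> log_deriv_iter q u + 2 * V" by linarith
  then have e: "exp (log_deriv_iter q w) \<le> exp (log_deriv_iter q u) * exp (2 * V)"
    unfolding exp_add[symmetric] exp_le_cancel_iff .
  define l m where "l = (F ^^ q) b - (F ^^ q) a" and "m = (G ^^ q) b - (G ^^ q) a"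
  have pos: "0 < l" "0 < m" using ab G_less[OF ab, of q] by (auto simp: l_def m_def)
  have lm: "l < \<epsilon>" "m < \<epsilon>" using N[OF Nq] by (auto simp: l_def m_def)
  have "(b - a) * (b - a) = (b - a) * (m * exp (log_deriv_iter q w))" using w(3) by (simp add: m_def)
  also have "\<dots> \<le> (b - a) * (m * (exp (log_deriv_iter q u) * exp (2 * V)))"
    using ab pos e by (intro mult_left_mono) auto
  also have "\<dots> = l * m * exp (2 * V)" using u(3) by (simp add: l_def mult_ac)
  also have "\<dots> < \<epsilon> * \<epsilon> * exp (2 * V)"
    using pos lm by (intro mult_strict_right_mono mult_strict_mono) auto
  also have "\<dots> = (b - a) * (b - a) * (exp (- V) * exp (- V) * exp (2 * V))"
    by (simp add: \<epsilon>_def mult_ac)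
  also have "exp (- V) * exp (- V) * exp (2 * V) = 1"
    by (simp flip: exp_add)
  finally show False by simp
qed

text \<open>An interval of length at least 2 / N contains an integer translate of a whole cell of
  length 1 / N, across which \<open>semiconj\<close> gains at least the smallest of \<open>N\<close>
  positive increments.\<close>

lemma short_if_semiconj_close:
  assumes "0 < \<epsilon>"
  obtains \<eta> where "0 < \<eta>" "\<And>u v. semiconj v - semiconj u < \<eta> \<Longrightarrow> v - u < \<epsilon>"
proof -
  obtain N :: nat where N: "0 < N" "2 / real N < \<epsilon>"
  proof -
    obtain n where "inverse (real (Suc n)) < \<epsilon> / 2" using reals_Archimedean[of "\<epsilon> / 2"] assms by auto
    then show ?thesis using that[of "Suc n"] by (simp add: field_simps)
  qed
  define \<eta> where "\<eta> = Min ((\<lambda>k. semiconj (real (Suc k) / N) - semiconj (real k / N)) ` {..<N})"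
  have "0 < \<eta>"
    unfolding \<eta>_def using N by (subst Min_gr_iff) (auto intro!: semiconj_strict_mono simp: divide_strict_right_mono)
  moreover have "v - u < \<epsilon>" if small: "semiconj v - semiconj u < \<eta>" for u v
  proof (rule ccontr)
    assume "\<not> v - u < \<epsilon>"
    then have uv: "u + 2 / real N < v" using N(2) by simp
    define j where "j = \<lceil>real N * u\<rceil>"
    define k where "k = nat (j mod int N)"
    define r where "r = j div int N"
    have k: "k < N" "j = int k + int N * r"
      using N(1) by (auto simp: k_def r_def nat_less_iff)
    have j: "real N * u \<le> of_int j" "of_int j < real N * u + 1" unfolding j_def by linarith+
    have Nuv: "real N * u + 2 < real N * v"
    proof -
      have "real N * (u + 2 / real N) < real N * v" using uv N(1) by (intro mult_strict_left_mono) auto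
      then show ?thesis using N(1) by (simp add: distrib_left)
    qed
    have "u \<le> real k / N + of_int r" "real (Suc k) / N + of_int r \<le> v"
      using j Nuv N(1) by (simp_all add: k(2) field_simps)
    from this[THEN semiconj_mono]
    have "semiconj u \<le> semiconj (real k / N) + of_int r" "semiconj (real (Suc k) / N) + of_int r \<le> semiconj v"
      using semiconj_iter[of 0 "real k / N" r] semiconj_iter[of 0 "real (Suc k) / N" r] by simp_all
    moreover have "\<eta> \<le> semiconj (real (Suc k) / N) - semiconj (real k / N)"
      unfolding \<eta>_def using k(1) by (intro Min_le) auto
    ultimately show False using small by linarith
  qed
  ultimately show ?thesis using that by blast
qed

text \<open>With g the \<open>q\<close>-th iterate shifted by \<open>- p\<close>, the arcs are
  [x, g x] and [g x, g (g x)]. A single row of images is disjoint but may leave gaps; two adjacent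
  rows cover the circle, at the price of multiplicity at most 2 and distortion 2V.\<close>

lemma tower:
  assumes "0 < \<epsilon>"
  obtains x y z Q where "x < y" "y < z" "z - x \<le> 2 * (y - x)" "0 < Q"
    "\<And>i. (F ^^ i) z - (F ^^ i) x < \<epsilon>"
    "disjoint_arcs {..<Q} (\<lambda>i. (F ^^ i) x) (\<lambda>i. (F ^^ i) y)"
    "disjoint_arcs {..<Q} (\<lambda>i. (F ^^ i) y) (\<lambda>i. (F ^^ i) z)"
    "\<And>t. \<exists>i<Q. \<exists>r. (F ^^ i) x + of_int r \<le> t \<and> t < (F ^^ i) z + of_int r"
    "\<And>i s t. i \<le> Q \<Longrightarrow> x \<le> s \<Longrightarrow> s \<le> z \<Longrightarrow> x \<le> t \<Longrightarrow> t \<le> z \<Longrightarrow>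
       \<bar>log_deriv_iter i s - log_deriv_iter i t\<bar> \<le> 2 * V"
proof -
  obtain \<eta> where \<eta>: "0 < \<eta>" "\<And>u v. semiconj v - semiconj u < \<eta> \<Longrightarrow> v - u < \<epsilon>"
    using short_if_semiconj_close[OF assms] by blast
  obtain q Q p P where q: "0 < q" "q < Q" "0 < real q * \<alpha> - of_int p" "real q * \<alpha> - of_int p < \<eta> / 2"
    "\<And>k r. 0 < k \<Longrightarrow> k < Q \<Longrightarrow> real q * \<alpha> - of_int p \<le> \<bar>real k * \<alpha> - of_int r\<bar>"
    "real Q * \<alpha> - of_int P < 0" "- (real q * \<alpha> - of_int p) < real Q * \<alpha> - of_int P"
    "real q * \<alpha> - of_int p < 1 / 2"
    using close_return[OF irrational half_gt_zero[OF \<eta>(1)]] by blast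
  define g where "g = (\<lambda>t. (F ^^ q) t - of_int p)"
  \<comment> \<open>The base point maximises the displacement of \<open>g\<close>, so the second arc
    is no longer than the first and the base arc fills at least half of [x, z].\<close>
  have "\<exists>x\<in>{0..1}. \<forall>t\<in>{0..1}. g t - t \<le> g x - x"
    unfolding g_def by (intro continuous_attains_sup continuous_intros cont_iter) auto
  then obtain x where x: "\<And>t. t \<in> {0..1} \<Longrightarrow> g t - t \<le> g x - x" by blast
  have gx_max: "g t - t \<le> g x - x" for t
  proof -
    have "g (frac t) - frac t = g t - t"
      unfolding g_def frac_def using iter_add_of_int[of q t "- \<lfloor>t\<rfloor>"] by simp
    then show ?thesis using x[of "frac t"] frac_lt_1[of t] by (simp add: less_imp_le)
  qed
  have Fg: "(F ^^ i) (g t) = (F ^^ (i + q)) t - of_int p" for i t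
    unfolding g_def funpow_add using iter_add_of_int[of i "(F ^^ q) t" "- p"] by simp
  define y z where "y = g x" and "z = g y"
  have g_gr: "t < g t" for t
    using orbit_less_iff[of 0 t 0 q "- p"] q(3) by (simp add: g_def)
  have Fz: "(F ^^ i) z = (F ^^ (i + 2 * q)) x + of_int (- 2 * p)" for i
  proof -
    have "i + q + q = i + 2 * q" by simp
    then have "(F ^^ i) z = (F ^^ (i + 2 * q)) x - of_int p - of_int p"
      unfolding z_def y_def Fg by (simp only:)
    then show ?thesis by simp
  qed
  have dis: "disjoint_arcs {..<Q} (\<lambda>i. (F ^^ i) t) (\<lambda>i. (F ^^ i) (g t))" for t
    unfolding Fg by (rule disjoint_tower[OF q(3,8,5)])
  have cover: "\<exists>i<Q. \<exists>r. (F ^^ i) x + of_int r \<le> t \<and> t < (F ^^ i) z + of_int r" for t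
  proof -
    define s where "s = (\<lambda>i. (F ^^ i) x + of_int \<lfloor>t - (F ^^ i) x\<rfloor>)"
    have s_le: "s i \<le> t" for i unfolding s_def by linarith
    have s_max: "(F ^^ i) x + of_int r \<le> s i" if "(F ^^ i) x + of_int r \<le> t" for i r
      using that unfolding s_def by (simp add: le_floor_iff)
    have "Max (s ` {..<Q}) \<in> s ` {..<Q}" using q(2) by (intro Max_in) auto
    then obtain i where i: "i < Q" "s i = Max (s ` {..<Q})" by auto
    have i_max: "s j \<le> s i" if "j < Q" for j unfolding i(2) using that by simp
    define r where "r = \<lfloor>t - (F ^^ i) x\<rfloor>"
    have "t < (F ^^ i) z + of_int r"
    proof -
      \<comment> \<open>To the right of level \<open>i\<close> there is another tower point before
        the right end of its double arc: level \<open>i + q\<close>, or, if that exceeds the tower,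
        level \<open>i + q - Q\<close>, where the closer return \<open>Q\<close> from the left
        serves as correction. Since \<open>s i\<close> is maximal below \<open>t\<close>, this point
        lies beyond \<open>t\<close>.\<close>
      have "\<exists>j<Q. \<exists>m. (F ^^ i) x + of_int r < (F ^^ j) x + of_int m \<and> (F ^^ j) x + of_int m \<le> (F ^^ (i + 2 * q)) x + of_int (r - 2 * p)"
      proof (cases "i + q < Q")
        case True
        have "(F ^^ i) x + of_int r < (F ^^ (i + q)) x + of_int (r - p)"
          unfolding orbit_less_iff using q(3) by (simp add: algebra_simps)
        moreover have "(F ^^ (i + q)) x + of_int (r - p) < (F ^^ (i + 2 * q)) x + of_int (r - 2 * p)"
          unfolding orbit_less_iff using q(3) by (simp add: algebra_simps)
        ultimately show ?thesis using True by (meson less_imp_le)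
      next
        case False
        define j where "j = i + q - Q"
        have j: "j < Q" "real j = real i + real q - real Q" using False i(1) q(2) by (auto simp: j_def of_nat_diff)
        have "(F ^^ i) x + of_int r < (F ^^ j) x + of_int (r + P - p)"
          unfolding orbit_less_iff j(2) using q(3,6) by (simp add: algebra_simps)
        moreover have "(F ^^ j) x + of_int (r + P - p) < (F ^^ (i + 2 * q)) x + of_int (r - 2 * p)"
          unfolding orbit_less_iff j(2) using q(7) by (simp add: algebra_simps)
        ultimately show ?thesis using j(1) by (meson less_imp_le)
      qed
      then obtain j m where j: "j < Q" "s i < (F ^^ j) x + of_int m"
        "(F ^^ j) x + of_int m \<le> (F ^^ i) z + of_int r"
        unfolding Fz s_def r_def[symmetric] by auto
      have "\<not> (F ^^ j) x + of_int m \<le> t" using s_max[of j m] i_max[OF j(1)] j(2) by linarith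
      then show ?thesis using j(3) by linarith
    qed
    moreover have "(F ^^ i) x + of_int r \<le> t" using s_le[of i] by (simp add: s_def r_def)
    ultimately show ?thesis using i(1) by blast
  qed
  have dist1: "\<bar>log_deriv_iter i s - log_deriv_iter i t\<bar> \<le> V"
    if "i \<le> Q" "c \<le> s" "s \<le> g c" "c \<le> t" "t \<le> g c" for i s t c
    by (rule log_deriv_iter_diff_le[OF dis[of c]]) (use that in auto)
  have V0: "0 \<le> V" using dist1[of 0 x x x] g_gr[of x] by force
  have dist2: "\<bar>log_deriv_iter i s - log_deriv_iter i t\<bar> \<le> 2 * V"
    if "i \<le> Q" "x \<le> s" "s \<le> z" "x \<le> t" "t \<le> z" for i s t
  proof -
    have "\<bar>log_deriv_iter i s - log_deriv_iter i y\<bar> \<le> V" "\<bar>log_deriv_iter i t - log_deriv_iter i y\<bar> \<le> V"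
      using dist1[OF that(1), of x _ y] dist1[OF that(1), of y _ y] that g_gr[of x] g_gr[of y]
      unfolding y_def[symmetric] z_def[symmetric] by (meson le_cases order.refl less_imp_le)+
    then show ?thesis by linarith
  qed
  \<comment> \<open>Seen through \<open>semiconj\<close>, each double arc has length twice the
    return distance; this is why the return was taken below \<open>\<eta> / 2\<close>.\<close>
  have small: "(F ^^ i) z - (F ^^ i) x < \<epsilon>" for i
  proof (rule \<eta>(2))
    show "semiconj ((F ^^ i) z) - semiconj ((F ^^ i) x) < \<eta>"
      unfolding Fz semiconj_iter using semiconj_iter[of i x 0] q(4) by (simp add: algebra_simps)
  qed
  show ?thesis
  proof (rule that[of x y z Q])
    show "x < y" "y < z" using g_gr by (auto simp: y_def z_def)
    show "z - x \<le> 2 * (y - x)" using gx_max[of y] by (simp add: y_def z_def)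
    show "0 < Q" using q(2) by simp
    show "disjoint_arcs {..<Q} (\<lambda>i. (F ^^ i) x) (\<lambda>i. (F ^^ i) y)" unfolding y_def by (rule dis)
    show "disjoint_arcs {..<Q} (\<lambda>i. (F ^^ i) y) (\<lambda>i. (F ^^ i) z)" unfolding z_def by (rule dis)
  qed (use small cover dist2 in auto)
qed

end

section \<open>Bounded Borel functions on the circle\<close>

definition circ :: "(real \<Rightarrow> real) \<Rightarrow> bool" where
  "circ f \<longleftrightarrow> f \<in> borel_measurable borel \<and> (\<forall>x. f (x + 1) = f x) \<and> (\<exists>B. \<forall>x. \<bar>f x\<bar> \<le> B)"

lemma circ_measurable [measurable_dest]: "circ f \<Longrightarrow> f \<in> borel_measurable borel"
  by (simp add: circ_def)

lemma circ_const: "circ (\<lambda>_. c)"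
  unfolding circ_def by auto

lemma circ_add:
  assumes "circ f" "circ g" shows "circ (\<lambda>x. f x + g x)"
proof -
  obtain A B where "\<And>x. \<bar>f x\<bar> \<le> A" "\<And>x. \<bar>g x\<bar> \<le> B" using assms unfolding circ_def by blast
  then have "\<bar>f x + g x\<bar> \<le> A + B" for x by (meson abs_triangle_ineq add_mono order_trans)
  then show ?thesis using assms unfolding circ_def by auto
qed

lemma circ_mult:
  assumes "circ f" "circ g" shows "circ (\<lambda>x. f x * g x)"
proof -
  obtain A B where "\<And>x. \<bar>f x\<bar> \<le> A" "\<And>x. \<bar>g x\<bar> \<le> B" using assms unfolding circ_def by blast
  then have "\<bar>f x * g x\<bar> \<le> A * B" for x
    unfolding abs_mult by (intro mult_mono) (auto intro: order_trans[OF abs_ge_zero])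
  then show ?thesis using assms unfolding circ_def by auto
qed

lemma circ_uminus: "circ f \<Longrightarrow> circ (\<lambda>x. - f x)"
  using circ_mult[OF circ_const[of "-1"], of f] by simp

lemma circ_diff: "circ f \<Longrightarrow> circ g \<Longrightarrow> circ (\<lambda>x. f x - g x)"
  using circ_add[OF _ circ_uminus, of f g] by simp

lemma circ_abs: "circ f \<Longrightarrow> circ (\<lambda>x. \<bar>f x\<bar>)"
  unfolding circ_def by auto

lemma circ_max: "circ f \<Longrightarrow> circ g \<Longrightarrow> circ (\<lambda>x. max (f x) (g x))"
proof -
  assume "circ f" "circ g"
  then have "circ (\<lambda>x. (f x + g x + \<bar>f x - g x\<bar>) * (1 / 2))"
    by (intro circ_mult circ_add circ_abs circ_diff circ_const)
  moreover have "(f x + g x + \<bar>f x - g x\<bar>) * (1 / 2) = max (f x) (g x)" for x by (simp add: max_def)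
  ultimately show ?thesis by simp
qed

lemma circ_sum:
  fixes f :: "'a \<Rightarrow> real \<Rightarrow> real"
  shows "(\<And>i. i \<in> A \<Longrightarrow> circ (f i)) \<Longrightarrow> circ (\<lambda>x. \<Sum>i\<in>A. f i x)"
  by (induction A rule: infinite_finite_induct) (auto simp: circ_const circ_add)

lemma circ_divide_ge_1:
  assumes "circ f" "circ m" "\<And>x. 1 \<le> m x"
  shows "circ (\<lambda>x. f x / m x)"
proof -
  obtain A where A: "\<And>x. \<bar>f x\<bar> \<le> A" using assms unfolding circ_def by blast
  have "\<bar>f x / m x\<bar> \<le> A" for x
  proof -
    have "\<bar>f x / m x\<bar> \<le> \<bar>f x\<bar> / 1"
      unfolding abs_divide using assms(3)[of x] by (intro divide_left_mono) auto
    then show ?thesis using A[of x] by simp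
  qed
  then show ?thesis using assms unfolding circ_def by auto
qed

lemma circ_continuous:
  assumes "continuous_on UNIV f" "\<And>x. f (x + 1) = f x"
  shows "circ f"
proof -
  have "compact (f ` {0..1})"
    by (intro compact_continuous_image continuous_on_subset[OF assms(1)]) auto
  then obtain B where B: "\<And>x. x \<in> {0..1} \<Longrightarrow> \<bar>f x\<bar> \<le> B"
    using compact_imp_bounded[of "f ` {0..1}"] unfolding bounded_iff by (metis image_eqI real_norm_def)
  have "\<bar>f x\<bar> \<le> B" for x
  proof -
    have "f (frac x) = f x" using add_of_int[of f 0 x "- \<lfloor>x\<rfloor>"] assms(2) by (simp add: frac_def)
    then show ?thesis using B[of "frac x"] frac_lt_1[of x] by (auto simp: less_imp_le)
  qed
  then show ?thesis
    unfolding circ_def using assms borel_measurable_continuous_onI by blast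
qed

lemma circ_add_of_int: "circ f \<Longrightarrow> f (x + of_int k) = f x"
  using add_of_int[of f 0 x k] by (simp add: circ_def)

lemma circ_set_integrable:
  assumes "circ f" shows "set_integrable lborel {a..b} f"
proof -
  obtain B where B: "\<And>x. \<bar>f x\<bar> \<le> B" using assms unfolding circ_def by blast
  have "set_integrable lborel {a..b} (\<lambda>_. B)"
    unfolding set_integrable_def by (simp add: emeasure_lborel_Icc_eq)
  then show ?thesis
  proof (rule set_integrable_bound)
    show "set_borel_measurable lborel {a..b} f"
      unfolding set_borel_measurable_def using assms by measurable
    show "AE x in lborel. x \<in> {a..b} \<longrightarrow> norm (f x) \<le> norm B"
      using B by (auto intro: order_trans[OF _ abs_ge_self])
  qed
qed

lemma circ_integrable: "circ f \<Longrightarrow> f integrable_on {a..b}"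
  using set_borel_integral_eq_integral(1)[OF circ_set_integrable] .

lemma circ_lebesgue_eq: "circ f \<Longrightarrow> (LINT x:{a..b}|lborel. f x) = integral {a..b} f"
  using set_borel_integral_eq_integral(2)[OF circ_set_integrable] .

lemma integral_shift_int:
  assumes "circ f" shows "integral {a + of_int k..b + of_int k} f = integral {a..b} f"
proof -
  have "(LINT x:{a + of_int k..b + of_int k}|lborel. f x) =
      (LINT x|lborel. indicator {a + of_int k..b + of_int k} (of_int k + 1 * x) *\<^sub>R f (of_int k + 1 * x))"
    unfolding set_lebesgue_integral_def by (subst lborel_integral_real_affine[of 1 _ "of_int k"]) auto
  also have "\<dots> = (LINT x:{a..b}|lborel. f x)"
    unfolding set_lebesgue_integral_def
    using circ_add_of_int[OF assms] by (intro Bochner_Integration.integral_cong) (auto simp: indicator_def add.commute)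
  finally show ?thesis by (simp only: circ_lebesgue_eq[OF assms])
qed

lemma integral_period:
  assumes "circ f" shows "integral {a..a + 1} f = integral {0..1} f"
proof -
  define k where "k = \<lfloor>a\<rfloor>"
  have k: "of_int k \<le> a" "a \<le> of_int k + 1" unfolding k_def by linarith+
  have "integral {a..a + 1} f = integral {a..of_int k + 1} f + integral {of_int k + 1..a + 1} f"
    using k by (intro Henstock_Kurzweil_Integration.integral_combine[symmetric] circ_integrable assms) auto
  also have "integral {of_int k + 1..a + 1} f = integral {of_int k..a} f"
    using integral_shift_int[OF assms, of "of_int k" 1 a] by simp
  also have "integral {a..of_int k + 1} f + integral {of_int k..a} f = integral {of_int k..of_int k + 1} f"
    using k Henstock_Kurzweil_Integration.integral_combine[of "of_int k" a "of_int k + 1" f] circ_integrable[OF assms]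
    by (simp add: add.commute)
  also have "\<dots> = integral {0..1} f"
    using integral_shift_int[OF assms, of 0 k 1] by (simp add: add.commute)
  finally show ?thesis .
qed

definition norm1 :: "(real \<Rightarrow> real) \<Rightarrow> real" where
  "norm1 f = integral {0..1} (\<lambda>x. \<bar>f x\<bar>)"

lemma norm1_nonneg: "circ f \<Longrightarrow> 0 \<le> norm1 f"
  unfolding norm1_def by (intro integral_nonneg circ_integrable circ_abs) auto

lemma norm1_add: "circ f \<Longrightarrow> circ g \<Longrightarrow> norm1 (\<lambda>x. f x + g x) \<le> norm1 f + norm1 g"
  unfolding norm1_def
  by (subst integral_add[symmetric]) (auto intro!: integral_le circ_integrable circ_abs circ_add)

lemma norm1_uminus: "norm1 (\<lambda>x. - f x) = norm1 f"
  unfolding norm1_def by simp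

lemma norm1_diff: "circ f \<Longrightarrow> circ g \<Longrightarrow> norm1 (\<lambda>x. f x - g x) \<le> norm1 f + norm1 g"
  using norm1_add[OF _ circ_uminus, of f g] by (simp add: norm1_uminus)

lemma norm1_scale: "norm1 (\<lambda>x. c * f x) = \<bar>c\<bar> * norm1 f"
  unfolding norm1_def by (simp add: abs_mult)

lemma norm1_sum:
  assumes "finite A" "\<And>i. i \<in> A \<Longrightarrow> circ (f i)"
  shows "norm1 (\<lambda>x. \<Sum>i\<in>A. f i x) \<le> (\<Sum>i\<in>A. norm1 (f i))"
  using assms
proof (induction A rule: finite_induct)
  case (insert a A)
  have "norm1 (\<lambda>x. f a x + (\<Sum>i\<in>A. f i x)) \<le> norm1 (f a) + norm1 (\<lambda>x. \<Sum>i\<in>A. f i x)"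
    using insert by (intro norm1_add circ_sum) auto
  with insert show ?case by fastforce
qed (simp add: norm1_def)

text \<open>The number of integers \<open>r\<close> with \<open>a + r \<le> t < b + r\<close>.\<close>

definition arc_count :: "real \<Rightarrow> real \<Rightarrow> real \<Rightarrow> real" where
  "arc_count a b t = of_int (\<lfloor>t - a\<rfloor> - \<lfloor>t - b\<rfloor>)"

lemma arc_count_nonneg: "a \<le> b \<Longrightarrow> 0 \<le> arc_count a b t"
  unfolding arc_count_def by (simp add: floor_mono)

lemma arc_count_ge_1: "a + of_int r \<le> t \<Longrightarrow> t < b + of_int r \<Longrightarrow> 1 \<le> arc_count a b t"
proof -
  assume "a + of_int r \<le> t" "t < b + of_int r"
  then have "r \<le> \<lfloor>t - a\<rfloor>" "\<lfloor>t - b\<rfloor> < r" by (auto simp: le_floor_iff floor_less_iff)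
  then show ?thesis unfolding arc_count_def by linarith
qed

lemma arc_count_pos:
  assumes "0 < arc_count a b t"
  obtains r :: int where "a + of_int r \<le> t" "t < b + of_int r"
proof -
  have "\<lfloor>t - b\<rfloor> < \<lfloor>t - a\<rfloor>" using assms unfolding arc_count_def by linarith
  then have "t - b < of_int \<lfloor>t - a\<rfloor>" by (simp add: floor_less_iff)
  moreover have "of_int \<lfloor>t - a\<rfloor> \<le> t - a" by linarith
  ultimately show ?thesis by (intro that[of "\<lfloor>t - a\<rfloor>"]) linarith+
qed

lemma arc_count_le_1: "b \<le> a + 1 \<Longrightarrow> arc_count a b t \<le> 1"
proof -
  assume "b \<le> a + 1"
  then have "\<lfloor>t - a\<rfloor> \<le> \<lfloor>(t - b) + 1\<rfloor>" by (intro floor_mono) simp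
  also have "\<dots> = \<lfloor>t - b\<rfloor> + 1" by simp
  finally show ?thesis unfolding arc_count_def by linarith
qed

lemma arc_count_split: "arc_count a b t + arc_count b c t = arc_count a c t"
  unfolding arc_count_def by simp

lemma circ_arc_count: assumes "a \<le> b" shows "circ (arc_count a b)"
  unfolding circ_def
proof (intro conjI allI exI[of _ "b - a + 1"])
  show "arc_count a b \<in> borel_measurable borel"
    unfolding arc_count_def by measurable
  show "arc_count a b (x + 1) = arc_count a b x" for x
  proof -
    have "\<lfloor>x + 1 - c\<rfloor> = \<lfloor>x - c\<rfloor> + 1" for c :: real
      unfolding one_add_floor by (simp add: algebra_simps)
    then show ?thesis by (simp add: arc_count_def)
  qed
  show "\<bar>arc_count a b x\<bar> \<le> b - a + 1" for x
    using arc_count_nonneg[OF assms, of x] unfolding arc_count_def by simp linarith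
qed

lemma disjoint_arcsD:
  "disjoint_arcs I u v \<Longrightarrow> i \<in> I \<Longrightarrow> j \<in> I \<Longrightarrow> i \<noteq> j \<or> r \<noteq> 0 \<Longrightarrow> v i + of_int r \<le> u j \<or> v j \<le> u i + of_int r"
  unfolding disjoint_arcs_def by blast

lemma sum_arc_count_le_1:
  assumes dis: "disjoint_arcs I u v"
  shows "(\<Sum>i\<in>I. arc_count (u i) (v i) t) \<le> 1"
proof (cases "\<exists>i\<in>I. 0 < arc_count (u i) (v i) t")
  case False
  then have "(\<Sum>i\<in>I. arc_count (u i) (v i) t) \<le> 0" by (intro sum_nonpos) auto
  then show ?thesis by simp
next
  case True
  then obtain i where i: "i \<in> I" "0 < arc_count (u i) (v i) t" by blast
  have zero: "arc_count (u j) (v j) t = 0" if "j \<in> I" "j \<noteq> i" for j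
  proof (rule ccontr)
    assume nz: "arc_count (u j) (v j) t \<noteq> 0"
    have "0 \<le> arc_count (u j) (v j) t"
      using dis that(1) by (intro arc_count_nonneg) (auto simp: disjoint_arcs_def less_imp_le)
    with nz have "0 < arc_count (u j) (v j) t" by simp
    then obtain s :: int where s: "u j + of_int s \<le> t" "t < v j + of_int s" by (rule arc_count_pos)
    obtain r :: int where r: "u i + of_int r \<le> t" "t < v i + of_int r" using i(2) by (rule arc_count_pos)
    have "v i + of_int (r - s) \<le> u j \<or> v j \<le> u i + of_int (r - s)"
      using disjoint_arcsD[OF dis i(1) that(1)] that(2) by blast
    then show False using r s by auto
  qed
  have "u i < v i" using dis i(1) by (simp add: disjoint_arcs_def)
  then have "v i \<le> u i + 1" using disjoint_arcsD[OF dis i(1) i(1), of 1] by auto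
  have "(\<Sum>j\<in>I. arc_count (u j) (v j) t) = (\<Sum>j\<in>{i}. arc_count (u j) (v j) t)"
    using dis i(1) zero by (intro sum.mono_neutral_right) (auto simp: disjoint_arcs_def)
  then show ?thesis using arc_count_le_1[OF \<open>v i \<le> u i + 1\<close>] by simp
qed

lemma integral_arc_count:
  assumes "circ f" "a \<le> b" "b \<le> a + 1"
  shows "integral {0..1} (\<lambda>t. f t * arc_count a b t) = integral {a..b} f"
proof -
  let ?g = "\<lambda>t. f t * arc_count a b t"
  have g: "circ ?g" using assms by (intro circ_mult circ_arc_count)
  \<comment> \<open>A period starting at \<open>a\<close> contains the arc uncut.\<close>
  have "integral {0..1} ?g = integral {a..a + 1} ?g" by (rule integral_period[OF g, symmetric])
  also have "\<dots> = integral {a..b} ?g + integral {b..a + 1} ?g"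
    using assms g by (intro Henstock_Kurzweil_Integration.integral_combine[symmetric] circ_integrable) auto
  also have "integral {a..b} ?g = integral {a..b} f"
  proof (rule integral_spike[of "{b}"])
    fix t assume t: "t \<in> {a..b} - {b}"
    then have "1 \<le> arc_count a b t" by (intro arc_count_ge_1[of _ 0]) auto
    then show "f t = ?g t" using arc_count_le_1[OF assms(3), of t] by simp
  qed simp
  also have "integral {b..a + 1} ?g = integral {b..a + 1} (\<lambda>_. 0)"
  proof (rule integral_spike[of "{a + 1}"])
    fix t assume t: "t \<in> {b..a + 1} - {a + 1}"
    then have "\<lfloor>t - a\<rfloor> = 0" "\<lfloor>t - b\<rfloor> = 0" using assms by (auto intro!: floor_unique)
    then show "0 = ?g t" by (simp add: arc_count_def)
  qed simp
  finally show ?thesis by simp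
qed

section \<open>The transfer operator on densities\<close>

context diffeo_lift
begin

definition transfer :: "nat \<Rightarrow> (real \<Rightarrow> real) \<Rightarrow> real \<Rightarrow> real" where
  "transfer i f t = f ((F ^^ i) t) * exp (log_deriv_iter i t)"

lemma log_deriv_iter_cont: "continuous_on UNIV (log_deriv_iter i)"
  unfolding log_deriv_iter_def[abs_def]
proof (intro continuous_on_sum)
  fix k
  have "continuous_on UNIV (\<lambda>x. D ((F ^^ k) x))"
    by (rule continuous_on_compose2[OF cont_D cont_iter]) simp
  then show "continuous_on UNIV (\<lambda>x. ln (D ((F ^^ k) x)))"
    using D_pos by (intro continuous_on_ln) (auto simp: less_imp_neq[symmetric])
qed

lemma log_deriv_iter_add_1: "log_deriv_iter i (t + 1) = log_deriv_iter i t"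
  unfolding log_deriv_iter_def by (simp add: iter_add_1 D_add_1)

lemma log_deriv_iter_add: "log_deriv_iter (i + j) t = log_deriv_iter i t + log_deriv_iter j ((F ^^ i) t)"
  by (induction j) (simp_all add: log_deriv_iter_def add.commute[of i] funpow_add)

lemma circ_exp_log_deriv: "circ (\<lambda>t. exp (log_deriv_iter i t))"
  by (intro circ_continuous continuous_on_exp log_deriv_iter_cont) (simp add: log_deriv_iter_add_1)

lemma circ_compose_iter: assumes "circ f" shows "circ (\<lambda>t. f ((F ^^ i) t))"
proof -
  have "(F ^^ i) \<in> borel_measurable borel" using cont_iter by (rule borel_measurable_continuous_onI)
  then have "(\<lambda>t. f ((F ^^ i) t)) \<in> borel_measurable borel"
    by (rule measurable_compose[OF _ circ_measurable[OF assms]])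
  then show ?thesis using assms unfolding circ_def by (auto simp: iter_add_1)
qed

lemma circ_transfer: "circ f \<Longrightarrow> circ (transfer i f)"
  unfolding transfer_def[abs_def] by (intro circ_mult circ_compose_iter circ_exp_log_deriv)

lemma integral_transfer:
  assumes "circ f" shows "integral {0..1} (transfer i f) = integral {0..1} f"
proof -
  have "(LBINT x. f x * indicator {(F ^^ i) 0..(F ^^ i) 1} x) =
      (LBINT x. f ((F ^^ i) x) * exp (log_deriv_iter i x) * indicator {0..1} x)"
    by (rule integral_substitution(2))
       (auto intro: circ_set_integrable[OF assms] iter_has_exp_deriv continuous_on_subset[of UNIV] continuous_on_exp log_deriv_iter_cont)
  then have "(LINT x:{(F ^^ i) 0..(F ^^ i) 1}|lborel. f x) = (LINT x:{0..1}|lborel. transfer i f x)"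
    unfolding set_lebesgue_integral_def transfer_def by (simp add: mult.commute mult.left_commute)
  then have "integral {(F ^^ i) 0..(F ^^ i) 1} f = integral {0..1} (transfer i f)"
    using circ_lebesgue_eq assms circ_transfer by metis
  moreover have "(F ^^ i) 1 = (F ^^ i) 0 + 1" using iter_add_1[of i 0] by simp
  ultimately show ?thesis using integral_period[OF assms] by metis
qed

lemma norm1_transfer: "circ f \<Longrightarrow> norm1 (transfer i f) = norm1 f"
proof -
  assume "circ f"
  then have "integral {0..1} (transfer i (\<lambda>x. \<bar>f x\<bar>)) = integral {0..1} (\<lambda>x. \<bar>f x\<bar>)"
    by (intro integral_transfer circ_abs)
  then show ?thesis unfolding norm1_def transfer_def[abs_def] by (simp add: abs_mult)
qed

lemma transfer_transfer: "transfer i (transfer j f) = transfer (i + j) f"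
proof
  fix t
  have "(F ^^ (i + j)) t = (F ^^ j) ((F ^^ i) t)" by (metis add.commute comp_apply funpow_add)
  then show "transfer i (transfer j f) t = transfer (i + j) f t"
    by (simp add: transfer_def log_deriv_iter_add exp_add)
qed

definition birkhoff :: "nat \<Rightarrow> (real \<Rightarrow> real) \<Rightarrow> real \<Rightarrow> real" where
  "birkhoff n f t = (\<Sum>i<n. transfer i f t)"

lemma circ_birkhoff: "circ f \<Longrightarrow> circ (birkhoff n f)"
  unfolding birkhoff_def[abs_def] by (intro circ_sum circ_transfer)

lemma birkhoff_cont:
  assumes "continuous_on UNIV f" shows "continuous_on UNIV (birkhoff n f)"
  unfolding birkhoff_def[abs_def] transfer_def[abs_def]
  by (intro continuous_on_sum continuous_on_mult continuous_on_exp log_deriv_iter_cont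
      continuous_on_compose2[OF assms cont_iter]) auto

lemma norm1_birkhoff_le: "circ f \<Longrightarrow> norm1 (birkhoff n f) \<le> real n * norm1 f"
  unfolding birkhoff_def[abs_def]
  using norm1_sum[of "{..<n}" "\<lambda>i. transfer i f"] by (simp add: circ_transfer norm1_transfer)

text \<open>The Birkhoff sum telescopes to \<open>i\<close> differences whatever \<open>n\<close>
  is, and \<open>transfer\<close> preserves the norm.\<close>

lemma norm1_birkhoff_coboundary:
  assumes "circ f"
  shows "norm1 (birkhoff n (\<lambda>t. f t - transfer i f t)) \<le> 2 * real i * norm1 f"
proof -
  have swap: "(\<Sum>k<n. a k - a (k + i)) = (\<Sum>k<i. a k - a (k + n))" for a :: "nat \<Rightarrow> real"
  proof -
    have 1: "(\<Sum>k<n + i. a k) = (\<Sum>k<n. a k) + (\<Sum>k<i. a (k + n))" for n i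
      by (induction i) (auto simp: add.commute)
    show ?thesis using 1[of n i] 1[of i n] by (simp add: sum_subtractf add.commute)
  qed
  have eq: "birkhoff n (\<lambda>t. f t - transfer i f t) = (\<lambda>t. \<Sum>k<i. transfer k f t - transfer (k + n) f t)"
  proof
    fix t
    have "birkhoff n (\<lambda>t. f t - transfer i f t) t = (\<Sum>k<n. transfer k f t - transfer k (transfer i f) t)"
      unfolding birkhoff_def by (simp add: transfer_def left_diff_distrib)
    then show "birkhoff n (\<lambda>t. f t - transfer i f t) t = (\<Sum>k<i. transfer k f t - transfer (k + n) f t)"
      using swap[of "\<lambda>k. transfer k f t"] by (simp only: transfer_transfer)
  qed
  have "norm1 (\<lambda>t. \<Sum>k<i. transfer k f t - transfer (k + n) f t) \<le> (\<Sum>k<i. norm1 (\<lambda>t. transfer k f t - transfer (k + n) f t))"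
    by (intro norm1_sum circ_diff circ_transfer assms) auto
  also have "\<dots> \<le> (\<Sum>k<i. norm1 f + norm1 f)"
    by (intro sum_mono order_trans[OF norm1_diff]) (simp_all add: circ_transfer norm1_transfer assms)
  finally show ?thesis unfolding eq by simp
qed

text \<open>Each piece may be moved by its own time; the total cost does not depend on
  \<open>n\<close> and disappears in averages.\<close>

lemma norm1_birkhoff_cohomologous:
  assumes f: "\<And>i. i < Q \<Longrightarrow> circ (f i)"
  shows "norm1 (birkhoff n (\<lambda>t. \<Sum>i<Q. f i t)) \<le>
    norm1 (birkhoff n (\<lambda>t. \<Sum>i<Q. transfer i (f i) t)) + (\<Sum>i<Q. 2 * real i * norm1 (f i))"
proof -
  have "birkhoff n (\<lambda>t. \<Sum>i<Q. f i t) t = birkhoff n (\<lambda>t. \<Sum>i<Q. transfer i (f i) t) t +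
      (\<Sum>i<Q. birkhoff n (\<lambda>t. f i t - transfer i (f i) t) t)" for t
  proof -
    have "(\<Sum>i<Q. birkhoff n (\<lambda>t. f i t - transfer i (f i) t) t) =
        (\<Sum>k<n. \<Sum>i<Q. transfer k (\<lambda>t. f i t - transfer i (f i) t) t)"
      unfolding birkhoff_def by (rule sum.swap)
    also have "\<dots> = birkhoff n (\<lambda>t. \<Sum>i<Q. f i t) t - birkhoff n (\<lambda>t. \<Sum>i<Q. transfer i (f i) t) t"
      unfolding birkhoff_def transfer_def
      by (simp add: sum_subtractf left_diff_distrib sum_distrib_right)
    finally show ?thesis by simp
  qed
  then have "birkhoff n (\<lambda>t. \<Sum>i<Q. f i t) = (\<lambda>t. birkhoff n (\<lambda>t. \<Sum>i<Q. transfer i (f i) t) t +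
      (\<Sum>i<Q. birkhoff n (\<lambda>t. f i t - transfer i (f i) t) t))" by (rule ext)
  then have "norm1 (birkhoff n (\<lambda>t. \<Sum>i<Q. f i t)) \<le> norm1 (birkhoff n (\<lambda>t. \<Sum>i<Q. transfer i (f i) t)) +
      norm1 (\<lambda>t. \<Sum>i<Q. birkhoff n (\<lambda>t. f i t - transfer i (f i) t) t)"
    using f by (simp only:) (intro norm1_add circ_birkhoff circ_sum circ_transfer circ_diff; simp)
  also have "norm1 (\<lambda>t. \<Sum>i<Q. birkhoff n (\<lambda>t. f i t - transfer i (f i) t) t) \<le>
      (\<Sum>i<Q. norm1 (birkhoff n (\<lambda>t. f i t - transfer i (f i) t)))"
    using f by (intro norm1_sum circ_birkhoff circ_diff circ_transfer) auto
  also have "\<dots> \<le> (\<Sum>i<Q. 2 * real i * norm1 (f i))"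
    using f by (intro sum_mono norm1_birkhoff_coboundary) auto
  finally show ?thesis by simp
qed

lemma arc_count_iter: "arc_count ((F ^^ i) a) ((F ^^ i) b) ((F ^^ i) t) = arc_count a b t"
proof -
  have "\<lfloor>(F ^^ i) t - (F ^^ i) a\<rfloor> = \<lfloor>t - a\<rfloor>" for a
  proof -
    have "r \<le> \<lfloor>(F ^^ i) t - (F ^^ i) a\<rfloor> \<longleftrightarrow> r \<le> \<lfloor>t - a\<rfloor>" for r
      using iter_le_iff[of i "a + of_int r" t] by (simp add: le_floor_iff iter_add_of_int le_diff_eq add.commute)
    then show ?thesis by (meson order_antisym order_refl)
  qed
  then show ?thesis by (simp add: arc_count_def)
qed

end


context denjoy_lift
begin

section \<open>Cancellation of mass and decay of Birkhoff averages\<close>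

lemma integral_split_positive:
  assumes "circ f" "integral {0..1} f = 0"
  shows "integral {0..1} (\<lambda>t. max (f t) 0) = norm1 f / 2" "integral {0..1} (\<lambda>t. max (- f t) 0) = norm1 f / 2"
proof -
  have i: "(\<lambda>t. max (f t) 0) integrable_on {0..1}" "(\<lambda>t. max (- f t) 0) integrable_on {0..1}"
    using assms(1) by (auto intro!: circ_integrable circ_max circ_uminus circ_const)
  have "integral {0..1} (\<lambda>t. max (f t) 0) - integral {0..1} (\<lambda>t. max (- f t) 0) = integral {0..1} f"
    unfolding Henstock_Kurzweil_Integration.integral_diff[OF i, symmetric]
    by (intro Henstock_Kurzweil_Integration.integral_cong) auto
  moreover have "integral {0..1} (\<lambda>t. max (f t) 0) + integral {0..1} (\<lambda>t. max (- f t) 0) = norm1 f"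
    unfolding norm1_def Henstock_Kurzweil_Integration.integral_add[OF i, symmetric]
    by (intro Henstock_Kurzweil_Integration.integral_cong) auto
  ultimately show "integral {0..1} (\<lambda>t. max (f t) 0) = norm1 f / 2" "integral {0..1} (\<lambda>t. max (- f t) 0) = norm1 f / 2"
    using assms(2) by auto
qed

text \<open>Moving the density of a continuous function to the base of a tower over a closest return
  makes positive and negative parts overlap there, because the branches of the tower have bounded
  distortion. This is where a definite proportion of the mass cancels.\<close>

lemma tower_cancellation:
  assumes \<psi>: "continuous_on UNIV \<psi>" "\<And>x. \<psi> (x + 1) = \<psi> x" "integral {0..1} \<psi> = 0" and \<epsilon>: "0 < \<epsilon>"
  obtains Q f where "\<And>i. i < Q \<Longrightarrow> circ (f i)" "\<psi> = (\<lambda>t. \<Sum>i<Q. f i t)"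
    "norm1 (\<lambda>t. \<Sum>i<Q. transfer i (f i) t) \<le> (1 - exp (- 2 * V) / 4) * norm1 \<psi> + \<epsilon>"
proof (cases "norm1 \<psi> = 0")
  case True
  have c\<psi>: "circ \<psi>" using \<psi> by (intro circ_continuous)
  have "norm1 (\<lambda>t. \<Sum>i<1. transfer i \<psi> t) \<le> 0"
    using True norm1_transfer[OF c\<psi>, of 0] by simp
  then show ?thesis using True c\<psi> \<epsilon> by (intro that[of 1 "\<lambda>_. \<psi>"]) auto
next
  case False
  have c\<psi>: "circ \<psi>" using \<psi> by (intro circ_continuous)
  define \<mu> where "\<mu> = norm1 \<psi>"
  have \<mu>: "0 < \<mu>" using False norm1_nonneg[OF c\<psi>] by (simp add: \<mu>_def)
  \<comment> \<open>The bound \<open>\<mu> / 4\<close> keeps the constant \<open>lam\<close> below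
    nonnegative; the other bound makes the final error at most \<open>\<epsilon>\<close>.\<close>
  define e where "e = min (\<mu> / 4) (\<epsilon> * exp (2 * V))"
  have e: "0 < e" "e \<le> \<mu> / 4" "exp (- 2 * V) * e \<le> \<epsilon>"
  proof -
    show "0 < e" "e \<le> \<mu> / 4" using \<mu> \<epsilon> by (simp_all add: e_def)
    have "exp (- 2 * V) * e \<le> exp (- 2 * V) * (\<epsilon> * exp (2 * V))"
      by (intro mult_left_mono) (auto simp: e_def)
    also have "\<dots> = \<epsilon>" by (simp add: exp_minus)
    finally show "exp (- 2 * V) * e \<le> \<epsilon>" .
  qed
  obtain \<delta>0 where \<delta>0: "0 < \<delta>0" "\<And>s t. s \<in> {0..2} \<Longrightarrow> t \<in> {0..2} \<Longrightarrow> dist t s < \<delta>0 \<Longrightarrow> dist (\<psi> t) (\<psi> s) < e"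
    using compact_uniformly_continuous[OF continuous_on_subset[OF \<psi>(1)], of "{0..2}"] e(1)
    unfolding uniformly_continuous_on_def by (metis compact_Icc subset_UNIV)
  define \<delta> where "\<delta> = min \<delta>0 1"
  have \<delta>: "0 < \<delta>" "\<delta> \<le> 1" using \<delta>0(1) by (auto simp: \<delta>_def)
  have osc: "\<bar>\<psi> t - \<psi> s\<bar> \<le> e" if "\<bar>t - s\<bar> < \<delta>" for s t
  proof -
    have *: "\<bar>\<psi> t - \<psi> s\<bar> \<le> e" if "s \<le> t" "t < s + \<delta>" for s t
    proof -
      define k where "k = - \<lfloor>s\<rfloor>"
      have "0 \<le> s + of_int k" "s + of_int k < 1" unfolding k_def by (simp, linarith)
      then have "dist (\<psi> (t + of_int k)) (\<psi> (s + of_int k)) < e"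
        using that \<delta> by (intro \<delta>0(2)) (auto simp: dist_real_def \<delta>_def)
      then show ?thesis by (simp add: circ_add_of_int[OF c\<psi>] dist_real_def)
    qed
    show ?thesis
    proof (cases "s \<le> t")
      case True then show ?thesis using * that by auto
    next
      case False then show ?thesis using *[of t s] that by (auto simp: abs_minus_commute)
    qed
  qed
  obtain x y z Q where T: "x < y" "y < z" "z - x \<le> 2 * (y - x)" "0 < Q"
    "\<And>i. (F ^^ i) z - (F ^^ i) x < \<delta>"
    "disjoint_arcs {..<Q} (\<lambda>i. (F ^^ i) x) (\<lambda>i. (F ^^ i) y)"
    "disjoint_arcs {..<Q} (\<lambda>i. (F ^^ i) y) (\<lambda>i. (F ^^ i) z)"
    and cover: "\<And>t. \<exists>i<Q. \<exists>r. (F ^^ i) x + of_int r \<le> t \<and> t < (F ^^ i) z + of_int r"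
    and distortion: "\<And>i s t. i \<le> Q \<Longrightarrow> x \<le> s \<Longrightarrow> s \<le> z \<Longrightarrow> x \<le> t \<Longrightarrow> t \<le> z \<Longrightarrow>
       \<bar>log_deriv_iter i s - log_deriv_iter i t\<bar> \<le> 2 * V"
    using tower[OF \<delta>(1)] by blast
  define cnt where "cnt = (\<lambda>i. arc_count ((F ^^ i) x) ((F ^^ i) z))"
  define m where "m = (\<lambda>t. \<Sum>i<Q. cnt i t)"
  \<comment> \<open>Dividing by the multiplicity turns the double arcs into weights of sum 1.
    Covering gives \<open>m \<ge> 1\<close>, and the two disjoint rows give
    \<open>m \<le> 2\<close>, so a weight is at least 1 / 2 on its arc.\<close>
  define h where "h = (\<lambda>i t. cnt i t / m t)"
  have Fxz: "(F ^^ i) x \<le> (F ^^ i) z" for i using T(1,2) by simp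
  have cnt0: "0 \<le> cnt i t" for i t unfolding cnt_def using Fxz by (rule arc_count_nonneg)
  have cnt_circ: "circ (cnt i)" for i unfolding cnt_def using Fxz by (rule circ_arc_count)
  have m_circ: "circ m" unfolding m_def by (intro circ_sum cnt_circ)
  have m1: "1 \<le> m t" for t
  proof -
    obtain i r where "i < Q" "(F ^^ i) x + of_int r \<le> t" "t < (F ^^ i) z + of_int r" using cover by blast
    then have "1 \<le> cnt i t" unfolding cnt_def by (intro arc_count_ge_1)
    also have "\<dots> \<le> m t" unfolding m_def using \<open>i < Q\<close> cnt0 by (intro member_le_sum) auto
    finally show ?thesis .
  qed
  have m2: "m t \<le> 2" for t
  proof -
    have "m t = (\<Sum>i<Q. arc_count ((F ^^ i) x) ((F ^^ i) y) t) + (\<Sum>i<Q. arc_count ((F ^^ i) y) ((F ^^ i) z) t)"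
      unfolding m_def cnt_def sum.distrib[symmetric] by (simp add: arc_count_split)
    then show ?thesis using sum_arc_count_le_1[OF T(6), of t] sum_arc_count_le_1[OF T(7), of t] by linarith
  qed
  have h_circ: "circ (h i)" for i unfolding h_def by (intro circ_divide_ge_1 cnt_circ m_circ m1)
  have h_sum: "(\<Sum>i<Q. h i t) = 1" for t
  proof -
    have "(\<Sum>i<Q. cnt i t) = m t" by (simp add: m_def)
    then show ?thesis unfolding h_def sum_divide_distrib[symmetric] using m1[of t] by simp
  qed
  have h0: "0 \<le> h i t" for i t using cnt0[of i t] m1[of t] by (simp add: h_def)
  define L where "L = (\<lambda>g t. \<Sum>i<Q. transfer i (\<lambda>s. g s * h i s) t)"
  have L_circ: "circ (L g)" if "circ g" for g
    unfolding L_def using that by (intro circ_sum circ_transfer circ_mult h_circ)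
  have L_integral: "integral {0..1} (L g) = integral {0..1} g" if g: "circ g" for g
  proof -
    have "integral {0..1} (L g) = (\<Sum>i<Q. integral {0..1} (transfer i (\<lambda>s. g s * h i s)))"
      unfolding L_def using g
      by (intro Henstock_Kurzweil_Integration.integral_sum circ_integrable circ_transfer circ_mult h_circ) auto
    also have "\<dots> = (\<Sum>i<Q. integral {0..1} (\<lambda>s. g s * h i s))"
      using g by (intro sum.cong integral_transfer circ_mult h_circ) auto
    also have "\<dots> = integral {0..1} (\<lambda>s. \<Sum>i<Q. g s * h i s)"
      using g by (intro Henstock_Kurzweil_Integration.integral_sum[symmetric] circ_integrable circ_mult h_circ) auto
    finally show ?thesis by (simp add: sum_distrib_left[symmetric] h_sum)
  qed
  \<comment> \<open>exp (- 2V) for the distortion, 1 / 2 for the weights, and the length of the base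
    double arc for averaging.\<close>
  define E where "E = exp (- 2 * V) / (2 * (z - x))"
  have E: "0 < E" using T(1,2) by (simp add: E_def)
  have lengths: "(\<Sum>i<Q. (F ^^ i) z - (F ^^ i) x) \<le> 2"
    using sum_length_disjoint_arcs[OF T(6)] sum_length_disjoint_arcs[OF T(7)]
    by (simp add: sum_subtractf)
  \<comment> \<open>On each double arc \<open>g\<close> is at most its value at the orbit point of
    \<open>u\<close> plus \<open>e\<close>, so its integral is at most the sum of these values times
    the arc lengths, up to \<open>2 * e\<close>. By the mean value theorem and bounded distortion an
    arc length is at most (z - x) exp (2V) times the derivative of the iterate at \<open>u\<close>,
    which is the factor in \<open>transfer\<close>.\<close>
  have lower: "E * (integral {0..1} g - 2 * e) * arc_count x y t \<le> L g t"
    if g: "circ g" "\<And>t. 0 \<le> g t" "\<And>s t. \<bar>t - s\<bar> < \<delta> \<Longrightarrow> g t \<le> g s + e" for g t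
  proof -
    have L0: "0 \<le> L g t" for t
      unfolding L_def transfer_def using g(2) h0 by (intro sum_nonneg mult_nonneg_nonneg) auto
    have xy1: "y \<le> x + 1" using T(2) T(5)[of 0] \<delta> by simp
    show ?thesis
    proof (cases "0 < arc_count x y t")
      case False
      then have "arc_count x y t = 0" using arc_count_nonneg[of x y t] T(1) by simp
      then show ?thesis using L0 by simp
    next
      case True
      then obtain r :: int where r: "x + of_int r \<le> t" "t < y + of_int r" by (rule arc_count_pos)
      have one: "arc_count x y t = 1"
        using arc_count_ge_1[OF r] arc_count_le_1[OF xy1, of t] by simp
      define u where "u = t + of_int (- r)"
      have u: "x \<le> u" "u < y" "u \<le> z" using r T(2) by (auto simp: u_def)
      have "E * (integral {0..1} g - 2 * e) \<le> E * (\<Sum>i<Q. g ((F ^^ i) u) * ((F ^^ i) z - (F ^^ i) x))"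
      proof (intro mult_left_mono)
        have "integral {0..1} g \<le> integral {0..1} (\<lambda>t. g t * m t)"
        proof (intro integral_le circ_integrable circ_mult g(1) m_circ)
          fix t show "g t \<le> g t * m t" using g(2)[of t] m1[of t] mult_left_mono[of 1 "m t" "g t"] by simp
        qed
        also have "\<dots> = (\<Sum>i<Q. integral {0..1} (\<lambda>t. g t * cnt i t))"
          unfolding m_def sum_distrib_left
          by (intro Henstock_Kurzweil_Integration.integral_sum circ_integrable circ_mult g(1) cnt_circ) auto
        also have "\<dots> \<le> (\<Sum>i<Q. (g ((F ^^ i) u) + e) * ((F ^^ i) z - (F ^^ i) x))"
        proof (rule sum_mono)
          fix i
          have "integral {0..1} (\<lambda>t. g t * cnt i t) = integral {(F ^^ i) x..(F ^^ i) z} g"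
            unfolding cnt_def using Fxz T(5)[of i] \<delta> g(1) by (intro integral_arc_count) auto
          also have "\<dots> \<le> integral {(F ^^ i) x..(F ^^ i) z} (\<lambda>_. g ((F ^^ i) u) + e)"
          proof (intro integral_le circ_integrable g(1) circ_const)
            fix s assume s: "s \<in> {(F ^^ i) x..(F ^^ i) z}"
            have "(F ^^ i) x \<le> (F ^^ i) u" "(F ^^ i) u \<le> (F ^^ i) z" using u by auto
            moreover have "(F ^^ i) x \<le> s" "s \<le> (F ^^ i) z" using s by auto
            ultimately have "\<bar>s - (F ^^ i) u\<bar> < \<delta>" using T(5)[of i] by linarith
            then show "g s \<le> g ((F ^^ i) u) + e" by (rule g(3))
          qed
          also have "\<dots> = (g ((F ^^ i) u) + e) * ((F ^^ i) z - (F ^^ i) x)"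
            using Fxz by simp
          finally show "integral {0..1} (\<lambda>t. g t * cnt i t) \<le> (g ((F ^^ i) u) + e) * ((F ^^ i) z - (F ^^ i) x)" .
        qed
        also have "\<dots> = (\<Sum>i<Q. g ((F ^^ i) u) * ((F ^^ i) z - (F ^^ i) x)) + e * (\<Sum>i<Q. (F ^^ i) z - (F ^^ i) x)"
          by (simp only: distrib_right sum.distrib sum_distrib_left)
        also have "e * (\<Sum>i<Q. (F ^^ i) z - (F ^^ i) x) \<le> e * 2"
          using e(1) lengths by (intro mult_left_mono) auto
        finally show "integral {0..1} g - 2 * e \<le> (\<Sum>i<Q. g ((F ^^ i) u) * ((F ^^ i) z - (F ^^ i) x))" by simp
      qed (use E in simp)
      also have "\<dots> = (\<Sum>i<Q. g ((F ^^ i) u) * (E * ((F ^^ i) z - (F ^^ i) x)))"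
        by (simp add: sum_distrib_left mult_ac)
      also have "\<dots> \<le> (\<Sum>i<Q. transfer i (\<lambda>s. g s * h i s) u)"
      proof (rule sum_mono)
        fix i assume i: "i \<in> {..<Q}"
        have xz: "x < z" using T(1,2) by simp
        obtain v where v: "x < v" "v < z" "(F ^^ i) z - (F ^^ i) x = (z - x) * exp (log_deriv_iter i v)"
          using MVT2[OF xz, of "F ^^ i" "\<lambda>x. exp (log_deriv_iter i x)"] iter_has_exp_deriv by blast
        have "log_deriv_iter i v - 2 * V \<le> log_deriv_iter i u"
          using distortion[of i v u] i u v by (simp add: abs_le_iff)
        then have "exp (log_deriv_iter i v - 2 * V) \<le> exp (log_deriv_iter i u)" by simp
        moreover have "E * ((F ^^ i) z - (F ^^ i) x) = exp (log_deriv_iter i v - 2 * V) / 2"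
        proof -
          have cancel: "A / (2 * d) * (d * X) = X * A / 2" if "d \<noteq> 0" for A d X :: real
            using that by simp
          have "z - x \<noteq> 0" using xz by simp
          then have "E * ((F ^^ i) z - (F ^^ i) x) = exp (log_deriv_iter i v) * exp (- 2 * V) / 2"
            unfolding v(3) E_def by (rule cancel)
          also have "exp (log_deriv_iter i v) * exp (- 2 * V) = exp (log_deriv_iter i v - 2 * V)"
            by (simp flip: exp_add)
          finally show ?thesis .
        qed
        ultimately have EF: "E * ((F ^^ i) z - (F ^^ i) x) \<le> 1 / 2 * exp (log_deriv_iter i u)" by simp
        have "1 \<le> cnt i ((F ^^ i) u)"
          unfolding cnt_def arc_count_iter using u T(2) by (intro arc_count_ge_1[of _ 0]) auto
        then have "1 / m ((F ^^ i) u) \<le> h i ((F ^^ i) u)"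
          unfolding h_def using m1[of "(F ^^ i) u"] by (intro divide_right_mono) auto
        moreover have "1 / 2 \<le> 1 / m ((F ^^ i) u)"
          using m1[of "(F ^^ i) u"] m2[of "(F ^^ i) u"] by (intro divide_left_mono) auto
        ultimately have "1 / 2 * exp (log_deriv_iter i u) \<le> h i ((F ^^ i) u) * exp (log_deriv_iter i u)"
          by (intro mult_right_mono) auto
        with EF have "E * ((F ^^ i) z - (F ^^ i) x) \<le> h i ((F ^^ i) u) * exp (log_deriv_iter i u)" by linarith
        from mult_left_mono[OF this g(2)[of "(F ^^ i) u"]]
        show "g ((F ^^ i) u) * (E * ((F ^^ i) z - (F ^^ i) x)) \<le> transfer i (\<lambda>s. g s * h i s) u"
          by (simp add: transfer_def mult.assoc)
      qed
      also have "\<dots> = L g u" by (simp add: L_def)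
      also have "\<dots> = L g t" unfolding u_def by (rule circ_add_of_int[OF L_circ[OF g(1)]])
      finally show ?thesis by (simp add: one)
    qed
  qed
  define P M where "P = L (\<lambda>t. max (\<psi> t) 0)" and "M = L (\<lambda>t. max (- \<psi> t) 0)"
  define lam where "lam = E * (\<mu> / 2 - 2 * e)"
  have circs: "circ (\<lambda>t. max (\<psi> t) 0)" "circ (\<lambda>t. max (- \<psi> t) 0)"
    using c\<psi> by (auto intro!: circ_max circ_uminus circ_const)
  have osc': "max (\<psi> t) 0 \<le> max (\<psi> s) 0 + e" "max (- \<psi> t) 0 \<le> max (- \<psi> s) 0 + e" if "\<bar>t - s\<bar> < \<delta>" for s t
    using osc[OF that] e(1) by auto
  have P_ge: "lam * arc_count x y t \<le> P t" and M_ge: "lam * arc_count x y t \<le> M t" for t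
    using lower[OF circs(1) _ osc'(1), of t] lower[OF circs(2) _ osc'(2), of t]
    unfolding integral_split_positive[OF c\<psi> \<psi>(3)] P_def M_def lam_def \<mu>_def by auto
  have diff: "L \<psi> t = P t - M t" for t
  proof -
    have "\<psi> s = max (\<psi> s) 0 - max (- \<psi> s) 0" for s by simp
    then have "\<psi> s * h i s = max (\<psi> s) 0 * h i s - max (- \<psi> s) 0 * h i s" for s i
      by (metis left_diff_distrib)
    then show ?thesis
      unfolding P_def M_def L_def transfer_def sum_subtractf[symmetric] by (simp add: left_diff_distrib)
  qed
  have "norm1 (L \<psi>) \<le> integral {0..1} (\<lambda>t. P t + M t - 2 * lam * arc_count x y t)"
    unfolding norm1_def
  proof (intro integral_le circ_integrable circ_abs L_circ c\<psi> circ_diff circ_add circ_mult circ_const)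
    show "circ P" "circ M" unfolding P_def M_def by (intro L_circ circs)+
    show "circ (arc_count x y)" using T(1) by (intro circ_arc_count) simp
    \<comment> \<open>The absolute difference of two numbers is their sum minus twice their minimum,
      and both \<open>P\<close> and \<open>M\<close> are bounded below by the same multiple of
      \<open>arc_count x y\<close>.\<close>
    fix t show "\<bar>L \<psi> t\<bar> \<le> P t + M t - 2 * lam * arc_count x y t"
      unfolding diff using P_ge[of t] M_ge[of t] by (simp add: abs_le_iff)
  qed
  also have "\<dots> = \<mu> - 2 * lam * (y - x)"
  proof -
    have PM: "circ P" "circ M" unfolding P_def M_def by (intro L_circ circs)+
    have cc: "circ (arc_count x y)" using T(1) by (intro circ_arc_count) simp
    have "integral {0..1} (arc_count x y) = integral {0..1} (\<lambda>t. 1 * arc_count x y t)" by simp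
    also have "\<dots> = integral {x..y} (\<lambda>_. 1)"
      using T(1,2) T(5)[of 0] \<delta> by (intro integral_arc_count circ_const) auto
    also have "\<dots> = y - x" using T(1) by simp
    finally have ic: "integral {0..1} (arc_count x y) = y - x" .
    have "integral {0..1} (\<lambda>t. P t + M t - 2 * lam * arc_count x y t) =
        (integral {0..1} P + integral {0..1} M) - 2 * lam * integral {0..1} (arc_count x y)"
      using PM cc by (simp add: Henstock_Kurzweil_Integration.integral_diff
          Henstock_Kurzweil_Integration.integral_add circ_integrable circ_add circ_mult circ_const)
    moreover have "integral {0..1} P = \<mu> / 2" "integral {0..1} M = \<mu> / 2"
      unfolding P_def M_def L_integral[OF circs(1)] L_integral[OF circs(2)] \<mu>_def
      using integral_split_positive[OF c\<psi> \<psi>(3)] by auto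
    ultimately show ?thesis by (simp add: ic)
  qed
  \<comment> \<open>The cancelled mass \<open>2 * lam * (y - x)\<close> is at least
    \<open>lam * (z - x)\<close>, since the base arc fills at least half of [x, z]; there the length
    cancels against the one in \<open>E\<close>.\<close>
  also have "\<dots> \<le> (1 - exp (- 2 * V) / 4) * \<mu> + \<epsilon>"
  proof -
    have "0 \<le> lam" unfolding lam_def using E e(2) by simp
    then have "lam * (z - x) \<le> lam * (2 * (y - x))" using T(3) by (intro mult_left_mono) auto
    moreover have "lam * (z - x) = exp (- 2 * V) * \<mu> / 4 - exp (- 2 * V) * e"
      unfolding lam_def E_def using T(1,2) by (simp add: field_simps)
    ultimately show ?thesis using e(3) by (simp add: algebra_simps)
  qed
  finally have fin: "norm1 (L \<psi>) \<le> (1 - exp (- 2 * V) / 4) * \<mu> + \<epsilon>" .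
  show ?thesis
  proof (rule that[of Q "\<lambda>i s. \<psi> s * h i s"])
    show "circ (\<lambda>s. \<psi> s * h i s)" for i by (intro circ_mult c\<psi> h_circ)
    show "\<psi> = (\<lambda>t. \<Sum>i<Q. \<psi> t * h i t)" by (simp add: sum_distrib_left[symmetric] h_sum)
    show "norm1 (\<lambda>t. \<Sum>i<Q. transfer i (\<lambda>s. \<psi> s * h i s) t) \<le> (1 - exp (- 2 * V) / 4) * norm1 \<psi> + \<epsilon>"
      using fin unfolding L_def \<mu>_def .
  qed
qed

text \<open>The transport cost is constant in \<open>n\<close>; half of \<open>\<epsilon>\<close>
  absorbs it once \<open>n\<close> is large.\<close>

lemma birkhoff_contraction:
  assumes \<psi>: "continuous_on UNIV \<psi>" "\<And>x. \<psi> (x + 1) = \<psi> x" "integral {0..1} \<psi> = 0" and \<epsilon>: "0 < \<epsilon>"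
  obtains n0 where "\<And>n. n0 \<le> n \<Longrightarrow>
    norm1 (birkhoff n \<psi>) \<le> real n * ((1 - exp (- 2 * V) / 4) * norm1 \<psi> + \<epsilon>)"
proof -
  obtain Q f where f: "\<And>i. i < Q \<Longrightarrow> circ (f i)" "\<psi> = (\<lambda>t. \<Sum>i<Q. f i t)"
    "norm1 (\<lambda>t. \<Sum>i<Q. transfer i (f i) t) \<le> (1 - exp (- 2 * V) / 4) * norm1 \<psi> + \<epsilon> / 2"
    using tower_cancellation[OF \<psi> half_gt_zero[OF \<epsilon>]] by blast
  define C where "C = (\<Sum>i<Q. 2 * real i * norm1 (f i))"
  have "norm1 (birkhoff n \<psi>) \<le> real n * ((1 - exp (- 2 * V) / 4) * norm1 \<psi> + \<epsilon>)"
    if n: "nat \<lceil>2 * C / \<epsilon>\<rceil> \<le> n" for n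
  proof -
    have "norm1 (birkhoff n \<psi>) \<le> norm1 (birkhoff n (\<lambda>t. \<Sum>i<Q. transfer i (f i) t)) + C"
      unfolding C_def by (subst f(2)) (rule norm1_birkhoff_cohomologous[OF f(1)])
    also have "norm1 (birkhoff n (\<lambda>t. \<Sum>i<Q. transfer i (f i) t)) \<le> real n * norm1 (\<lambda>t. \<Sum>i<Q. transfer i (f i) t)"
      using f(1) by (intro norm1_birkhoff_le circ_sum circ_transfer) auto
    also have "\<dots> \<le> real n * ((1 - exp (- 2 * V) / 4) * norm1 \<psi> + \<epsilon> / 2)"
      using f(3) by (intro mult_left_mono) auto
    also have "C \<le> real n * (\<epsilon> / 2)"
    proof -
      have "2 * C / \<epsilon> \<le> real n" using n by linarith
      then show ?thesis using \<epsilon> by (simp add: field_simps)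
    qed
    finally show ?thesis by (simp add: algebra_simps)
  qed
  then show ?thesis using that by blast
qed

text \<open>Averages a satisfy \<open>a n \<le> (1 - c) * a m + \<epsilon>\<close> for all large
  \<open>n\<close>. The infimum of all averages is therefore at most 1 - c times itself, hence 0,
  and one small average forces all later ones to be small.\<close>

lemma birkhoff_average_vanishes:
  assumes \<psi>: "continuous_on UNIV \<psi>" "\<And>x. \<psi> (x + 1) = \<psi> x" "integral {0..1} \<psi> = 0" and \<epsilon>: "0 < \<epsilon>"
  obtains n0 where "\<And>n. n0 \<le> n \<Longrightarrow> norm1 (birkhoff n \<psi>) \<le> real n * \<epsilon>"
proof -
  define c where "c = exp (- 2 * V) / 4"
  have c: "0 < c" by (simp add: c_def)
  have c\<psi>: "circ \<psi>" using \<psi> by (intro circ_continuous)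
  define a where "a = (\<lambda>m. norm1 (birkhoff m \<psi>) / real m)"
  have a0: "0 \<le> a m" for m unfolding a_def by (intro divide_nonneg_nonneg norm1_nonneg circ_birkhoff c\<psi>) auto
  have step: "\<exists>n0. \<forall>n\<ge>n0. norm1 (birkhoff n \<psi>) \<le> real n * ((1 - c) * a m + \<epsilon>)"
    if m: "0 < m" and \<epsilon>: "0 < \<epsilon>" for m \<epsilon>
  proof -
    \<comment> \<open>Contract the average of length \<open>m\<close> instead of
      \<open>\<psi>\<close>: it is again continuous, periodic and of mean zero, and differs from
      \<open>\<psi>\<close> by coboundaries.\<close>
    define g where "g = (\<lambda>t. 1 / real m * birkhoff m \<psi> t)"
    have g_eq: "g = (\<lambda>t. \<Sum>i<m. transfer i (\<lambda>t. \<psi> t / real m) t)"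
      by (simp add: g_def birkhoff_def transfer_def sum_divide_distrib)
    have "continuous_on UNIV (birkhoff m \<psi>)"
      by (rule birkhoff_cont[OF \<psi>(1)])
    then have g1: "continuous_on UNIV g" unfolding g_def by (intro continuous_intros)
    have g2: "g (x + 1) = g x" for x
      using circ_birkhoff[OF c\<psi>, of m] by (simp add: g_def circ_def)
    have "integral {0..1} (birkhoff m \<psi>) = (\<Sum>i<m. integral {0..1} (transfer i \<psi>))"
      unfolding birkhoff_def[abs_def]
      by (intro Henstock_Kurzweil_Integration.integral_sum circ_integrable circ_transfer c\<psi>) auto
    then have g3: "integral {0..1} g = 0"
      using \<psi>(3) by (simp add: g_def integral_transfer[OF c\<psi>])
    have ng: "norm1 g = a m" unfolding g_def a_def norm1_scale by simp
    obtain n1 where n1: "\<And>n. n1 \<le> n \<Longrightarrow> norm1 (birkhoff n g) \<le> real n * ((1 - c) * a m + \<epsilon> / 2)"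
      using birkhoff_contraction[OF g1 g2 g3 half_gt_zero[OF \<epsilon>]] unfolding ng c_def by blast
    define C where "C = (\<Sum>i<m. 2 * real i * norm1 (\<lambda>t. \<psi> t / real m))"
    have "norm1 (birkhoff n \<psi>) \<le> real n * ((1 - c) * a m + \<epsilon>)"
      if n: "max n1 (nat \<lceil>2 * C / \<epsilon>\<rceil>) \<le> n" for n
    proof -
      have "circ (\<lambda>t. \<psi> t / real m)"
        using circ_mult[OF c\<psi> circ_const[of "1 / real m"]] by simp
      moreover have "(\<lambda>t. \<Sum>i<m. \<psi> t / real m) = \<psi>" using m by simp
      ultimately have "norm1 (birkhoff n \<psi>) \<le> norm1 (birkhoff n g) + C"
        using norm1_birkhoff_cohomologous[of m "\<lambda>_ t. \<psi> t / real m" n] unfolding g_eq C_def by metis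
      also have "norm1 (birkhoff n g) \<le> real n * ((1 - c) * a m + \<epsilon> / 2)" using n by (intro n1) simp
      also have "C \<le> real n * (\<epsilon> / 2)"
      proof -
        have "2 * C / \<epsilon> \<le> real n" using n by linarith
        then show ?thesis using \<epsilon> by (simp add: field_simps)
      qed
      finally show ?thesis by (simp add: algebra_simps)
    qed
    then show ?thesis by blast
  qed
  define I where "I = Inf (a ` {0<..})"
  have I_le: "I \<le> a m" if "0 < m" for m
    unfolding I_def using that a0 by (intro cInf_lower bdd_belowI[of _ 0]) auto
  have I_le2: "I \<le> (1 - c) * a m + \<epsilon>" if pos: "0 < m" "0 < \<epsilon>" for m \<epsilon>
  proof -
    obtain n0 where n0: "\<And>n. n0 \<le> n \<Longrightarrow> norm1 (birkhoff n \<psi>) \<le> real n * ((1 - c) * a m + \<epsilon>)"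
      using step[OF pos] by blast
    have "I \<le> a (Suc n0)" by (rule I_le) simp
    also have "\<dots> \<le> (1 - c) * a m + \<epsilon>"
      using n0[of "Suc n0"] unfolding a_def by (simp add: divide_le_eq mult.commute)
    finally show ?thesis .
  qed
  have I_le3: "I \<le> (1 - c) * a m" if "0 < m" for m
    by (rule field_le_epsilon) (rule I_le2[OF that])
  have I0: "I = 0"
  proof (rule antisym)
    show "0 \<le> I" unfolding I_def using a0 by (intro cInf_greatest) auto
    show "I \<le> 0"
    proof (cases "c < 1")
      case True
      have "I / (1 - c) \<le> I"
        unfolding I_def
        using I_le3 True by (intro cInf_greatest) (auto simp: I_def[symmetric] divide_le_eq mult.commute)
      then have "c * I \<le> 0" using True by (simp add: divide_le_eq algebra_simps)
      then show ?thesis using c by (simp add: mult_le_0_iff)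
    next
      case False
      then have "(1 - c) * a 1 \<le> 0" using a0[of 1] by (intro mult_nonpos_nonneg) auto
      then show ?thesis using I_le3[of 1] by simp
    qed
  qed
  have "\<exists>m>0. a m < \<epsilon> / 2"
  proof -
    have lt: "Inf (a ` {0<..}) < \<epsilon> / 2" using I0 \<epsilon> unfolding I_def by linarith
    have ne: "a ` {0<..} \<noteq> {}" by blast
    from cInf_lessD[OF ne lt] show ?thesis by auto
  qed
  then obtain m where m: "0 < m" "a m < \<epsilon> / 2" by blast
  obtain n0 where n0: "\<And>n. n0 \<le> n \<Longrightarrow> norm1 (birkhoff n \<psi>) \<le> real n * ((1 - c) * a m + \<epsilon> / 2)"
    using step[OF m(1) half_gt_zero[OF \<epsilon>]] by blast
  have "norm1 (birkhoff n \<psi>) \<le> real n * \<epsilon>" if "n0 \<le> n" for n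
  proof -
    have "(1 - c) * a m \<le> 1 * a m" using c a0[of m] by (intro mult_right_mono) auto
    then have "(1 - c) * a m + \<epsilon> / 2 \<le> \<epsilon>" using m(2) by linarith
    then have "real n * ((1 - c) * a m + \<epsilon> / 2) \<le> real n * \<epsilon>" by (intro mult_left_mono) auto
    with n0[OF that] show ?thesis by linarith
  qed
  then show ?thesis using that by blast
qed

end

section \<open>Absolutely continuous derivative\<close>

lemma variation_le_antiderivative:
  assumes b: "continuous_on UNIV b" "\<And>x. b (x + 1) = b x"
    and G: "\<And>x. (G has_real_derivative b x) (at x)"
  shows "variation_le G (norm1 b)"
proof -
  have abs_cont: "continuous_on UNIV (\<lambda>x. \<bar>b x\<bar>)" using b(1) by (intro continuous_intros)
  obtain T where T: "\<And>x. (T has_real_derivative \<bar>b x\<bar>) (at x)"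
    using antiderivative_exists[OF abs_cont] by blast
  have "\<bar>G v - G u\<bar> \<le> T v - T u" if "u \<le> v" for u v
  proof -
    have "T u - G u \<le> T v - G v"
      using that DERIV_diff[OF T G] by (intro DERIV_nonneg_imp_nondecreasing[of u v "\<lambda>x. T x - G x"]) (auto intro!: exI)
    moreover have "T u + G u \<le> T v + G v"
      using that DERIV_add[OF T G]
      by (intro DERIV_nonneg_imp_nondecreasing[of u v "\<lambda>x. T x + G x"]) (auto intro!: exI)
    ultimately show ?thesis by linarith
  qed
  moreover have "T (x + 1) = T x + norm1 b" for x
  proof -
    have "T (x + 1) = T x + (T 1 - T 0)" by (rule antiderivative_add_1[OF T]) (simp add: b(2))
    moreover have "((\<lambda>x. \<bar>b x\<bar>) has_integral T 1 - T 0) {0..1}"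
      using T by (intro fundamental_theorem_of_calculus)
        (auto simp: has_real_derivative_iff_has_vector_derivative[symmetric] intro: has_field_derivative_at_within)
    then have "norm1 b = T 1 - T 0" unfolding norm1_def by (rule integral_unique)
    ultimately show ?thesis by simp
  qed
  ultimately show ?thesis unfolding variation_le_def by blast
qed

text \<open>The rough remainder contributes at most \<open>\<epsilon> / 2\<close> per iterate. The
  smooth part sums to a function with derivative \<open>birkhoff n \<psi>\<close>, whose variation
  is controlled by the norm of that Birkhoff sum.\<close>

lemma (in denjoy_lift) variation_log_deriv_iter_small:
  assumes ac: "absolutely_continuous_on_interval (\<lambda>x. ln (D x)) 0 1" and \<epsilon>: "0 < \<epsilon>"
  obtains n0 where "\<And>n. n0 \<le> n \<Longrightarrow> variation_le (log_deriv_iter n) (real n * \<epsilon>)"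
proof -
  have cont: "continuous_on UNIV (\<lambda>x. ln (D x))"
    using cont_D D_pos by (intro continuous_on_ln) (auto simp: less_imp_neq[symmetric])
  have per: "ln (D (x + 1)) = ln (D x)" for x by (simp add: D_add_1)
  obtain g \<psi> where \<psi>: "continuous_on UNIV \<psi>" "\<And>x. \<psi> (x + 1) = \<psi> x"
    and g: "\<And>x. (g has_real_derivative \<psi> x) (at x)" "\<And>x. g (x + 1) = g x"
    and diff: "variation_le (\<lambda>x. ln (D x) - g x) (\<epsilon> / 2)"
    using ac_approx[OF per cont ac variation half_gt_zero[OF \<epsilon>]] by blast
  have "(\<psi> has_integral g 1 - g 0) {0..1}"
    using g(1) by (intro fundamental_theorem_of_calculus)
      (auto simp: has_real_derivative_iff_has_vector_derivative[symmetric] intro: has_field_derivative_at_within)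
  then have \<psi>0: "integral {0..1} \<psi> = 0" using g(2)[of 0] by (simp add: integral_unique)
  obtain n0 where n0: "\<And>n. n0 \<le> n \<Longrightarrow> norm1 (birkhoff n \<psi>) \<le> real n * (\<epsilon> / 2)"
    using birkhoff_average_vanishes[OF \<psi> \<psi>0 half_gt_zero[OF \<epsilon>]] by blast
  have "variation_le (log_deriv_iter n) (real n * \<epsilon>)" if n: "n0 \<le> n" for n
  proof -
    have 1: "variation_le (\<lambda>x. \<Sum>k<n. ln (D ((F ^^ k) x)) - g ((F ^^ k) x)) (\<Sum>k<n. \<epsilon> / 2)"
      by (intro variation_le_sum variation_le_compose[OF diff] mono_iter iter_add_1) simp
    have "continuous_on UNIV (birkhoff n \<psi>)"
      by (rule birkhoff_cont[OF \<psi>(1)])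
    moreover have "birkhoff n \<psi> (x + 1) = birkhoff n \<psi> x" for x
      using circ_birkhoff[OF circ_continuous[OF \<psi>], of n] by (simp add: circ_def)
    moreover have "((\<lambda>x. \<Sum>k<n. g ((F ^^ k) x)) has_real_derivative birkhoff n \<psi> x) (at x)" for x
      unfolding birkhoff_def transfer_def
      by (intro DERIV_sum DERIV_chain2[OF g(1) iter_has_exp_deriv])
    ultimately have "variation_le (\<lambda>x. \<Sum>k<n. g ((F ^^ k) x)) (norm1 (birkhoff n \<psi>))"
      by (rule variation_le_antiderivative)
    then have 2: "variation_le (\<lambda>x. \<Sum>k<n. g ((F ^^ k) x)) (real n * (\<epsilon> / 2))"
      using n0[OF n] by (rule variation_le_mono)
    have "log_deriv_iter n = (\<lambda>x. (\<Sum>k<n. ln (D ((F ^^ k) x)) - g ((F ^^ k) x)) + (\<Sum>k<n. g ((F ^^ k) x)))"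
      by (simp add: log_deriv_iter_def[abs_def] sum_subtractf)
    then show ?thesis
      using variation_le_add[OF 1 2] by (simp add: field_simps)
  qed
  then show ?thesis using that by blast
qed

lemma absolutely_continuous_ln:
  assumes ac: "absolutely_continuous_on_interval g a b"
    and c: "0 < c" "\<And>x. a \<le> x \<Longrightarrow> x \<le> b \<Longrightarrow> c \<le> g x"
  shows "absolutely_continuous_on_interval (\<lambda>x. ln (g x)) a b"
  unfolding absolutely_continuous_on_interval_def
proof (intro allI impI)
  fix \<epsilon> :: real assume \<epsilon>: "0 < \<epsilon>"
  have lip: "\<bar>ln s - ln t\<bar> \<le> \<bar>s - t\<bar> / c" if "c \<le> s" "c \<le> t" for s t
  proof -
    have *: "ln s - ln t \<le> \<bar>s - t\<bar> / c" if st: "c \<le> s" "c \<le> t" for s t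
    proof -
      have "ln s - ln t \<le> (s - t) / t" using st c(1) by (intro ln_diff_le) auto
      also have "\<dots> \<le> \<bar>s - t\<bar> / t" using st c(1) by (intro divide_right_mono) auto
      also have "\<dots> \<le> \<bar>s - t\<bar> / c" using st c(1) by (intro divide_left_mono) auto
      finally show ?thesis .
    qed
    show ?thesis using *[OF that] *[OF that(2,1)] by (simp add: abs_le_iff abs_minus_commute)
  qed
  obtain \<delta> where \<delta>: "0 < \<delta>" "\<forall>(n::nat) u v.
        (\<forall>i<n. a \<le> u i \<and> u i \<le> v i \<and> v i \<le> b) \<and>
        disjoint_family_on (\<lambda>i. {u i<..<v i}) {..<n} \<and>
        (\<Sum>i<n. v i - u i) < \<delta>
        \<longrightarrow> (\<Sum>i<n. \<bar>g (v i) - g (u i)\<bar>) < c * \<epsilon>"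
    using ac \<epsilon> c(1) unfolding absolutely_continuous_on_interval_def
    by (elim allE[of _ "c * \<epsilon>"]) auto
  show "\<exists>\<delta>>0. \<forall>(n::nat) u v.
        (\<forall>i<n. a \<le> u i \<and> u i \<le> v i \<and> v i \<le> b) \<and>
        disjoint_family_on (\<lambda>i. {u i<..<v i}) {..<n} \<and>
        (\<Sum>i<n. v i - u i) < \<delta>
        \<longrightarrow> (\<Sum>i<n. \<bar>ln (g (v i)) - ln (g (u i))\<bar>) < \<epsilon>"
  proof (intro exI[of _ \<delta>] conjI allI impI, rule \<delta>(1))
    fix n :: nat and u v
    assume A: "(\<forall>i<n. a \<le> u i \<and> u i \<le> v i \<and> v i \<le> b) \<and>
        disjoint_family_on (\<lambda>i. {u i<..<v i}) {..<n} \<and> (\<Sum>i<n. v i - u i) < \<delta>"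
    have "(\<Sum>i<n. \<bar>ln (g (v i)) - ln (g (u i))\<bar>) \<le> (\<Sum>i<n. \<bar>g (v i) - g (u i)\<bar> / c)"
    proof (intro sum_mono lip c(2))
      fix i assume "i \<in> {..<n}"
      then have "a \<le> u i" "u i \<le> v i" "v i \<le> b" using A by auto
      then show "a \<le> u i" "u i \<le> b" "a \<le> v i" "v i \<le> b" by auto
    qed
    also have "\<dots> < \<epsilon>"
      using A \<delta>(2) c(1) unfolding sum_divide_distrib[symmetric] by (simp add: divide_less_eq mult.commute)
    finally show "(\<Sum>i<n. \<bar>ln (g (v i)) - ln (g (u i))\<bar>) < \<epsilon>" .
  qed
qed

theorem asymptotic_distortion_absolutely_continuous:
  assumes f: "circle_C1bv_diffeo f" "irrational_rotation_number f"
    "circle_absolutely_continuous (circle_deriv f)"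
  shows "asymptotic_distortion f = 0"
proof -
  obtain F D where "diffeo_lift F D" and lift: "circle_lift F f"
    using f(1) circle_C1_diffeo_lift unfolding circle_C1bv_diffeo_def by blast
  interpret diffeo_lift F D by fact
  have irr: "translation_number F \<notin> \<rat>" using f(2) rotation_number_lift[OF lift] by simp
  have deriv: "(\<lambda>x. circle_deriv f (circle_proj x)) = D" using circle_deriv_lift[OF lift] by auto
  have "total_variation (\<lambda>x. ln (D x)) 0 1 < \<infinity>"
    using f(1) circle_deriv_lift[OF lift] by (simp add: circle_C1bv_diffeo_def circle_variation_def)
  moreover have "0 \<le> total_variation (\<lambda>x. ln (D x)) 0 1" by (rule total_variation_nonneg) simp
  ultimately obtain V where V: "total_variation (\<lambda>x. ln (D x)) 0 1 = ereal V"
    by (cases "total_variation (\<lambda>x. ln (D x)) 0 1") auto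
  have "variation_le (\<lambda>x. ln (D x)) V"
    by (rule total_variation_le_imp_variation_le) (simp_all add: D_add_1 V)
  then interpret denjoy_lift F D V using irr by unfold_locales
  have "\<exists>x\<in>{0..1}. \<forall>y\<in>{0..1}. D x \<le> D y"
    by (intro continuous_attains_inf continuous_on_subset[OF cont_D]) auto
  then obtain x where "\<forall>y\<in>{0..1}. D x \<le> D y" by blast
  moreover have "absolutely_continuous_on_interval D 0 1"
    using f(3) by (simp add: circle_absolutely_continuous_def deriv)
  ultimately have ac: "absolutely_continuous_on_interval (\<lambda>x. ln (D x)) 0 1"
    using D_pos by (intro absolutely_continuous_ln[of _ _ _ "D x"]) auto
  define a where "a = (\<lambda>n. real_of_ereal (circle_variation (\<lambda>p. ln (circle_deriv (f ^^ n) p))) / real n)"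
  have a_eq: "a n = real_of_ereal (total_variation (log_deriv_iter n) 0 1) / real n" for n
    unfolding a_def circle_variation_ln_deriv[OF lift] log_deriv_iter_def[abs_def] ..
  have "a \<longlonglongrightarrow> 0"
  proof (rule LIMSEQ_I)
    fix r :: real assume r: "0 < r"
    obtain n0 where n0: "\<And>n. n0 \<le> n \<Longrightarrow> variation_le (log_deriv_iter n) (real n * (r / 2))"
      using variation_log_deriv_iter_small[OF ac half_gt_zero[OF r]] by blast
    show "\<exists>no. \<forall>n\<ge>no. norm (a n - 0) < r"
    proof (intro exI[of _ "Suc n0"] allI impI)
      fix n assume n: "Suc n0 \<le> n"
      have le: "total_variation (log_deriv_iter n) 0 1 \<le> ereal (real n * (r / 2))"
        using variation_le_imp_total_variation_le[OF n0[of n], of 0] n by simp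
      moreover have "0 \<le> total_variation (log_deriv_iter n) 0 1" by (rule total_variation_nonneg) simp
      ultimately have "0 \<le> real_of_ereal (total_variation (log_deriv_iter n) 0 1)"
        "real_of_ereal (total_variation (log_deriv_iter n) 0 1) \<le> real n * (r / 2)"
        by (cases "total_variation (log_deriv_iter n) 0 1"; simp)+
      then have "0 \<le> a n" "a n \<le> r / 2"
        unfolding a_eq using n by (simp_all add: divide_le_eq mult.commute)
      then show "norm (a n - 0) < r" using r by simp
    qed
  qed
  then show ?thesis unfolding asymptotic_distortion_def a_def by (rule limI)
qed

section \<open>The Cantor function\<close>

text \<open>All approximants are 0 to the left of the unit interval and 1 to its right, so adding
  two rescaled copies replaces the usual case distinction on thirds.\<close>

fun cantor_approx :: "nat \<Rightarrow> real \<Rightarrow> real" where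
  "cantor_approx 0 x = max 0 (min 1 x)"
| "cantor_approx (Suc n) x = (cantor_approx n (3 * x) + cantor_approx n (3 * x - 2)) / 2"

lemma cantor_approx_le_0: "x \<le> 0 \<Longrightarrow> cantor_approx n x = 0"
  by (induction n arbitrary: x) auto

lemma cantor_approx_ge_1: "1 \<le> x \<Longrightarrow> cantor_approx n x = 1"
  by (induction n arbitrary: x) auto

lemma cantor_approx_mono: "x \<le> y \<Longrightarrow> cantor_approx n x \<le> cantor_approx n y"
proof (induction n arbitrary: x y)
  case (Suc n)
  then show ?case unfolding cantor_approx.simps by (intro divide_right_mono add_mono Suc.IH) auto
qed auto

lemma cantor_approx_range: "0 \<le> cantor_approx n x" "cantor_approx n x \<le> 1"
proof -
  have "0 \<le> cantor_approx n x \<and> cantor_approx n x \<le> 1"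
  proof (induction n arbitrary: x)
    case (Suc n)
    have "0 \<le> cantor_approx n (3 * x)" "cantor_approx n (3 * x) \<le> 1"
      "0 \<le> cantor_approx n (3 * x - 2)" "cantor_approx n (3 * x - 2) \<le> 1" using Suc by blast+
    then show ?case by simp
  qed auto
  then show "0 \<le> cantor_approx n x" "cantor_approx n x \<le> 1" by auto
qed

lemma cantor_approx_cont: "continuous_on UNIV (cantor_approx n)"
proof (induction n)
  case 0
  have "continuous_on UNIV (\<lambda>x::real. max 0 (min 1 x))" by (intro continuous_intros)
  then show ?case by simp
next
  case (Suc n)
  have "continuous_on UNIV (\<lambda>x. (cantor_approx n (3 * x) + cantor_approx n (3 * x - 2)) / 2)"
    by (intro continuous_intros continuous_on_compose2[OF Suc]) auto
  then show ?case by simp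
qed

text \<open>At each point at least one of the two rescaled copies is constant in \<open>n\<close>,
  so the difference halves at every step.\<close>

lemma cantor_approx_step: "\<bar>cantor_approx (Suc n) x - cantor_approx n x\<bar> \<le> (1 / 2) ^ n"
proof (induction n arbitrary: x)
  case 0
  then show ?case
    using cantor_approx_range[of 0 x] cantor_approx_range[of "Suc 0" x] by (simp only: power_0 abs_le_iff) linarith
next
  case (Suc n)
  have split: "cantor_approx (Suc (Suc n)) x - cantor_approx (Suc n) x =
     ((cantor_approx (Suc n) (3 * x) - cantor_approx n (3 * x)) +
      (cantor_approx (Suc n) (3 * x - 2) - cantor_approx n (3 * x - 2))) / 2"
    unfolding cantor_approx.simps(2)[of "Suc n" x] cantor_approx.simps(2)[of n x] by (simp add: field_simps)
  show ?case
  proof (cases "3 * x \<le> 2")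
    case True
    then have "cantor_approx (Suc n) (3 * x - 2) = 0" "cantor_approx n (3 * x - 2) = 0"
      by (intro cantor_approx_le_0; simp)+
    then show ?thesis unfolding split using Suc[of "3 * x"] by simp
  next
    case False
    then have "cantor_approx (Suc n) (3 * x) = 1" "cantor_approx n (3 * x) = 1"
      by (intro cantor_approx_ge_1; simp)+
    then show ?thesis unfolding split using Suc[of "3 * x - 2"] by simp
  qed
qed

definition cantor :: "real \<Rightarrow> real" where
  "cantor x = lim (\<lambda>n. cantor_approx n x)"

lemma cantor_uniform_limit: "uniform_limit UNIV cantor_approx cantor sequentially"
proof -
  have "uniform_limit UNIV (\<lambda>n x. \<Sum>i<n. cantor_approx (Suc i) x - cantor_approx i x)
      (\<lambda>x. \<Sum>i. cantor_approx (Suc i) x - cantor_approx i x) sequentially"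
    by (rule Weierstrass_m_test[where M = "\<lambda>n. (1 / 2) ^ n"])
       (use cantor_approx_step in \<open>auto simp del: cantor_approx.simps\<close>)
  then have "uniform_limit UNIV (\<lambda>n x. cantor_approx n x - cantor_approx 0 x)
      (\<lambda>x. \<Sum>i. cantor_approx (Suc i) x - cantor_approx i x) sequentially"
  proof -
    have "(\<Sum>i<n. cantor_approx (Suc i) x - cantor_approx i x) = cantor_approx n x - cantor_approx 0 x" for n x
      by (rule sum_lessThan_telescope)
    then show "uniform_limit UNIV (\<lambda>n x. \<Sum>i<n. cantor_approx (Suc i) x - cantor_approx i x)
      (\<lambda>x. \<Sum>i. cantor_approx (Suc i) x - cantor_approx i x) sequentially \<Longrightarrow> ?thesis"
      by (simp only:)
  qed
  then have "uniform_limit UNIV (\<lambda>n x. (cantor_approx n x - cantor_approx 0 x) + cantor_approx 0 x)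
      (\<lambda>x. (\<Sum>i. cantor_approx (Suc i) x - cantor_approx i x) + cantor_approx 0 x) sequentially"
    by (intro uniform_limit_add uniform_limit_const)
  then have lim: "uniform_limit UNIV cantor_approx
      (\<lambda>x. (\<Sum>i. cantor_approx (Suc i) x - cantor_approx i x) + cantor_approx 0 x) sequentially"
    by (simp only: diff_add_cancel)
  have "cantor = (\<lambda>x. (\<Sum>i. cantor_approx (Suc i) x - cantor_approx i x) + cantor_approx 0 x)"
    unfolding cantor_def by (intro ext limI tendsto_uniform_limitI[OF lim]) simp
  with lim show ?thesis by simp
qed

lemma cantor_lim: "(\<lambda>n. cantor_approx n x) \<longlonglongrightarrow> cantor x"
  by (rule tendsto_uniform_limitI[OF cantor_uniform_limit]) simp

lemma cantor_cont: "continuous_on UNIV cantor"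
  by (rule uniform_limit_theorem[OF _ cantor_uniform_limit]) (auto simp: cantor_approx_cont)

lemma cantor_le_0: "x \<le> 0 \<Longrightarrow> cantor x = 0"
  using cantor_lim[of x] by (simp add: cantor_approx_le_0 LIMSEQ_const_iff)

lemma cantor_ge_1: "1 \<le> x \<Longrightarrow> cantor x = 1"
  using cantor_lim[of x] by (simp add: cantor_approx_ge_1 LIMSEQ_const_iff)

lemma cantor_mono: "x \<le> y \<Longrightarrow> cantor x \<le> cantor y"
  by (rule LIMSEQ_le[OF cantor_lim cantor_lim]) (auto intro: cantor_approx_mono)

lemma cantor_self_similar: "cantor x = (cantor (3 * x) + cantor (3 * x - 2)) / 2"
proof -
  have "(\<lambda>n. cantor_approx (Suc n) x) \<longlonglongrightarrow> (cantor (3 * x) + cantor (3 * x - 2)) / 2"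
    unfolding cantor_approx.simps by (intro tendsto_intros cantor_lim) simp
  then show ?thesis using LIMSEQ_Suc[OF cantor_lim[of x]] by (rule LIMSEQ_unique[rotated])
qed

text \<open>The points of \<open>A\<close> are the left endpoints, scaled by \<open>3 ^ m\<close>, of the level-\<open>m\<close> intervals of
  the Cantor set.\<close>

lemma cantor_growth:
  obtains A :: "real set" where "finite A" "card A \<le> 2 ^ m"
    "\<And>a b. a < b \<Longrightarrow> cantor a \<noteq> cantor b \<Longrightarrow> \<exists>j\<in>A. a < (j + 1) / 3 ^ m \<and> j / 3 ^ m < b"
proof -
  have "\<exists>A :: real set. finite A \<and> card A \<le> 2 ^ m \<and>
    (\<forall>a b. a < b \<longrightarrow> cantor a \<noteq> cantor b \<longrightarrow> (\<exists>j\<in>A. a < (j + 1) / 3 ^ m \<and> j / 3 ^ m < b))"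
  proof (induction m)
    case 0
    have "a < 1 \<and> 0 < b" if "a < b" "cantor a \<noteq> cantor b" for a b
      using that cantor_le_0[of a] cantor_le_0[of b] cantor_ge_1[of a] cantor_ge_1[of b] by linarith
    then show ?case by (intro exI[of _ "{0}"]) auto
  next
    case (Suc m)
    then obtain A :: "real set" where A: "finite A" "card A \<le> 2 ^ m"
      "\<And>a b. a < b \<Longrightarrow> cantor a \<noteq> cantor b \<Longrightarrow> \<exists>j\<in>A. a < (j + 1) / 3 ^ m \<and> j / 3 ^ m < b" by blast
    define A' where "A' = A \<union> (\<lambda>j. j + 2 * 3 ^ m) ` A"
    have "card A' \<le> card A + card ((\<lambda>j. j + 2 * 3 ^ m) ` A)" unfolding A'_def by (rule card_Un_le)
    also have "\<dots> \<le> 2 ^ Suc m" using A(1,2) card_image_le[OF A(1), of "\<lambda>j. j + 2 * 3 ^ m"] by simp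
    finally have "card A' \<le> 2 ^ Suc m" .
    moreover have "\<exists>j\<in>A'. a < (j + 1) / 3 ^ Suc m \<and> j / 3 ^ Suc m < b"
      if ab: "a < b" "cantor a \<noteq> cantor b" for a b
    proof (cases "cantor (3 * a) \<noteq> cantor (3 * b)")
      case True
      then obtain j where j: "j \<in> A" "3 * a < (j + 1) / 3 ^ m" "j / 3 ^ m < 3 * b"
        using A(3)[of "3 * a" "3 * b"] ab by auto
      then have "a < (j + 1) / 3 ^ Suc m" "j / 3 ^ Suc m < b" by (simp_all add: field_simps)
      then show ?thesis using j(1) by (auto simp: A'_def)
    next
      case False
      then have "cantor (3 * a - 2) \<noteq> cantor (3 * b - 2)"
        using ab(2) cantor_self_similar[of a] cantor_self_similar[of b] by auto
      then obtain j where j: "j \<in> A" "3 * a - 2 < (j + 1) / 3 ^ m" "j / 3 ^ m < 3 * b - 2"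
        using A(3)[of "3 * a - 2" "3 * b - 2"] ab by auto
      then have "a < (j + 2 * 3 ^ m + 1) / 3 ^ Suc m" "(j + 2 * 3 ^ m) / 3 ^ Suc m < b"
        by (simp_all add: field_simps)
      then show ?thesis using j(1) by (auto simp: A'_def)
    qed
    ultimately show ?case using A(1) by (intro exI[of _ A']) (auto simp: A'_def)
  qed
  then show ?thesis using that by blast
qed

section \<open>The Cantor function as a monotone map of degree one\<close>

definition cantor_lift :: "real \<Rightarrow> real" where
  "cantor_lift x = of_int \<lfloor>x\<rfloor> + cantor (frac x)"

lemma cantor_lift_eq: "of_int p \<le> x \<Longrightarrow> x \<le> of_int p + 1 \<Longrightarrow> cantor_lift x = of_int p + cantor (x - of_int p)"
proof (cases "x = of_int p + 1")
  case True
  then show ?thesis by (simp add: cantor_lift_def frac_def cantor_le_0 cantor_ge_1)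
next
  case False
  assume "of_int p \<le> x" "x \<le> of_int p + 1"
  with False have "\<lfloor>x\<rfloor> = p" by (intro floor_unique) auto
  then show ?thesis by (simp add: cantor_lift_def frac_def)
qed

lemma cantor_lift_add_1: "cantor_lift (x + 1) = cantor_lift x + 1"
  by (simp add: cantor_lift_def frac_1_eq)

lemma cantor_lift_mono: "mono cantor_lift"
proof (rule monoI)
  fix x y :: real assume xy: "x \<le> y"
  show "cantor_lift x \<le> cantor_lift y"
  proof (cases "\<lfloor>x\<rfloor> = \<lfloor>y\<rfloor>")
    case True
    then show ?thesis using xy by (simp add: cantor_lift_def frac_def cantor_mono)
  next
    case False
    then have "\<lfloor>x\<rfloor> + 1 \<le> \<lfloor>y\<rfloor>" using floor_mono[OF xy] by linarith
    then have "of_int \<lfloor>x\<rfloor> + (1::real) \<le> of_int \<lfloor>y\<rfloor>" by linarith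
    moreover have "cantor (frac x) \<le> 1" "0 \<le> cantor (frac y)"
      using cantor_mono[of "frac x" 1] cantor_mono[of 0 "frac y"] frac_lt_1[of x]
      by (auto simp: cantor_le_0 cantor_ge_1 less_imp_le)
    ultimately show ?thesis by (simp add: cantor_lift_def)
  qed
qed

lemma cantor_lift_minus_id_cont: "continuous_on UNIV (\<lambda>x. cantor_lift x - x)"
proof -
  have "continuous_on UNIV (\<lambda>x. (\<lambda>y. cantor y - y) (frac x))"
    by (rule continuous_on_frac)
       (auto intro!: continuous_intros continuous_on_subset[OF cantor_cont] simp: cantor_le_0 cantor_ge_1)
  moreover have "cantor_lift x - x = cantor (frac x) - frac x" for x
    by (simp add: cantor_lift_def frac_def)
  ultimately show ?thesis by simp
qed

text \<open>The interval may straddle the integer \<open>p + 1\<close>; growth then occurs on one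
  side of it, which \<open>e\<close> records.\<close>

lemma cantor_lift_growth:
  assumes "of_int p \<le> a" "a < b" "b \<le> of_int p + 2" "cantor_lift a \<noteq> cantor_lift b"
    and A: "\<And>a b. a < b \<Longrightarrow> cantor a \<noteq> cantor b \<Longrightarrow> \<exists>j\<in>A. a < (j + 1) / N \<and> j / N < b"
  shows "\<exists>j\<in>A. \<exists>e\<in>{0, 1}. a < of_int p + e + j / N + 1 / N \<and> of_int p + e + j / N < b"
proof -
  have grow: "\<exists>j\<in>A. a < of_int q + j / N + 1 / N \<and> of_int q + j / N < b"
    if ab: "of_int q \<le> a" "a < b" "b \<le> of_int q + 1" "cantor_lift a \<noteq> cantor_lift b" for q a b
  proof -
    have "cantor (a - of_int q) \<noteq> cantor (b - of_int q)"
      using ab by (simp add: cantor_lift_eq[of q])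
    then obtain j where "j \<in> A" "a - of_int q < (j + 1) / N" "j / N < b - of_int q"
      using A[of "a - of_int q" "b - of_int q"] ab(2) by auto
    then show ?thesis by (intro bexI[of _ j]) (auto simp: add_divide_distrib)
  qed
  define c where "c = max a (min b (of_int p + 1))"
  consider "cantor_lift a \<noteq> cantor_lift (min b (of_int p + 1))" "a < of_int p + 1"
    | "cantor_lift (max a (of_int p + 1)) \<noteq> cantor_lift b" "of_int p + 1 < b"
    using assms(2,4) by (cases "b \<le> of_int p + 1"; cases "of_int p + 1 \<le> a") (force simp: min_def max_def)+
  then show ?thesis
  proof cases
    case 1
    then obtain j where "j \<in> A" "a < of_int p + j / N + 1 / N" "of_int p + j / N < min b (of_int p + 1)"
      using grow[of p a "min b (of_int p + 1)"] assms by auto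
    then show ?thesis by (intro bexI[of _ j] bexI[of _ 0]) auto
  next
    case 2
    then obtain j where "j \<in> A" "max a (of_int p + 1) < of_int (p + 1) + j / N + 1 / N" "of_int (p + 1) + j / N < b"
      using grow[of "p + 1" "max a (of_int p + 1)" b] assms by auto
    then show ?thesis by (intro bexI[of _ j] bexI[of _ 1]) auto
  qed
qed

text \<open>The left margin 1 is there because a cell is indexed by its left end: a cell containing
  \<open>y\<close> in its interior has index above \<open>y - 1\<close>.\<close>

lemma card_nat_in_interval: "card {k::nat. y - 1 < real k \<and> real k < y + real L} \<le> L + 1"
  "finite {k::nat. y - 1 < real k \<and> real k < y + real L}"
proof -
  have sub: "int ` {k::nat. y - 1 < real k \<and> real k < y + real L} \<subseteq> {\<lfloor>y\<rfloor>..\<lfloor>y\<rfloor> + int L}"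
  proof
    fix z assume "z \<in> int ` {k::nat. y - 1 < real k \<and> real k < y + real L}"
    then have "y - 1 < of_int z" "of_int z < y + real L" by auto
    then show "z \<in> {\<lfloor>y\<rfloor>..\<lfloor>y\<rfloor> + int L}" by (simp, linarith)
  qed
  then have "card (int ` {k::nat. y - 1 < real k \<and> real k < y + real L}) \<le> card {\<lfloor>y\<rfloor>..\<lfloor>y\<rfloor> + int L}"
    by (intro card_mono) auto
  then show "card {k::nat. y - 1 < real k \<and> real k < y + real L} \<le> L + 1"
    by (simp add: card_image)
  show "finite {k::nat. y - 1 < real k \<and> real k < y + real L}"
    using finite_subset[OF sub] by (simp add: finite_image_iff)
qed

context diffeo_lift
begin

lemma iter_growth:
  "\<exists>B>0. \<forall>x y. x \<le> y \<longrightarrow> (F ^^ i) y - (F ^^ i) x \<le> B * (y - x) \<and>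
    y - x \<le> B * ((F ^^ i) y - (F ^^ i) x)"
proof -
  have "circ (log_deriv_iter i)"
    by (intro circ_continuous log_deriv_iter_cont log_deriv_iter_add_1)
  then obtain C where C: "\<And>x. \<bar>log_deriv_iter i x\<bar> \<le> C" unfolding circ_def by blast
  have bounds: "(F ^^ i) y - (F ^^ i) x \<le> exp C * (y - x) \<and> y - x \<le> exp C * ((F ^^ i) y - (F ^^ i) x)"
    if "x \<le> y" for x y
  proof (cases "x = y")
    case False
    with that have "x < y" by simp
    then obtain u where u: "(F ^^ i) y - (F ^^ i) x = (y - x) * exp (log_deriv_iter i u)"
      using MVT2[of x y "F ^^ i" "\<lambda>x. exp (log_deriv_iter i x)"] iter_has_exp_deriv by blast
    have "log_deriv_iter i u \<le> C" "- C \<le> log_deriv_iter i u" using C[of u] by (auto simp: abs_le_iff)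
    then have e: "exp (log_deriv_iter i u) \<le> exp C" "exp (- C) \<le> exp (log_deriv_iter i u)" by auto
    have "(y - x) * 1 \<le> (y - x) * (exp C * exp (log_deriv_iter i u))"
      using \<open>x < y\<close> \<open>- C \<le> log_deriv_iter i u\<close> by (intro mult_left_mono) (auto simp flip: exp_add)
    then show ?thesis
      unfolding u using \<open>x < y\<close> mult_left_mono[OF e(1), of "y - x"] by (simp add: mult_ac)
  qed simp
  then show ?thesis by (intro exI[of _ "exp C"]) simp
qed

definition growing_cells :: "nat \<Rightarrow> nat \<Rightarrow> nat set" where
  "growing_cells i m = {k. k < 3 ^ m \<and>
     cantor_lift ((F ^^ i) (real k / 3 ^ m)) \<noteq> cantor_lift ((F ^^ i) (real (Suc k) / 3 ^ m))}"

text \<open>A level-\<open>m\<close> Cantor interval pulls back under the iterate to an interval at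
  most \<open>B\<close> cells long, which accounts for at most \<open>L + 1\<close> cells. There are
  at most 2^m Cantor intervals per period, and the image of the unit interval meets at most two
  periods of the integer grid up to its endpoint.\<close>

lemma card_growing_cells: "\<exists>K. \<forall>m. card (growing_cells i m) \<le> K * 2 ^ m"
proof -
  obtain B where B: "0 < B" "\<And>x y. x \<le> y \<Longrightarrow> y - x \<le> B * ((F ^^ i) y - (F ^^ i) x)"
    using iter_growth[of i] by blast
  define L where "L = nat \<lceil>B\<rceil>"
  have L: "B \<le> real L" unfolding L_def by linarith
  have "card (growing_cells i m) \<le> (2 * (L + 1)) * 2 ^ m" for m
  proof -
    define N where "N = (3::real) ^ m"
    have N: "0 < N" by (simp add: N_def)
    obtain A where A: "finite A" "card A \<le> 2 ^ m"
      "\<And>a b. a < b \<Longrightarrow> cantor a \<noteq> cantor b \<Longrightarrow> \<exists>j\<in>A. a < (j + 1) / N \<and> j / N < b"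
      using cantor_growth[of m] unfolding N_def by blast
    define p where "p = \<lfloor>(F ^^ i) 0\<rfloor>"
    have surj: "\<exists>x. (F ^^ i) x = y" for y
      by (induction i arbitrary: y) (auto, metis F_surj)
    define X where "X = (\<lambda>y. SOME x. (F ^^ i) x = y)"
    have X: "(F ^^ i) (X y) = y" for y unfolding X_def using surj by (rule someI_ex)
    define S where "S = (\<lambda>j e. {k::nat. N * X (of_int p + e + j / N) - 1 < real k \<and> real k < N * X (of_int p + e + j / N) + real L})"
    have sub: "growing_cells i m \<subseteq> (\<Union>(j, e)\<in>A \<times> {0, 1}. S j e)"
    proof
      fix k assume "k \<in> growing_cells i m"
      then have k: "k < 3 ^ m" "cantor_lift ((F ^^ i) (real k / N)) \<noteq> cantor_lift ((F ^^ i) (real (Suc k) / N))"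
        by (auto simp: growing_cells_def N_def)
      have "real (Suc k) \<le> N"
        unfolding N_def using k(1) by (metis Suc_leI of_nat_le_iff of_nat_numeral of_nat_power)
      then have "0 \<le> real k / N" "real k / N < real (Suc k) / N" "real (Suc k) / N \<le> 1"
        using N by (auto simp: divide_strict_right_mono)
      then have "(F ^^ i) 0 \<le> (F ^^ i) (real k / N)" "(F ^^ i) (real k / N) < (F ^^ i) (real (Suc k) / N)"
        "(F ^^ i) (real (Suc k) / N) \<le> (F ^^ i) (0 + 1)" by (simp_all del: of_nat_Suc)
      then have "\<exists>j\<in>A. \<exists>e\<in>{0, 1}. (F ^^ i) (real k / N) < of_int p + e + j / N + 1 / N \<and>
          of_int p + e + j / N < (F ^^ i) (real (Suc k) / N)"
      proof (intro cantor_lift_growth[OF _ _ _ k(2) A(3)])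
        show "of_int p \<le> (F ^^ i) (real k / N)"
          using \<open>(F ^^ i) 0 \<le> (F ^^ i) (real k / N)\<close> unfolding p_def by linarith
        show "(F ^^ i) (real (Suc k) / N) \<le> of_int p + 2"
          using \<open>(F ^^ i) (real (Suc k) / N) \<le> (F ^^ i) (0 + 1)\<close> unfolding iter_add_1 p_def by linarith
      qed
      then obtain j e where je: "j \<in> A" "e \<in> {0, 1}" "(F ^^ i) (real k / N) < of_int p + e + j / N + 1 / N"
          "of_int p + e + j / N < (F ^^ i) (real (Suc k) / N)" by blast
      define x where "x = X (of_int p + e + j / N)"
      have Fx: "(F ^^ i) x = of_int p + e + j / N" unfolding x_def by (rule X)
      have "x < real (Suc k) / N" using je(4) unfolding Fx[symmetric] by simp
      then have "N * x - 1 < real k" using N by (simp add: field_simps)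
      moreover have "real k < N * x + real L"
      proof (cases "x \<le> real k / N")
        case True
        have "real k / N - x \<le> B * ((F ^^ i) (real k / N) - (F ^^ i) x)" using B(2)[OF True] .
        also have "\<dots> < B * (1 / N)" using je(3) B(1) unfolding Fx by (intro mult_strict_left_mono) auto
        also have "\<dots> \<le> real L / N" using L N by (simp add: divide_right_mono)
        finally have "(real k / N - x) * N < real L / N * N" using N by (rule mult_strict_right_mono)
        moreover have "(real k / N - x) * N = real k - x * N" "real L / N * N = real L"
          using N by (simp_all add: left_diff_distrib)
        ultimately show ?thesis by (simp only: mult.commute[of x N])
      next
        case False
        then have "real k < N * x" using N by (simp add: field_simps)
        then show ?thesis by linarith
      qed
      ultimately have "k \<in> S j e" unfolding S_def x_def by simp
      then show "k \<in> (\<Union>(j, e)\<in>A \<times> {0, 1}. S j e)" using je(1,2) by blast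
    qed
    have "card (growing_cells i m) \<le> card (\<Union>(j, e)\<in>A \<times> {0, 1}. S j e)"
      using A(1) card_nat_in_interval(2) by (intro card_mono[OF _ sub]) (auto simp: S_def)
    also have "\<dots> \<le> (\<Sum>(j, e)\<in>A \<times> {0, 1::real}. card (S j e))"
      using card_UN_le[of "A \<times> {0, 1::real}" "\<lambda>(j, e). S j e"] A(1) by (simp add: case_prod_unfold)
    also have "\<dots> \<le> (\<Sum>(j, e)\<in>A \<times> {0, 1::real}. L + 1)"
      unfolding case_prod_unfold S_def by (intro sum_mono card_nat_in_interval(1))
    also have "\<dots> = (card A * 2) * (L + 1)" by (simp add: card_cartesian_product)
    also have "\<dots> \<le> (2 ^ m * 2) * (L + 1)" using A(2) by (intro mult_right_mono) auto
    finally show ?thesis by (simp add: mult_ac)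
  qed
  then show ?thesis by blast
qed

lemma total_variation_singular:
  assumes D: "\<And>x. ln (D x) = cantor_lift x - x + c"
  shows "total_variation (log_deriv_iter n) 0 1 = ereal (2 * real n)"
proof (rule antisym)
  \<comment> \<open>On the few cells where \<open>G\<close> grows the Lipschitz function \<open>H\<close> hardly does, so almost nothing
    cancels in \<open>G - H\<close>.\<close>
  define G where "G = (\<lambda>x. \<Sum>i<n. cantor_lift ((F ^^ i) x))"
  define H where "H = (\<lambda>x. \<Sum>i<n. (F ^^ i) x)"
  have log: "log_deriv_iter n x = G x - H x + real n * c" for x
    unfolding log_deriv_iter_def D G_def H_def by (simp add: sum.distrib sum_subtractf)
  have G1: "G (x + 1) = G x + real n" and H1: "H (x + 1) = H x + real n" for x
    unfolding G_def H_def iter_add_1 cantor_lift_add_1 by (simp_all add: sum.distrib)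
  have Gm: "mono G" unfolding G_def by (intro monoI sum_mono monoD[OF cantor_lift_mono] monoD[OF mono_iter])
  have Hm: "mono H" unfolding H_def by (intro monoI sum_mono monoD[OF mono_iter])
  have "variation_le (\<lambda>x. (G x + (- H x)) + real n * c) ((real n + real n) + 0)"
    using Gm Hm G1 H1
    by (intro variation_le_add variation_le_const variation_le_uminus variation_le_mono_function) auto
  then have "variation_le (log_deriv_iter n) (2 * real n)"
    using log by (simp add: log[abs_def])
  then show "total_variation (log_deriv_iter n) 0 1 \<le> ereal (2 * real n)"
    using variation_le_imp_total_variation_le[of _ _ 0] by simp
  obtain K where K: "\<And>i m. card (growing_cells i m) \<le> K i * 2 ^ m"
    using choice[of "\<lambda>i K. \<forall>m. card (growing_cells i m) \<le> K * 2 ^ m"] card_growing_cells by blast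
  have "\<forall>i. \<exists>B. 0 < B \<and> (\<forall>x y. x \<le> y \<longrightarrow> (F ^^ i) y - (F ^^ i) x \<le> B * (y - x))"
  proof
    fix i
    show "\<exists>B. 0 < B \<and> (\<forall>x y. x \<le> y \<longrightarrow> (F ^^ i) y - (F ^^ i) x \<le> B * (y - x))"
      using iter_growth[of i] by blast
  qed
  then have "\<exists>B. \<forall>i. 0 < B i \<and> (\<forall>x y. x \<le> y \<longrightarrow> (F ^^ i) y - (F ^^ i) x \<le> B i * (y - x))"
    by (rule choice)
  then obtain B where B0: "\<forall>i. 0 < B i \<and> (\<forall>x y. x \<le> y \<longrightarrow> (F ^^ i) y - (F ^^ i) x \<le> B i * (y - x))"
    by (rule exE)
  note B = B0[THEN spec, THEN conjunct1] B0[THEN spec, THEN conjunct2, rule_format]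
  define K' where "K' = (\<Sum>i<n. K i)"
  define B' where "B' = (\<Sum>i<n. B i)"
  have B'0: "0 \<le> B'" unfolding B'_def by (intro sum_nonneg) (simp add: B(1) less_imp_le)
  have HB: "H y - H x \<le> B' * (y - x)" if "x \<le> y" for x y
    unfolding H_def B'_def sum_distrib_right sum_subtractf[symmetric] using that by (intro sum_mono B(2))
  have lower: "ereal (2 * real n - 2 * B' * real K' * (2 / 3) ^ m) \<le> total_variation (log_deriv_iter n) 0 1" for m
  proof -
    define N where "N = (3::nat) ^ m"
    have N: "0 < N" by (simp add: N_def)
    \<comment> \<open>At most a multiple of 2^m out of 3^m cells, so the Lipschitz function
      \<open>H\<close> gains only a multiple of (2/3)^m on them.\<close>
    define S where "S = {k. k < N \<and> G (real k / N) \<noteq> G (real (Suc k) / N)}"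
    have "S \<subseteq> (\<Union>i<n. growing_cells i m)"
      unfolding S_def G_def N_def growing_cells_def
      by (auto simp del: of_nat_Suc) (meson sum.cong lessThan_iff)
    then have "card S \<le> card (\<Union>i<n. growing_cells i m)"
      by (intro card_mono) (auto simp: growing_cells_def)
    also have "\<dots> \<le> (\<Sum>i<n. K i * 2 ^ m)"
      by (intro order_trans[OF card_UN_le] sum_mono K) simp
    finally have "card S \<le> K' * 2 ^ m" by (simp add: K'_def sum_distrib_right)
    then have card_S: "real (card S) \<le> real K' * 2 ^ m"
      using of_nat_mono[of "card S" "K' * 2 ^ m"] by simp
    have cell: "real k / N \<le> real (Suc k) / N" for k by (simp add: divide_right_mono)
    have incr_sum: "(\<Sum>k<N. incr G N k) = real n" "(\<Sum>k<N. incr H N k) = real n"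
      using incr_refine[OF N, of G 1 0] incr_refine[OF N, of H 1 0] G1[of 0] H1[of 0]
      by (simp_all add: incr_def)
    have "(\<Sum>k\<in>S. incr H N k) \<le> (\<Sum>k\<in>S. B' / N)"
    proof (rule sum_mono)
      fix k
      have "incr H N k \<le> B' * (real (Suc k) / N - real k / N)" unfolding incr_def by (rule HB[OF cell])
      then show "incr H N k \<le> B' / N" by (simp add: diff_divide_distrib[symmetric])
    qed
    also have "\<dots> = real (card S) * (B' / N)" by simp
    also have "\<dots> \<le> (real K' * 2 ^ m) * (B' / N)" using card_S B'0 by (intro mult_right_mono) auto
    also have "\<dots> = B' * real K' * (2 / 3) ^ m" by (simp add: N_def power_divide)
    finally have HS: "(\<Sum>k\<in>S. incr H N k) \<le> B' * real K' * (2 / 3) ^ m" .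
    have fin: "S \<subseteq> {..<N}" "finite {..<N}" by (auto simp: S_def)
    \<comment> \<open>Off \<open>S\<close> the increment of \<open>G\<close> is 0 and that of
      \<open>H\<close> counts fully; on \<open>S\<close> the bound is the increment of
      \<open>G\<close> minus that of \<open>H\<close>.\<close>
    have "2 * real n - 2 * (\<Sum>k\<in>S. incr H N k) = (\<Sum>k<N. incr G N k + incr H N k - (if k \<in> S then 2 * incr H N k else 0))"
      using fin by (simp add: sum_subtractf sum.distrib incr_sum sum.If_cases Int_absorb1 sum_distrib_left)
    also have "\<dots> \<le> (\<Sum>k<N. \<bar>incr G N k - incr H N k\<bar>)"
    proof (rule sum_mono)
      fix k assume "k \<in> {..<N}"
      then have "k \<notin> S \<Longrightarrow> incr G N k = 0" by (simp add: S_def incr_def)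
      moreover have "0 \<le> incr H N k" unfolding incr_def using monoD[OF Hm cell[of k]] by simp
      ultimately show "incr G N k + incr H N k - (if k \<in> S then 2 * incr H N k else 0) \<le> \<bar>incr G N k - incr H N k\<bar>"
        by auto
    qed
    also have "\<dots> = (\<Sum>k<N. \<bar>log_deriv_iter n (real (Suc k) / N) - log_deriv_iter n (real k / N)\<bar>)"
      unfolding log incr_def by (intro sum.cong) (auto simp: algebra_simps)
    finally have "2 * real n - 2 * B' * real K' * (2 / 3) ^ m \<le> (\<Sum>k<N. \<bar>log_deriv_iter n (real (Suc k) / N) - log_deriv_iter n (real k / N)\<bar>)"
      using HS by simp
    moreover have "ereal (\<Sum>k<N. \<bar>log_deriv_iter n (real (Suc k) / N) - log_deriv_iter n (real k / N)\<bar>) \<le> total_variation (log_deriv_iter n) 0 1"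
      using N by (intro total_variation_upper) (auto simp: mono_on_def divide_right_mono)
    ultimately show ?thesis by (meson ereal_less_eq(3) order_trans)
  qed
  have "(\<lambda>m. ereal (2 * real n - 2 * B' * real K' * (2 / 3) ^ m)) \<longlonglongrightarrow> ereal (2 * real n - 2 * B' * real K' * 0)"
    by (intro tendsto_intros LIMSEQ_realpow_zero) auto
  then have "(\<lambda>m. ereal (2 * real n - 2 * B' * real K' * (2 / 3) ^ m)) \<longlonglongrightarrow> ereal (2 * real n)" by simp
  then show "ereal (2 * real n) \<le> total_variation (log_deriv_iter n) 0 1"
    by (rule LIMSEQ_le_const2) (use lower in blast)
qed

end

section \<open>Circle diffeomorphisms from lifts\<close>

lemma circle_lift_exists:
  assumes "continuous_on UNIV F" "\<And>x. F (x + 1) = F x + 1"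
  shows "circle_lift F (\<lambda>p. circle_proj (F (rep_circle p)))"
  unfolding circle_lift_def
proof (intro conjI allI assms(1))
  fix x
  have "rep_circle (circle_proj x) - x \<in> \<int>" by (simp flip: circle_proj_eq_iff)
  then obtain k where "rep_circle (circle_proj x) = x + of_int k" by (metis Ints_cases add_diff_cancel_left' diff_add_cancel add.commute)
  then show "circle_proj (F x) = circle_proj (F (rep_circle (circle_proj x)))"
    using add_of_int[of F 1 x k] assms(2) by (simp add: circle_proj_eq_iff)
qed

context diffeo_lift
begin

lemma inv_F_deriv: "(inv F has_real_derivative 1 / D (inv F y)) (at y)" "continuous_on UNIV (inv F)"
proof -
  have FF: "F (inv F y) = y" "inv F (F x) = x" for x y
    using bij_F by (simp_all add: bij_is_surj surj_f_inv_f bij_is_inj inv_f_f)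
  have "isCont (inv F) (F x)" for x
    by (rule isCont_inverse_function[of 1]) (auto simp: FF intro: DERIV_isCont has_deriv)
  then have cont: "isCont (inv F) y" for y using FF(1)[of y] by metis
  have "(inv F has_real_derivative inverse (D (inv F y))) (at y)"
    by (rule DERIV_inverse_function[where f = F and a = "y - 1" and b = "y + 1"])
       (use D_pos[of "inv F y"] in \<open>auto simp: FF has_deriv cont\<close>)
  then show "(inv F has_real_derivative 1 / D (inv F y)) (at y)" by (simp add: inverse_eq_divide)
  show "continuous_on UNIV (inv F)" using cont by (simp add: continuous_on_eq_continuous_at)
qed

lemma circle_C1_diffeo_from_lift:
  obtains f where "circle_lift F f" "circle_C1_diffeo f"
proof -
  have FF: "F (inv F y) = y" "inv F (F x) = x" for x y
    using bij_F by (simp_all add: bij_is_surj surj_f_inv_f bij_is_inj inv_f_f)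
  define f where "f = (\<lambda>p. circle_proj (F (rep_circle p)))"
  define g where "g = (\<lambda>p. circle_proj (inv F (rep_circle p)))"
  have f: "circle_lift F f" unfolding f_def by (rule circle_lift_exists[OF cont_F F_add_1])
  have "inv F (y + 1) = inv F y + 1" for y by (metis FF F_add_1)
  then have g: "circle_lift (inv F) g" unfolding g_def by (rule circle_lift_exists[OF inv_F_deriv(2)])
  have fg: "f (g p) = p" "g (f p) = p" for p
    using f g FF unfolding circle_lift_def by (metis circle_proj_rep)+
  then have bij: "bij f" by (metis bijI')
  have "inv f = g" using fg by (intro inv_equality) auto
  moreover have "F C1_differentiable_on UNIV"
    unfolding C1_differentiable_on_def using has_deriv cont_D
    by (auto simp: has_real_derivative_iff_has_vector_derivative)
  moreover have "inv F C1_differentiable_on UNIV"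
    unfolding C1_differentiable_on_def
  proof (intro exI[of _ "\<lambda>y. 1 / D (inv F y)"] conjI ballI)
    show "(inv F has_vector_derivative 1 / D (inv F y)) (at y)" for y
      using inv_F_deriv(1) by (simp add: has_real_derivative_iff_has_vector_derivative)
    show "continuous_on UNIV (\<lambda>y. 1 / D (inv F y))"
      using D_pos by (intro continuous_on_divide continuous_on_compose2[OF cont_D inv_F_deriv(2)] continuous_on_const)
        (auto simp: less_imp_neq[symmetric])
  qed
  moreover have "circle_deriv f p > 0" for p
    using circle_deriv_lift[OF f, of "rep_circle p"] D_pos by simp
  ultimately have "circle_C1_diffeo f"
    unfolding circle_C1_diffeo_def circle_C1_def using bij f g by blast
  then show ?thesis using f that by blast
qed

end

section \<open>Irrational rotation numbers in a family of rigid translates\<close>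

text \<open>The translation number is a uniform limit in \<open>t\<close>, with error 1 / n after
  \<open>n\<close> iterates, hence continuous. It grows by 1 as \<open>t\<close> runs from 0 to 1,
  so the intermediate value theorem reaches an irrational.\<close>

lemma translation_number_translate_irrational:
  assumes "diffeo_lift E D"
  obtains t where "translation_number (\<lambda>x. t + E x) \<notin> \<rat>"
proof -
  define T where "T = (\<lambda>t x. t + E x)"
  have lift: "diffeo_lift (T t) D" for t
    using assms unfolding diffeo_lift_def T_def by (auto intro!: derivative_eq_intros)
  have E: "continuous_on UNIV E" "\<And>x. E (x + 1) = E x + 1"
    using diffeo_lift.cont_F[OF assms] diffeo_lift.F_add_1[OF assms] by auto
  have iter_cont: "continuous_on UNIV (\<lambda>t. (T t ^^ n) 0)" for n
  proof (induction n)
    case (Suc n)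
    have "continuous_on UNIV (\<lambda>t. t + E ((T t ^^ n) 0))"
      by (intro continuous_intros continuous_on_compose2[OF E(1) Suc]) auto
    then show ?case by (simp add: T_def)
  qed simp
  have "uniform_limit UNIV (\<lambda>n t. (T t ^^ n) 0 / real n) (\<lambda>t. translation_number (T t)) sequentially"
  proof (rule uniform_limitI)
    fix e :: real assume e: "0 < e"
    have "\<forall>\<^sub>F n in sequentially. 1 / real n < e \<and> 0 < n"
      using order_tendstoD(2)[OF lim_1_over_n e] eventually_gt_at_top[of 0] by (rule eventually_conj)
    then show "\<forall>\<^sub>F n in sequentially. \<forall>t\<in>UNIV. dist ((T t ^^ n) 0 / real n) (translation_number (T t)) < e"
    proof eventually_elim
      case (elim n)
      have "\<bar>(T t ^^ n) 0 / real n - translation_number (T t)\<bar> < e" for t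
      proof -
        have "\<bar>(T t ^^ n) 0 - real n * translation_number (T t)\<bar> / real n \<le> 1 / real n"
          by (intro divide_right_mono diffeo_lift.translation_number_bound[OF lift]) simp
        moreover have "\<bar>(T t ^^ n) 0 - real n * translation_number (T t)\<bar> / real n = \<bar>(T t ^^ n) 0 / real n - translation_number (T t)\<bar>"
        proof -
          have "(T t ^^ n) 0 / real n - translation_number (T t) = ((T t ^^ n) 0 - real n * translation_number (T t)) / real n"
            using elim by (simp add: field_simps)
          then show ?thesis by simp
        qed
        ultimately show ?thesis using elim by linarith
      qed
      then show ?case by (simp add: dist_real_def)
    qed
  qed
  then have cont: "continuous_on UNIV (\<lambda>t. translation_number (T t))"
    by (rule uniform_limit_theorem[rotated])
       (auto simp: divide_inverse intro!: always_eventually continuous_intros iter_cont)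
  have "(T 1 ^^ n) 0 = (T 0 ^^ n) 0 + of_int (int n)" for n
  proof (induction n)
    case (Suc n)
    then show ?case using add_of_int[of E 1 "(T 0 ^^ n) 0" "int n"] E(2) by (simp add: T_def)
  qed simp
  then have "(\<lambda>n. (T 1 ^^ n) 0 / real n - (T 0 ^^ n) 0 / real n) = (\<lambda>n. real n / real n)"
    by (simp add: add_divide_distrib)
  moreover have "(\<lambda>n. (T 1 ^^ n) 0 / real n - (T 0 ^^ n) 0 / real n) \<longlonglongrightarrow> translation_number (T 1) - translation_number (T 0)"
    by (intro tendsto_diff diffeo_lift.translation_number_lim[OF lift])
  moreover have "(\<lambda>n. real n / real n) \<longlonglongrightarrow> 1"
    by (rule tendsto_eventually) (use eventually_gt_at_top[of 0] in eventually_elim, simp)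
  ultimately have one: "translation_number (T 1) = translation_number (T 0) + 1"
    using LIMSEQ_unique by fastforce
  have "uncountable {translation_number (T 0)<..<translation_number (T 0) + 1}"
    by (simp add: uncountable_open_interval)
  then have "\<not> {translation_number (T 0)<..<translation_number (T 0) + 1} \<subseteq> \<rat>"
    using countable_rat countable_subset by blast
  then obtain y where "translation_number (T 0) < y" "y < translation_number (T 0) + 1" and irr: "y \<notin> \<rat>"
    by (meson greaterThanLessThan_iff subsetI)
  then have y: "translation_number (T 0) \<le> y" "y \<le> translation_number (T 1)" "y \<notin> \<rat>"
    unfolding one by auto
  obtain t where "translation_number (T t) = y"
    using IVT'[of "\<lambda>t. translation_number (T t)" 0 y 1] y(1,2) continuous_on_subset[OF cont] by auto
  then show ?thesis using y(3) that[of t] by (auto simp: T_def)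
qed

theorem nonvanishing_asymptotic_distortion:
  "\<exists>f. circle_C1bv_diffeo f \<and> irrational_rotation_number f \<and> asymptotic_distortion f \<noteq> 0"
proof -
  define b where "b = (\<lambda>x. exp (cantor_lift x - x))"
  have b: "continuous_on UNIV b" "\<And>x. b (x + 1) = b x" "\<And>x. 0 < b x"
    unfolding b_def by (auto intro!: continuous_on_exp cantor_lift_minus_id_cont simp: cantor_lift_add_1)
  obtain E0 where E0: "\<And>x. (E0 has_real_derivative b x) (at x)" using antiderivative_exists[OF b(1)] by blast
  \<comment> \<open>Dividing by the integral of \<open>b\<close> over a period makes the lift of
    degree one and changes the logarithm of the derivative only by a constant.\<close>
  define \<kappa> where "\<kappa> = E0 1 - E0 0"
  have E0_less: "E0 0 < E0 1" by (rule DERIV_pos_imp_increasing) (use E0 b(3) in auto)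
  then have \<kappa>: "0 < \<kappa>" by (simp add: \<kappa>_def)
  have E0_1: "E0 (x + 1) = E0 x + \<kappa>" for x
    unfolding \<kappa>_def by (rule antiderivative_add_1[OF E0 b(2)])
  define D where "D = (\<lambda>x. b x / \<kappa>)"
  have lift0: "diffeo_lift (\<lambda>x. t + E0 x / \<kappa>) D" for t
  proof
    show "((\<lambda>x. t + E0 x / \<kappa>) has_real_derivative D x) (at x)" for x
      unfolding D_def using DERIV_add[OF DERIV_const DERIV_cdivide[OF E0[of x], of \<kappa>], of t] by simp
    show "continuous_on UNIV D" unfolding D_def using b(1) \<kappa> by (intro continuous_intros) auto
    show "0 < D x" for x unfolding D_def using b(3) \<kappa> by simp
    show "t + E0 (x + 1) / \<kappa> = t + E0 x / \<kappa> + 1" for x using \<kappa> by (simp add: E0_1 add_divide_distrib)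
  qed
  have lift00: "diffeo_lift (\<lambda>x. E0 x / \<kappa>) D" using lift0[of 0] by simp
  obtain t where t: "translation_number (\<lambda>x. t + E0 x / \<kappa>) \<notin> \<rat>"
    using translation_number_translate_irrational[OF lift00] by blast
  define F where "F = (\<lambda>x. t + E0 x / \<kappa>)"
  interpret diffeo_lift F D unfolding F_def by (rule lift0)
  obtain f where f: "circle_lift F f" "circle_C1_diffeo f" by (rule circle_C1_diffeo_from_lift)
  have "ln (D x) = cantor_lift x - x + (- ln \<kappa>)" for x
    using \<kappa> by (simp add: D_def b_def ln_div)
  then have var: "total_variation (log_deriv_iter n) 0 1 = ereal (2 * real n)" for n
    by (rule total_variation_singular)
  have cvar: "circle_variation (\<lambda>p. ln (circle_deriv (f ^^ n) p)) = ereal (2 * real n)" for n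
    using var[of n] unfolding circle_variation_ln_deriv[OF f(1)] log_deriv_iter_def[abs_def] .
  have "circle_C1bv_diffeo f"
    using f(2) cvar[of 1] by (simp add: circle_C1bv_diffeo_def)
  moreover have "irrational_rotation_number f" using rotation_number_lift[OF f(1)] t by (simp add: F_def)
  moreover have "asymptotic_distortion f = 2"
  proof -
    have "(\<lambda>n. real_of_ereal (circle_variation (\<lambda>p. ln (circle_deriv (f ^^ n) p))) / real n) \<longlonglongrightarrow> 2"
      unfolding cvar by (rule tendsto_eventually) (use eventually_gt_at_top[of 0] in eventually_elim, simp)
    then show ?thesis unfolding asymptotic_distortion_def by (rule limI)
  qed
  ultimately show ?thesis by auto
qed

theorem theorem2:
  shows "(\<forall>f. circle_C1bv_diffeo f \<and> irrational_rotation_number f \<and>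
              circle_absolutely_continuous (circle_deriv f)
              \<longrightarrow> asymptotic_distortion f = 0) \<and>
         (\<exists>f. circle_C1bv_diffeo f \<and> irrational_rotation_number f \<and>
              asymptotic_distortion f \<noteq> 0)"
  using asymptotic_distortion_absolutely_continuous nonvanishing_asymptotic_distortion by blast

end
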